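(* Let $(X_k)_{k\in\mathbf{Z}}$ be a stationary causal process $X_k=G(\ldots,\varepsilon_{k-1},\varepsilon_k)$ with mean zero. Assume that $(X_k)$ satisfies GMC($\alpha$) for some $\alpha>0$, that $X_k\in\mathcal{L}^{4+\delta}$ for some $\delta\in(0,4]$, that $B_n\to\infty$ and $B_n=O(n^\eta)$ for some $0<\eta<\delta/(4+\delta)$, and that $f_*:=\min_{\theta\in\mathbf{R}}f(\theta)>0$. Then, as $n\to\infty$, $$\max_{\lambda\in[0,\pi]}\sqrt{nb_n}\,|f_n(\lambda)-\mathbf{E}(f_n(\lambda))|=O_{\mathbf{P}}\bigl((\log n)^{1/2}\bigr).$$
   Context: $(\varepsilon_k)_{k\in\mathbf{Z}}$ are i.i.d. and $G$ is a measurable function such that $X_k=G(\ldots,\varepsilon_{k-1},\varepsilon_k)$ is a proper random variable. $\xi\in\mathcal{L}^p$ means $\mathbf{E}(|\xi|^p)<\infty$. GMC($\alpha$) (geometric-moment contraction): with $(\varepsilon'_k)_{k\in\mathbf{Z}}$ an i.i.d. copy of $(\varepsilon_k)_{k\in\mathbf{Z}}$ (independent of it) and $X_n'=G(\ldots,\varepsilon'_{-1},\varepsilon'_0,\varepsilon_1,\ldots,\varepsilon_n)$, there exist $C>0$ and $0<\rho<1$ such that $\mathbf{E}(|X_n'-X_n|^\alpha)\le C\rho^n$ for all $n\in\mathbf{N}$. Let $r(k)=\mathbf{E}(X_0X_k)$ and let $f(\lambda)=\frac1{2\pi}\sum_{k\in\mathbf{Z}}r(k)e^{ik\lambda}$ be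 the spectral density. Let $\hat r(k)=n^{-1}\sum_{j=1}^{n-|k|}X_jX_{j+|k|}$ for $|k|<n$. Let $a(\cdot)$ be an even, Lipschitz continuous function with support $[-1,1]$ and $a(0)=1$; $B_n$ is a sequence of positive integers with $B_n\to\infty$ and $B_n/n\to0$; $b_n=1/B_n$; and $$f_n(\lambda)=\frac1{2\pi}\sum_{k=-B_n}^{B_n}\hat r(k)a(kb_n)e^{-ik\lambda}.$$ *)

theory Defs
  imports "HOL-Probability.Probability" "HOL-Library.Landau_Symbols"
begin

definition iid :: "'a measure \<Rightarrow> 's measure \<Rightarrow> ('i \<Rightarrow> 'a \<Rightarrow> 's) \<Rightarrow> bool" where
  "iid M S \<epsilon> \<longleftrightarrow>
     prob_space.indep_vars M (\<lambda>_. S) \<epsilon> UNIV \<and>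
     (\<forall>i j. distr M S (\<epsilon> i) = distr M S (\<epsilon> j))"

text \<open>The one-sided sequence \<open>(\<dots>, \<epsilon>\<^sub>k\<^sub>-\<^sub>1, \<epsilon>\<^sub>k)\<close> is passed to \<open>G\<close> read backwards in time:
  its entry number \<open>j\<close> is the innovation at time \<open>k - j\<close>.\<close>

definition causal_process ::
    "((nat \<Rightarrow> 's) \<Rightarrow> real) \<Rightarrow> (int \<Rightarrow> 'a \<Rightarrow> 's) \<Rightarrow> int \<Rightarrow> 'a \<Rightarrow> real" where
  "causal_process G \<epsilon> k \<omega> = G (\<lambda>j. \<epsilon> (k - int j) \<omega>)"

text \<open>The innovations and their independent copy are realised on the product space
  \<open>M \<Otimes>\<^sub>M M\<close> as \<open>\<epsilon>\<^sub>k(\<omega>)\<close> and \<open>\<epsilon>'\<^sub>k = \<epsilon>\<^sub>k(\<omega>')\<close>, so that \<open>M\<close> itself need not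
  carry the copy. The moments below depend only on the joint law of the two sequences.\<close>

definition coupled_innovations :: "(int \<Rightarrow> 'a \<Rightarrow> 's) \<Rightarrow> int \<Rightarrow> 'a \<times> 'a \<Rightarrow> 's" where
  "coupled_innovations \<epsilon> k = (\<lambda>(\<omega>, \<omega>'). if k \<ge> 1 then \<epsilon> k \<omega> else \<epsilon> k \<omega>')"

text \<open>The expectation is taken as a nonnegative integral, so that the bound includes its finiteness.\<close>

definition GMC ::
    "'a measure \<Rightarrow> ((nat \<Rightarrow> 's) \<Rightarrow> real) \<Rightarrow> (int \<Rightarrow> 'a \<Rightarrow> 's) \<Rightarrow> real \<Rightarrow> bool" where
  "GMC M G \<epsilon> \<alpha> \<longleftrightarrow>
     (\<exists>C>0. \<exists>\<rho>. 0 < \<rho> \<and> \<rho> < 1 \<and>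
       (\<forall>n::nat. n \<ge> 1 \<longrightarrow>
         (\<integral>\<^sup>+ z. ennreal (\<bar>causal_process G (coupled_innovations \<epsilon>) (int n) z
                      - causal_process G \<epsilon> (int n) (fst z)\<bar> powr \<alpha>) \<partial>(M \<Otimes>\<^sub>M M))
           \<le> ennreal (C * \<rho> ^ n)))"

definition autocov :: "'a measure \<Rightarrow> (int \<Rightarrow> 'a \<Rightarrow> real) \<Rightarrow> int \<Rightarrow> real" where
  "autocov M X k = (\<integral>\<omega>. X 0 \<omega> * X k \<omega> \<partial>M)"

text \<open>For a stationary process the value is real, since then \<open>autocov\<close> is even.\<close>

definition spectral_density :: "'a measure \<Rightarrow> (int \<Rightarrow> 'a \<Rightarrow> real) \<Rightarrow> real \<Rightarrow> complex" where
  "spectral_density M X \<theta> =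
     1 / (2 * of_real pi) *
     (\<Sum>\<^sub>\<infinity>k\<in>UNIV. of_real (autocov M X k) * exp (\<i> * of_int k * of_real \<theta>))"

text \<open>The summation range is an interval of integers, so the value is 0 when \<open>\<bar>k\<bar> \<ge> n\<close>.\<close>

definition sample_autocov :: "(int \<Rightarrow> 'a \<Rightarrow> real) \<Rightarrow> nat \<Rightarrow> int \<Rightarrow> 'a \<Rightarrow> real" where
  "sample_autocov X n k \<omega> = 1 / real n * (\<Sum>j = 1..int n - \<bar>k\<bar>. X j \<omega> * X (j + \<bar>k\<bar>) \<omega>)"

definition spectral_estimate ::
    "(real \<Rightarrow> real) \<Rightarrow> (nat \<Rightarrow> nat) \<Rightarrow> (int \<Rightarrow> 'a \<Rightarrow> real) \<Rightarrow> nat \<Rightarrow> real \<Rightarrow> 'a \<Rightarrow> complex" where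
  "spectral_estimate a B X n \<theta> \<omega> =
     1 / (2 * of_real pi) *
     (\<Sum>k = - int (B n)..int (B n).
        of_real (sample_autocov X n k \<omega> * a (of_int k * (1 / real (B n)))) *
        exp (- (\<i> * of_int k * of_real \<theta>)))"

text \<open>\<open>Z\<^sub>n = O\<^sub>P(r\<^sub>n)\<close>. Measurability is part of the definition because \<open>measure\<close> is 0
  on sets that are not measurable.\<close>

definition bigO_in_prob :: "'a measure \<Rightarrow> (nat \<Rightarrow> 'a \<Rightarrow> real) \<Rightarrow> (nat \<Rightarrow> real) \<Rightarrow> bool" where
  "bigO_in_prob M Z r \<longleftrightarrow>
     (\<forall>n. Z n \<in> borel_measurable M) \<and>
     (\<forall>\<eta>>0. \<exists>K>0. \<forall>\<^sub>F n in sequentially.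
        measure M {\<omega> \<in> space M. \<bar>Z n \<omega>\<bar> > K * r n} \<le> \<eta>)"

end

(*
  On a grid of 4 B_n frequencies, a discrete Fourier expansion of the modulated lag window with
  absolutely bounded coefficients reduces the supremum over all frequencies to a maximum over
  sums of products of linear forms: each product pairs a block of length B_n with its neighbouring
  blocks. Freezing the remote past of the innovations gives finitely dependent approximations at
  every range k, whose increments decay geometrically in L^q for some 4 < q < 4 + delta. Summing
  Rosenthal type bounds over the ranges controls linear forms in L^q, hence the products and their
  partial sums in L^(q/2) with sharp order. Superblocks of logarithmic length are independent for
  equal parity; truncation at sqrt(n B_n / log n) together with an exponential inequality and a
  union bound over the grid concludes, and the truncation error is negligible precisely because
  eta < 1 - 4/q.
*)
theory Submission
  imports Defs "HOL-Real_Asymp.Real_Asymp"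
begin

section \<open>Moment bounds\<close>

text \<open>At one frequency the centred estimate is a sum of about n/B products, each of size B in
  L^(q/2), so its scale is sqrt (n B). About B frequencies compete, so each exceedance must have
  probability o(1/B). Markov's inequality for the whole sum gains only a power of log n; hence the
  truncation. With T = sqrt (n B / log n) the truncation loss times B is n (B/n)^(q/4) up to
  logarithms, and B = O(n^\<eta>) turns its vanishing into \<eta> < 1 - 4/q. The right side tends to
  \<delta> / (4 + \<delta>) as q increases to 4 + \<delta>, so some q strictly below that value
  suffices. Strictness matters: contraction of order \<alpha> reaches order q by interpolation
  against the moment of order 4 + \<delta>, and the endpoint is lost. Moment inequalities for
  quadratic forms are avoided. A character at i - j factors into one at i and a conjugate one at j;
  with the window expanded in characters and every block summed against a fixed neighbourhood, only
  products of two linear forms remain, and Cauchy-Schwarz handles these.\<close>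

lemma exp_le_quadratic:
  fixes x :: real
  assumes "x \<le> 1"
  shows "exp x \<le> 1 + x + x\<^sup>2"
proof (cases "0 \<le> x")
  case True
  then show ?thesis using exp_bound[of x] assms by simp
next
  case False
  define y where "y = - x"
  have y: "0 < y" using False by (simp add: y_def)
  have pos: "0 < 1 + y + y\<^sup>2 / 2" using y by (simp add: add_pos_nonneg)
  \<comment> \<open>For negative x: the product identity shows that 1 - y + y^2 dominates the
    reciprocal of the quadratic Taylor minorant of \<open>exp y\<close>.\<close>
  have "1 \<le> 1 + y\<^sup>2 / 2 + y ^ 3 / 2 + y ^ 4 / 2" using y by simp
  also have "\<dots> = (1 - y + y\<^sup>2) * (1 + y + y\<^sup>2 / 2)"
    by (simp add: field_simps power2_eq_square power3_eq_cube power4_eq_xxxx)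
  finally have "1 / (1 + y + y\<^sup>2 / 2) \<le> 1 - y + y\<^sup>2"
    using pos by (simp add: field_simps)
  moreover have "exp x \<le> 1 / (1 + y + y\<^sup>2 / 2)"
  proof -
    have "exp x = 1 / exp y" by (simp add: y_def exp_minus field_simps)
    also have "\<dots> \<le> 1 / (1 + y + y\<^sup>2 / 2)"
      using exp_lower_Taylor_quadratic[of y] y pos by (intro divide_left_mono) auto
    finally show ?thesis .
  qed
  ultimately show ?thesis by (simp add: y_def)
qed

text \<open>Large enough for both regimes of the expansion of |1 + t|^p: \<open>p\<^sup>2\<close> is
  the quadratic coefficient for small t, and \<open>(1 + p) powr p\<close> comes from |1 + t| <= (1
  + p) |t| once |t| > 1 / p.\<close>

definition powr_const :: "real \<Rightarrow> real"
  where "powr_const p = (1 + p) powr p + p\<^sup>2"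

lemma powr_const_ge_1: "0 \<le> p \<Longrightarrow> 1 \<le> powr_const p"
  by (simp add: powr_const_def add_increasing2 ge_one_powr_ge_zero)

text \<open>For |t| <= 1 / p, write the power as an exponential and use ln (1 + t) <= t together
  with the quadratic bound on \<open>exp\<close>. For larger t the power is absorbed by |t|^p, and a
  negative linear term by p^2 t^2, because 1 < p |t|.\<close>

lemma powr_one_add_le:
  fixes p t :: real
  assumes "p > 2"
  shows "\<bar>1 + t\<bar> powr p \<le> 1 + p * t + powr_const p * (t\<^sup>2 + \<bar>t\<bar> powr p)"
proof (cases "\<bar>t\<bar> \<le> 1 / p")
  case True
  have pt: "\<bar>p * t\<bar> \<le> 1" using True assms by (simp add: abs_mult field_simps)
  have "1 / p < 1" using assms by simp
  then have t: "1 + t > 0" using True by linarith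
  have "\<bar>1 + t\<bar> powr p = exp (p * ln (1 + t))" using t by (simp add: powr_def)
  also have "\<dots> \<le> exp (p * t)"
    using t assms ln_le_minus_one[of "1 + t"] by simp
  also have "\<dots> \<le> 1 + p * t + (p * t)\<^sup>2"
    using pt by (intro exp_le_quadratic) auto
  also have "(p * t)\<^sup>2 \<le> powr_const p * (t\<^sup>2 + \<bar>t\<bar> powr p)"
  proof -
    have "(p * t)\<^sup>2 \<le> powr_const p * t\<^sup>2"
      by (simp add: powr_const_def power_mult_distrib mult_right_mono)
    also have "\<dots> \<le> powr_const p * (t\<^sup>2 + \<bar>t\<bar> powr p)"
      using powr_const_ge_1[of p] assms by (intro mult_left_mono) auto
    finally show ?thesis .
  qed
  finally show ?thesis by simp
next
  case False
  then have t: "1 < p * \<bar>t\<bar>" using assms by (simp add: field_simps)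
  have "\<bar>1 + t\<bar> \<le> (1 + p) * \<bar>t\<bar>"
    using t by (simp add: algebra_simps)
  then have "\<bar>1 + t\<bar> powr p \<le> ((1 + p) * \<bar>t\<bar>) powr p"
    using assms by (intro powr_mono2) auto
  also have "\<dots> = (1 + p) powr p * \<bar>t\<bar> powr p" using assms by (simp add: powr_mult)
  finally have 1: "\<bar>1 + t\<bar> powr p \<le> (1 + p) powr p * \<bar>t\<bar> powr p" .
  have "- (p * t) \<le> p * \<bar>t\<bar> * 1" using assms by (auto simp: abs_if)
  also have "\<dots> \<le> p * \<bar>t\<bar> * (p * \<bar>t\<bar>)" using t assms by (intro mult_left_mono) auto
  also have "\<dots> = p\<^sup>2 * t\<^sup>2" by (simp add: power2_eq_square)
  finally have 2: "- (p * t) \<le> p\<^sup>2 * t\<^sup>2" .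
  have 3: "0 \<le> (1 + p) powr p * t\<^sup>2" "0 \<le> p\<^sup>2 * \<bar>t\<bar> powr p" by auto
  show ?thesis using 1 2 3 unfolding powr_const_def distrib_left distrib_right by linarith
qed

text \<open>The previous expansion at t = y / x, scaled by |x|^p. The linear term keeps its sign, so
  that its expectation can vanish later.\<close>

lemma powr_abs_add_le:
  fixes p x y :: real
  assumes "p > 2"
  shows "\<bar>x + y\<bar> powr p \<le> \<bar>x\<bar> powr p + p * (\<bar>x\<bar> powr (p - 1) * sgn x) * y
           + powr_const p * (\<bar>x\<bar> powr (p - 2) * y\<^sup>2 + \<bar>y\<bar> powr p)"
proof (cases "x = 0")
  case True
  then show ?thesis using powr_const_ge_1[of p] assms
    mult_right_mono[of 1 "powr_const p" "\<bar>y\<bar> powr p"] by simp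
next
  case False
  have a: "\<bar>x\<bar> powr p = \<bar>x\<bar> powr (p - 1) * \<bar>x\<bar>"
    using False powr_add[of "\<bar>x\<bar>" "p - 1" 1] by simp
  have b: "\<bar>x\<bar> powr p = \<bar>x\<bar> powr (p - 2) * x\<^sup>2"
    using False powr_add[of "\<bar>x\<bar>" "p - 2" 2] by simp
  have "\<bar>x + y\<bar> powr p = \<bar>x\<bar> powr p * \<bar>1 + y / x\<bar> powr p"
    using False by (simp flip: powr_mult abs_mult add: distrib_left)
  also have "\<dots> \<le> \<bar>x\<bar> powr p * (1 + p * (y / x) + powr_const p * ((y / x)\<^sup>2 + \<bar>y / x\<bar> powr p))"
    using powr_one_add_le[OF assms, of "y / x"] by (rule mult_left_mono) auto
  also have "\<dots> = \<bar>x\<bar> powr p + p * (\<bar>x\<bar> powr p * (y / x))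
      + powr_const p * (\<bar>x\<bar> powr p * (y / x)\<^sup>2 + \<bar>x\<bar> powr p * \<bar>y / x\<bar> powr p)"
    by (simp add: algebra_simps)
  also have "\<bar>x\<bar> powr p * (y / x) = \<bar>x\<bar> powr (p - 1) * sgn x * y"
    using False by (simp add: a sgn_if)
  also have "\<bar>x\<bar> powr p * (y / x)\<^sup>2 = \<bar>x\<bar> powr (p - 2) * y\<^sup>2"
    using False by (simp add: b power_divide)
  also have "\<bar>x\<bar> powr p * \<bar>y / x\<bar> powr p = \<bar>y\<bar> powr p"
    using False by (simp add: powr_divide)
  finally show ?thesis by (simp add: mult.assoc)
qed

text \<open>The endpoint 0 has to be included because random variables may vanish; there convexity
  reduces to s^p <= s for 0 < s < 1.\<close>

lemma powr_convex_atLeast: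
  fixes p :: real
  assumes "1 \<le> p"
  shows "convex_on {0..} (\<lambda>x::real. x powr p)"
proof (rule convex_onI)
  fix t x y :: real
  assume t: "0 < t" "t < 1" and xy: "x \<in> {0..}" "y \<in> {0..}"
  have le: "s powr p \<le> s" if "0 < s" "s < 1" for s :: real
    using powr_mono'[of 1 p s] that assms by simp
  have zero: "(s * z) powr p \<le> s * z powr p" if "0 < s" "s < 1" "0 \<le> z" for s z :: real
    using that mult_right_mono[OF le[of s], of "z powr p"] by (simp add: powr_mult)
  show "((1 - t) *\<^sub>R x + t *\<^sub>R y) powr p \<le> (1 - t) * x powr p + t * y powr p"
  proof (cases "x = 0 \<or> y = 0")
    case True
    then show ?thesis using zero[of t y] zero[of "1 - t" x] t xy by auto
  next
    case False
    then show ?thesis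
      using convex_onD[OF powr_convex[OF assms], of t x y] t xy by auto
  qed
qed simp

text \<open>A cheap form of Young's inequality: replace both bases by the larger one.\<close>

lemma powr_mult_le_add:
  fixes u v p :: real
  assumes "0 \<le> u" "0 \<le> v" "0 \<le> b" "0 \<le> c" "b + c = p" "0 < p"
  shows "u powr b * v powr c \<le> u powr p + v powr p"
proof -
  define w where "w = max u v"
  have "u powr b * v powr c \<le> w powr b * w powr c"
    unfolding w_def using assms by (intro mult_mono powr_mono2) auto
  also have "\<dots> = w powr p" using assms by (simp flip: powr_add)
  also have "\<dots> \<le> u powr p + v powr p"
    unfolding w_def by (simp add: max_def)
  finally show ?thesis .
qed

lemma le_one_add_powr:
  fixes u b p :: real
  assumes "0 \<le> u" "0 < b" "b \<le> p"
  shows "u powr b \<le> 1 + u powr p"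
  using powr_mult_le_add[of u 1 b "p - b" p] assms by simp

text \<open>The L^p norm of Z is at most c, stated without a p-th root. Integrability is included
  because the Bochner integral of a non-integrable function is 0.\<close>

definition moment_le :: "'a measure \<Rightarrow> real \<Rightarrow> ('a \<Rightarrow> real) \<Rightarrow> real \<Rightarrow> bool" where
  "moment_le M p Z c \<longleftrightarrow> Z \<in> borel_measurable M \<and> integrable M (\<lambda>\<omega>. \<bar>Z \<omega>\<bar> powr p)
     \<and> (\<integral>\<omega>. \<bar>Z \<omega>\<bar> powr p \<partial>M) \<le> c powr p"

lemma moment_leD:
  assumes "moment_le M p Z c"
  shows "Z \<in> borel_measurable M" "integrable M (\<lambda>\<omega>. \<bar>Z \<omega>\<bar> powr p)"
    "(\<integral>\<omega>. \<bar>Z \<omega>\<bar> powr p \<partial>M) \<le> c powr p"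
  using assms by (auto simp: moment_le_def)

lemma moment_leI:
  assumes "Z \<in> borel_measurable M" "integrable M W" "\<And>\<omega>. \<omega> \<in> space M \<Longrightarrow> \<bar>Z \<omega>\<bar> powr p \<le> W \<omega>"
    "(\<integral>\<omega>. W \<omega> \<partial>M) \<le> c powr p"
  shows "moment_le M p Z c"
proof -
  have i: "integrable M (\<lambda>\<omega>. \<bar>Z \<omega>\<bar> powr p)"
    by (rule Bochner_Integration.integrable_bound[OF assms(2)])
       (use assms in \<open>auto intro!: AE_I2 order.trans[OF _ abs_ge_self]\<close>)
  moreover have "(\<integral>\<omega>. \<bar>Z \<omega>\<bar> powr p \<partial>M) \<le> (\<integral>\<omega>. W \<omega> \<partial>M)"
    using assms i by (intro integral_mono) auto
  ultimately show ?thesis using assms by (simp add: moment_le_def)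
qed

lemma moment_le_mono:
  "moment_le M p Z c \<Longrightarrow> 0 \<le> c \<Longrightarrow> c \<le> d \<Longrightarrow> 0 < p \<Longrightarrow> moment_le M p Z d"
  unfolding moment_le_def using powr_mono2[of p c d] by auto

lemma moment_le_cmult:
  assumes "moment_le M p Z c" "0 \<le> c" "0 < p"
  shows "moment_le M p (\<lambda>\<omega>. k * Z \<omega>) (\<bar>k\<bar> * c)"
  using assms mult_left_mono[of "\<integral>\<omega>. \<bar>Z \<omega>\<bar> powr p \<partial>M" "c powr p" "\<bar>k\<bar> powr p"]
  by (auto simp: moment_le_def abs_mult powr_mult)

lemma moment_le_cmult_le:
  assumes "moment_le M p Z c" "0 \<le> c" "0 < p" "\<bar>k\<bar> \<le> 1"
  shows "moment_le M p (\<lambda>\<omega>. k * Z \<omega>) c"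
proof (rule moment_le_mono[OF moment_le_cmult[OF assms(1-3)]])
  show "\<bar>k\<bar> * c \<le> c" using assms mult_right_mono[of "\<bar>k\<bar>" 1 c] by simp
qed (use assms in auto)

lemma moment_le_zero: "0 < p \<Longrightarrow> moment_le M p (\<lambda>_. 0) c"
  by (simp add: moment_le_def)

lemma moment_le_scale:
  assumes "moment_le M p Z c" "0 < c"
  shows "integrable M (\<lambda>\<omega>. (\<bar>Z \<omega>\<bar> / c) powr p)" "(\<integral>\<omega>. (\<bar>Z \<omega>\<bar> / c) powr p \<partial>M) \<le> 1"
  using assms by (auto simp: moment_le_def powr_divide)

text \<open>Minkowski's inequality, obtained from the convexity of \<open>\<bar>\<cdot>\<bar> powr p\<close> by
  giving the summand \<open>Z k\<close> the weight \<open>c k / (\<Sum>k\<in>F. c k)\<close>.\<close>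

lemma moment_le_sum:
  assumes F: "finite F" and p: "1 \<le> p"
    and Z: "\<And>k. k \<in> F \<Longrightarrow> moment_le M p (Z k) (c k)" and c: "\<And>k. k \<in> F \<Longrightarrow> 0 < c k"
  shows "moment_le M p (\<lambda>\<omega>. \<Sum>k\<in>F. Z k \<omega>) (\<Sum>k\<in>F. c k)"
proof (cases "F = {}")
  case True
  then show ?thesis using p by (simp add: moment_le_zero)
next
  case False
  define s where "s = (\<Sum>k\<in>F. c k)"
  have s: "0 < s" unfolding s_def using F False c by (intro sum_pos) auto
  define W where "W = (\<lambda>\<omega>. s powr p * (\<Sum>k\<in>F. c k / s * (\<bar>Z k \<omega>\<bar> / c k) powr p))"
  have "moment_le M p (\<lambda>\<omega>. \<Sum>k\<in>F. Z k \<omega>) s"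
  proof (rule moment_leI)
    show "(\<lambda>\<omega>. \<Sum>k\<in>F. Z k \<omega>) \<in> borel_measurable M"
      using Z by (intro borel_measurable_sum) (auto simp: moment_le_def)
    show "integrable M W" unfolding W_def
      using moment_le_scale(1)[OF Z c] by (intro integrable_mult_right Bochner_Integration.integrable_sum)
    have "(\<integral>\<omega>. W \<omega> \<partial>M) = s powr p * (\<Sum>k\<in>F. c k / s * (\<integral>\<omega>. (\<bar>Z k \<omega>\<bar> / c k) powr p \<partial>M))"
      unfolding W_def using moment_le_scale(1)[OF Z c] by (simp add: integral_sum)
    also have "\<dots> \<le> s powr p * (\<Sum>k\<in>F. c k / s * 1)"
      using moment_le_scale(2)[OF Z c] c s by (intro mult_left_mono sum_mono) (auto simp: less_imp_le)
    also have "(\<Sum>k\<in>F. c k / s * 1) = 1"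
      using s by (simp add: s_def flip: sum_divide_distrib)
    finally show "(\<integral>\<omega>. W \<omega> \<partial>M) \<le> s powr p" by simp
  next
    fix \<omega>
    have conv: "convex_on {0..} (\<lambda>x::real. x powr p)"
      using powr_convex_atLeast[OF p] .
    have "\<bar>\<Sum>k\<in>F. Z k \<omega>\<bar> \<le> (\<Sum>k\<in>F. \<bar>Z k \<omega>\<bar>)" by (rule sum_abs)
    also have "\<dots> = s * (\<Sum>k\<in>F. c k / s * (\<bar>Z k \<omega>\<bar> / c k))"
      unfolding sum_distrib_left using s c by (intro sum.cong) (auto simp: less_le)
    finally have "\<bar>\<Sum>k\<in>F. Z k \<omega>\<bar> powr p \<le> (s * (\<Sum>k\<in>F. c k / s * (\<bar>Z k \<omega>\<bar> / c k))) powr p"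
      using p by (intro powr_mono2) auto
    also have "\<dots> = s powr p * (\<Sum>k\<in>F. c k / s * (\<bar>Z k \<omega>\<bar> / c k)) powr p"
      using s c by (intro powr_mult) 
    also have "\<dots> \<le> W \<omega>"
      unfolding W_def
      using convex_on_sum[OF F False conv, of "\<lambda>k. c k / s" "\<lambda>k. \<bar>Z k \<omega>\<bar> / c k"] s c
      by (intro mult_left_mono) (auto simp: less_imp_le s_def simp flip: sum_divide_distrib)
    finally show "\<bar>\<Sum>k\<in>F. Z k \<omega>\<bar> powr p \<le> W \<omega>" .
  qed
  then show ?thesis by (simp add: s_def)
qed

lemma moment_le_add:
  assumes "1 \<le> p" "moment_le M p Y b" "moment_le M p Z c" "0 < b" "0 < c"
  shows "moment_le M p (\<lambda>\<omega>. Y \<omega> + Z \<omega>) (b + c)"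
  using moment_le_sum[of "UNIV :: bool set" p M "\<lambda>k. if k then Y else Z" "\<lambda>k. if k then b else c"] assms
  by (simp add: UNIV_bool add.commute)

lemma moment_le_minus: "moment_le M p (\<lambda>\<omega>. - Z \<omega>) c \<longleftrightarrow> moment_le M p Z c"
  by (simp add: moment_le_def)

lemma moment_le_diff:
  assumes "1 \<le> p" "moment_le M p Y b" "moment_le M p Z c" "0 < b" "0 < c"
  shows "moment_le M p (\<lambda>\<omega>. Y \<omega> - Z \<omega>) (b + c)"
  using moment_le_add[of p M Y b "\<lambda>\<omega>. - Z \<omega>" c] assms by (simp add: moment_le_minus)

text \<open>Cauchy-Schwarz: normalise both factors and apply 2 u v <= u^2 + v^2 pointwise.\<close>

lemma moment_le_mult:
  assumes "0 < p" "moment_le M (2 * p) Y b" "moment_le M (2 * p) Z c" "0 < b" "0 < c"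
  shows "moment_le M p (\<lambda>\<omega>. Y \<omega> * Z \<omega>) (b * c)"
proof -
  define W where "W = (\<lambda>\<omega>. (b * c) powr p * (((\<bar>Y \<omega>\<bar> / b) powr (2 * p) + (\<bar>Z \<omega>\<bar> / c) powr (2 * p)) / 2))"
  note [simp] = moment_le_scale(1)[OF assms(2,4)] moment_le_scale(1)[OF assms(3,5)]
  note [measurable] = moment_leD(1)[OF assms(2)] moment_leD(1)[OF assms(3)]
  show ?thesis
  proof (rule moment_leI)
    show "(\<lambda>\<omega>. Y \<omega> * Z \<omega>) \<in> borel_measurable M" by measurable
    show "integrable M W" unfolding W_def by simp
    show "(\<integral>\<omega>. W \<omega> \<partial>M) \<le> (b * c) powr p"
      unfolding W_def using moment_le_scale(2)[OF assms(2,4)] moment_le_scale(2)[OF assms(3,5)]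
        mult_left_mono[of "u + v" 2 "(b * c) powr p" for u v]
      by simp
    fix \<omega>
    define u where "u = (\<bar>Y \<omega>\<bar> / b) powr p"
    define v where "v = (\<bar>Z \<omega>\<bar> / c) powr p"
    have uv: "(\<bar>Y \<omega>\<bar> / b) powr (2 * p) = u\<^sup>2" "(\<bar>Z \<omega>\<bar> / c) powr (2 * p) = v\<^sup>2"
      unfolding u_def v_def by (simp_all add: power2_eq_square flip: powr_add)
    have "\<bar>Y \<omega> * Z \<omega>\<bar> powr p = (b * c) powr p * (u * v)"
      unfolding u_def v_def using assms by (simp add: powr_mult abs_mult powr_divide)
    also have "\<dots> \<le> W \<omega>"
      unfolding W_def uv using sum_squares_bound[of u v] by (intro mult_left_mono) auto
    finally show "\<bar>Y \<omega> * Z \<omega>\<bar> powr p \<le> W \<omega>" .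
  qed
qed

context prob_space
begin

lemma moment_le_const: "0 \<le> c \<Longrightarrow> \<bar>k\<bar> \<le> c \<Longrightarrow> 0 < p \<Longrightarrow> moment_le M p (\<lambda>_. k) c"
  by (simp add: moment_le_def powr_mono2 prob_space)

text \<open>After normalising by c, u^b <= 1 + u^p. Compared with Jensen's inequality this costs a
  factor 2, which only changes constants.\<close>

lemma moment_le_lower:
  assumes "moment_le M p Z c" "0 < c" "0 < b" "b \<le> p"
  shows "integrable M (\<lambda>\<omega>. \<bar>Z \<omega>\<bar> powr b)" "expectation (\<lambda>\<omega>. \<bar>Z \<omega>\<bar> powr b) \<le> 2 * c powr b"
proof -
  note [measurable] = moment_leD(1)[OF assms(1)]
  have le: "\<bar>Z \<omega>\<bar> powr b \<le> c powr b * (1 + (\<bar>Z \<omega>\<bar> / c) powr p)" for \<omega>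
  proof -
    have "\<bar>Z \<omega>\<bar> powr b = c powr b * (\<bar>Z \<omega>\<bar> / c) powr b"
      using assms by (simp flip: powr_mult)
    then show ?thesis using le_one_add_powr[of "\<bar>Z \<omega>\<bar> / c" b p] assms by (simp add: mult_left_mono)
  qed
  have i: "integrable M (\<lambda>\<omega>. c powr b * (1 + (\<bar>Z \<omega>\<bar> / c) powr p))"
    using moment_le_scale(1)[OF assms(1,2)] by simp
  show 1: "integrable M (\<lambda>\<omega>. \<bar>Z \<omega>\<bar> powr b)"
    by (rule Bochner_Integration.integrable_bound[OF i]) (auto intro!: AE_I2 order.trans[OF le])
  have "expectation (\<lambda>\<omega>. \<bar>Z \<omega>\<bar> powr b) \<le> expectation (\<lambda>\<omega>. c powr b * (1 + (\<bar>Z \<omega>\<bar> / c) powr p))"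
    by (intro integral_mono 1 i le)
  also have "\<dots> = c powr b * (1 + expectation (\<lambda>\<omega>. (\<bar>Z \<omega>\<bar> / c) powr p))"
    using moment_le_scale(1)[OF assms(1,2)] by (simp add: prob_space)
  also have "\<dots> \<le> c powr b * 2"
    using moment_le_scale(2)[OF assms(1,2)] by (intro mult_left_mono) auto
  finally show "expectation (\<lambda>\<omega>. \<bar>Z \<omega>\<bar> powr b) \<le> 2 * c powr b" by simp
qed

lemma moment_le_integrable:
  assumes "moment_le M p Z c" "0 < c" "1 \<le> p"
  shows "integrable M Z" "expectation (\<lambda>\<omega>. \<bar>Z \<omega>\<bar>) \<le> 2 * c" "\<bar>expectation Z\<bar> \<le> 2 * c"
proof -
  have m: "Z \<in> borel_measurable M" using assms by (simp add: moment_le_def)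
  have abs: "integrable M (\<lambda>\<omega>. \<bar>Z \<omega>\<bar>)"
    using moment_le_lower(1)[OF assms(1,2), of 1] assms by simp
  then show "integrable M Z" using integrable_abs_iff[OF m] by simp
  show 2: "expectation (\<lambda>\<omega>. \<bar>Z \<omega>\<bar>) \<le> 2 * c"
    using moment_le_lower(2)[OF assms(1,2), of 1] assms by simp
  show "\<bar>expectation Z\<bar> \<le> 2 * c"
    using integral_abs_bound[of M Z] 2 by linarith
qed

lemma moment_le_square:
  assumes "moment_le M p Z c" "0 < c" "2 \<le> p"
  shows "integrable M (\<lambda>\<omega>. (Z \<omega>)\<^sup>2)" "expectation (\<lambda>\<omega>. (Z \<omega>)\<^sup>2) \<le> 2 * c\<^sup>2"
  using moment_le_lower[OF assms(1,2), of 2] assms by simp_all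

text \<open>The factor is 3 = 1 + 2, since the mean is bounded by 2 c.\<close>

lemma moment_le_center:
  assumes "moment_le M p Z c" "0 < c" "1 \<le> p"
  shows "moment_le M p (\<lambda>\<omega>. Z \<omega> - expectation Z) (3 * c)"
  using moment_le_diff[OF assms(3,1) moment_le_const[of "2 * c" "expectation Z" p]]
    moment_le_integrable(3)[OF assms] assms by simp

end

section \<open>Sums of independent and of finitely dependent variables\<close>

text \<open>Its square dominates three times \<open>powr_const p\<close>, which pays for the three
  remainder terms of one induction step, and it is at least 1.\<close>

definition rosenthal_const :: "real \<Rightarrow> real"
  where "rosenthal_const p = 1 + sqrt (3 * powr_const p)"

lemma rosenthal_const_ge_1: "0 \<le> p \<Longrightarrow> 1 \<le> rosenthal_const p"
  using powr_const_ge_1[of p] by (simp add: rosenthal_const_def)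

lemma rosenthal_const_square: "0 \<le> p \<Longrightarrow> 3 * powr_const p \<le> (rosenthal_const p)\<^sup>2"
  using powr_const_ge_1[of p] by (simp add: rosenthal_const_def power2_sum)

text \<open>The arithmetic of adding one summand to k others. With a = sqrt k and b = sqrt (k + 1)
  the remainder is at most K^p a^(p-2) c^p by the choice of K, and a^p + a^(p-2) = a^(p-2) b^2 <=
  b^p.\<close>

lemma rosenthal_step:
  fixes p c k :: real
  assumes p: "2 < p" and c: "0 < c" and k: "1 \<le> k"
  defines "K \<equiv> rosenthal_const p"
  defines "s \<equiv> K * sqrt k * c"
  shows "s powr p + powr_const p * (2 * (s powr (p - 2) * c\<^sup>2) + c powr p) \<le> (K * sqrt (k + 1) * c) powr p"
proof -
  define a where "a = sqrt k"
  define b where "b = sqrt (k + 1)"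
  have K: "1 \<le> K" "3 * powr_const p \<le> K\<^sup>2"
    using p rosenthal_const_ge_1[of p] rosenthal_const_square[of p] by (auto simp: K_def)
  have a: "1 \<le> a" "a \<le> b" using k by (auto simp: a_def b_def)
  have b2: "b\<^sup>2 = a\<^sup>2 + 1" using k by (simp add: a_def b_def)
  have split: "x powr p = x powr (p - 2) * x\<^sup>2" if "0 < x" for x :: real
    using powr_add[of x "p - 2" 2] that by simp
  have s: "s = K * a * c" by (simp add: s_def a_def)
  have s2: "s powr (p - 2) * c\<^sup>2 = (K * a) powr (p - 2) * c powr p"
    using K a c by (simp add: s powr_mult split[of c])
  have "1 \<le> K * a" using K a mult_mono[of 1 K 1 a] by simp
  then have "1 \<le> (K * a) powr (p - 2)"
    using p by (intro ge_one_powr_ge_zero) auto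
  then have "c powr p \<le> (K * a) powr (p - 2) * c powr p"
    using mult_right_mono[of 1 "(K * a) powr (p - 2)" "c powr p"] by simp
  then have "powr_const p * (2 * (s powr (p - 2) * c\<^sup>2) + c powr p)
      \<le> powr_const p * (3 * ((K * a) powr (p - 2) * c powr p))"
    using powr_const_ge_1[of p] p s2 by (intro mult_left_mono) (auto simp: mult.commute)
  also have "\<dots> = 3 * powr_const p * ((K * a) powr (p - 2) * c powr p)" by simp
  also have "\<dots> \<le> K\<^sup>2 * ((K * a) powr (p - 2) * c powr p)"
    using K by (intro mult_right_mono) auto
  also have "\<dots> = K powr p * (a powr (p - 2) * c powr p)"
    using K a by (simp add: split[of K] powr_mult)
  finally have "s powr p + powr_const p * (2 * (s powr (p - 2) * c\<^sup>2) + c powr p)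
      \<le> s powr p + K powr p * (a powr (p - 2) * c powr p)" by simp
  also have "\<dots> = K powr p * (a powr (p - 2) * b\<^sup>2) * c powr p"
    using K a c by (simp add: s powr_mult split[of a] b2 algebra_simps)
  also have "\<dots> \<le> K powr p * (b powr (p - 2) * b\<^sup>2) * c powr p"
    using a p by (intro mult_right_mono mult_left_mono powr_mono2) auto
  also have "\<dots> = (K * b * c) powr p"
    using K a c by (simp add: powr_mult split[of b])
  finally show ?thesis by (simp add: b_def)
qed

context prob_space
begin

text \<open>The induction adds one summand at a time; the first-order term of the expansion of
  \<open>\<bar>x + y\<bar> powr p\<close> vanishes by independence and centering.\<close>

lemma moment_le_indep_sum:
  fixes Z :: "'i \<Rightarrow> 'a \<Rightarrow> real"
  assumes p: "2 < p" and c: "0 < c" and F: "finite F"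
    and indep: "indep_vars (\<lambda>_. borel) Z F"
    and Z: "\<And>i. i \<in> F \<Longrightarrow> moment_le M p (Z i) c"
    and mean: "\<And>i. i \<in> F \<Longrightarrow> expectation (Z i) = 0"
  shows "moment_le M p (\<lambda>\<omega>. \<Sum>i\<in>F. Z i \<omega>) (rosenthal_const p * sqrt (card F) * c)"
  using F indep Z mean
proof (induction F rule: finite_induct)
  case empty
  then show ?case using p by (simp add: moment_le_zero)
next
  case (insert i F)
  define K where "K = rosenthal_const p"
  have K: "1 \<le> K" using p rosenthal_const_ge_1[of p] by (simp add: K_def)
  have Zi: "moment_le M p (Z i) c" "expectation (Z i) = 0" using insert.prems by auto
  show ?case
  \<comment> \<open>The first summand is treated apart, as \<open>rosenthal_step\<close> needs k >=
    1 and the normalisation by s needs s > 0.\<close>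
  proof (cases "F = {}")
    case True
    then show ?thesis
      using moment_le_mono[OF Zi(1), of "K * c"] K c p by (simp add: K_def)
  next
    case False
    define k where "k = real (card F)"
    have k: "1 \<le> k" using False insert.hyps(1) by (simp add: k_def Suc_le_eq card_gt_0_iff)
    define s where "s = K * sqrt k * c"
    have s: "0 < s" using K k c by (simp add: s_def)
    define Y where "Y = (\<lambda>\<omega>. \<Sum>j\<in>F. Z j \<omega>)"
    have indF: "indep_vars (\<lambda>_. borel) Z F"
      using insert.prems(1) by (rule indep_vars_subset) auto
    have Y: "moment_le M p Y s"
      unfolding Y_def s_def K_def k_def using insert.IH[OF indF] insert.prems by auto
    define h where "h = (\<lambda>x::real. \<bar>x\<bar> powr (p - 1) * sgn x)"
    have [measurable]: "h \<in> borel_measurable borel" unfolding h_def by measurable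
    note [measurable] = moment_leD(1)[OF Y] moment_leD(1)[OF Zi(1)]
    have ind: "indep_var borel (Z i) borel Y"
      unfolding Y_def using insert by (intro indep_vars_sum) auto
    have indh: "indep_var borel (\<lambda>\<omega>. Z i \<omega>) borel (\<lambda>\<omega>. h (Y \<omega>))"
      using indep_var_compose[OF ind, of id borel h borel] by (simp add: comp_def)
    have Zint: "integrable M (Z i)" using moment_le_integrable[OF Zi(1) c] p by simp
    have hint: "integrable M (\<lambda>\<omega>. h (Y \<omega>))"
      by (rule Bochner_Integration.integrable_bound[OF moment_le_lower(1)[OF Y s, of "p - 1"]])
         (use p in \<open>auto intro!: AE_I2 simp: h_def abs_mult sgn_if\<close>)
    have prodint: "integrable M (\<lambda>\<omega>. Z i \<omega> * h (Y \<omega>))"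
      by (rule indep_var_integrable[OF indh Zint hint])
    have prod0: "expectation (\<lambda>\<omega>. Z i \<omega> * h (Y \<omega>)) = 0"
      using indep_var_lebesgue_integral[OF indh Zint hint] Zi by simp
    define W where "W = (\<lambda>\<omega>. \<bar>Y \<omega>\<bar> powr p + p * (Z i \<omega> * h (Y \<omega>))
        + powr_const p * (s powr (p - 2) * c\<^sup>2 * ((\<bar>Y \<omega>\<bar> / s) powr p + (\<bar>Z i \<omega>\<bar> / c) powr p) + \<bar>Z i \<omega>\<bar> powr p))"
    note [simp] = prodint moment_le_scale(1)[OF Y s] moment_le_scale(1)[OF Zi(1) c]
      moment_leD(2)[OF Y] moment_leD(2)[OF Zi(1)]
    have "moment_le M p (\<lambda>\<omega>. Y \<omega> + Z i \<omega>) (K * sqrt (k + 1) * c)"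
    proof (rule moment_leI)
      show "(\<lambda>\<omega>. Y \<omega> + Z i \<omega>) \<in> borel_measurable M" by measurable
      show "integrable M W" unfolding W_def by simp
      have "expectation W = expectation (\<lambda>\<omega>. \<bar>Y \<omega>\<bar> powr p)
          + powr_const p * (s powr (p - 2) * c\<^sup>2 * (expectation (\<lambda>\<omega>. (\<bar>Y \<omega>\<bar> / s) powr p)
              + expectation (\<lambda>\<omega>. (\<bar>Z i \<omega>\<bar> / c) powr p)) + expectation (\<lambda>\<omega>. \<bar>Z i \<omega>\<bar> powr p))"
        unfolding W_def by (simp add: prod0)
      also have "\<dots> \<le> s powr p + powr_const p * (s powr (p - 2) * c\<^sup>2 * (1 + 1) + c powr p)"
        using moment_leD(3)[OF Y] moment_leD(3)[OF Zi(1)] moment_le_scale(2)[OF Y s]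
          moment_le_scale(2)[OF Zi(1) c] powr_const_ge_1[of p] p
        by (intro add_mono mult_left_mono) auto
      also have "\<dots> \<le> (K * sqrt (k + 1) * c) powr p"
        using rosenthal_step[OF p c k] by (simp add: s_def K_def mult_ac)
      finally show "expectation W \<le> (K * sqrt (k + 1) * c) powr p" .
      fix \<omega>
      \<comment> \<open>The mixed term is not factored by independence: after normalising by s and c
        it is dominated by pure p-th powers, each with expectation at most 1.\<close>
      have "\<bar>Y \<omega>\<bar> powr (p - 2) * (Z i \<omega>)\<^sup>2
          = s powr (p - 2) * c\<^sup>2 * ((\<bar>Y \<omega>\<bar> / s) powr (p - 2) * (\<bar>Z i \<omega>\<bar> / c) powr 2)"
        using s c by (simp add: powr_divide power_divide)
      also have "\<dots> \<le> s powr (p - 2) * c\<^sup>2 * ((\<bar>Y \<omega>\<bar> / s) powr p + (\<bar>Z i \<omega>\<bar> / c) powr p)"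
        using s c p by (intro mult_left_mono powr_mult_le_add) auto
      finally have "powr_const p * (\<bar>Y \<omega>\<bar> powr (p - 2) * (Z i \<omega>)\<^sup>2 + \<bar>Z i \<omega>\<bar> powr p)
          \<le> powr_const p * (s powr (p - 2) * c\<^sup>2 * ((\<bar>Y \<omega>\<bar> / s) powr p + (\<bar>Z i \<omega>\<bar> / c) powr p) + \<bar>Z i \<omega>\<bar> powr p)"
        using powr_const_ge_1[of p] p by (intro mult_left_mono) auto
      then show "\<bar>Y \<omega> + Z i \<omega>\<bar> powr p \<le> W \<omega>"
        using powr_abs_add_le[OF p, of "Y \<omega>" "Z i \<omega>"] by (simp add: W_def h_def mult_ac)
    qed
    moreover have "(\<lambda>\<omega>. \<Sum>j\<in>insert i F. Z j \<omega>) = (\<lambda>\<omega>. Y \<omega> + Z i \<omega>)"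
      using insert.hyps by (auto simp: Y_def add.commute)
    moreover have "real (card (insert i F)) = k + 1"
      using insert.hyps by (simp add: k_def)
    ultimately show ?thesis by (simp add: K_def)
  qed
qed

text \<open>The exponential moment is taken at inverse temperature \<open>1 / T\<close>, where the truncated
  summands contribute bounded exponents.\<close>

lemma indep_truncated_sum_upper_tail:
  fixes V :: "'i \<Rightarrow> 'a \<Rightarrow> real"
  assumes p: "2 < p" and v: "0 < v" and T: "0 < T" and F: "finite F"
    and indep: "indep_vars (\<lambda>_. borel) V F"
    and V: "\<And>i. i \<in> F \<Longrightarrow> moment_le M p (V i) v"
    and mean: "\<And>i. i \<in> F \<Longrightarrow> expectation (V i) = 0"
  shows "prob {\<omega> \<in> space M. x \<le> (\<Sum>i\<in>F. if \<bar>V i \<omega>\<bar> \<le> T then V i \<omega> else 0)}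
     \<le> exp (- x / T + card F * ((v / T) powr p + 2 * (v / T)\<^sup>2))"
proof -
  define g where "g = (\<lambda>y. (if \<bar>y\<bar> \<le> T then y else 0) / T)"
  have g1: "\<bar>g y\<bar> \<le> 1" for y using T by (auto simp: g_def)
  have [measurable]: "g \<in> borel_measurable borel" unfolding g_def by measurable
  have Vm: "V i \<in> borel_measurable M" if "i \<in> F" for i using V[OF that] by (rule moment_leD)
  have gV: "(\<lambda>\<omega>. exp (g (V i \<omega>))) \<in> borel_measurable M" if "i \<in> F" for i
    using Vm[OF that] by measurable
  have int: "integrable M (\<lambda>\<omega>. exp (g (V i \<omega>)))" if "i \<in> F" for i
    by (rule integrable_const_bound[of _ "exp 1"]) (use gV[OF that] g1 in \<open>auto intro!: AE_I2 simp: abs_le_iff\<close>)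
  have le: "expectation (\<lambda>\<omega>. exp (g (V i \<omega>))) \<le> exp ((v / T) powr p + 2 * (v / T)\<^sup>2)" if i: "i \<in> F" for i
  proof -
    \<comment> \<open>The linear term is that of the untruncated variable, whose mean is 0.
      Replacing \<open>g y\<close> by y / T costs (|y| / T)^p, and only where |y| > T.\<close>
    have pw: "exp (g y) \<le> 1 + y / T + (v / T) powr p * (\<bar>y\<bar> / v) powr p + y\<^sup>2 / T\<^sup>2" for y
    proof -
      have a: "(v / T) powr p * (\<bar>y\<bar> / v) powr p = (\<bar>y\<bar> / T) powr p"
        using v T by (simp flip: powr_mult)
      have "exp (g y) \<le> 1 + g y + (g y)\<^sup>2"
        using g1[of y] by (intro exp_le_quadratic) auto
      moreover have "g y \<le> y / T + (\<bar>y\<bar> / T) powr p"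
      proof (cases "\<bar>y\<bar> \<le> T")
        case True
        then show ?thesis by (simp add: g_def)
      next
        case False
        then have "1 \<le> \<bar>y\<bar> / T" using T by (simp add: field_simps)
        then have "(\<bar>y\<bar> / T) powr 1 \<le> (\<bar>y\<bar> / T) powr p" using p by (intro powr_mono) auto
        then have "\<bar>y\<bar> / T \<le> (\<bar>y\<bar> / T) powr p" using T by simp
        moreover have "- (y / T) \<le> \<bar>y\<bar> / T" using T by (simp add: field_simps)
        ultimately show ?thesis using False by (simp add: g_def)
      qed
      moreover have "(g y)\<^sup>2 \<le> y\<^sup>2 / T\<^sup>2" by (simp add: g_def power_divide)
      ultimately show ?thesis by (simp add: a)
    qed
    note [simp] = moment_le_integrable(1)[OF V[OF i] v] moment_le_square(1)[OF V[OF i] v]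
      moment_le_scale(1)[OF V[OF i] v]
    have "expectation (\<lambda>\<omega>. exp (g (V i \<omega>)))
        \<le> expectation (\<lambda>\<omega>. 1 + V i \<omega> / T + (v / T) powr p * (\<bar>V i \<omega>\<bar> / v) powr p + (V i \<omega>)\<^sup>2 / T\<^sup>2)"
      using p by (intro integral_mono int i pw) auto
    also have "\<dots> = 1 + (v / T) powr p * expectation (\<lambda>\<omega>. (\<bar>V i \<omega>\<bar> / v) powr p)
        + expectation (\<lambda>\<omega>. (V i \<omega>)\<^sup>2) / T\<^sup>2"
      using p mean[OF i] by (simp add: prob_space)
    also have "\<dots> \<le> 1 + (v / T) powr p * 1 + (2 * v\<^sup>2) / T\<^sup>2"
      using p moment_le_square(2)[OF V[OF i] v] moment_le_scale(2)[OF V[OF i] v]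
      by (intro add_mono mult_left_mono divide_right_mono) auto
    also have "\<dots> = 1 + ((v / T) powr p + 2 * (v / T)\<^sup>2)" by (simp add: power_divide)
    also have "\<dots> \<le> exp ((v / T) powr p + 2 * (v / T)\<^sup>2)" by (rule exp_ge_add_one_self)
    finally show ?thesis .
  qed
  have ind: "indep_vars (\<lambda>_. borel) (\<lambda>i \<omega>. exp (g (V i \<omega>))) F"
    using indep by (rule indep_vars_compose2) auto
  define W where "W = (\<lambda>\<omega>. \<Prod>i\<in>F. exp (g (V i \<omega>)))"
  have Wint: "integrable M W"
    unfolding W_def by (rule indep_vars_integrable[OF F ind int])
  have W: "W \<omega> = exp ((\<Sum>i\<in>F. if \<bar>V i \<omega>\<bar> \<le> T then V i \<omega> else 0) / T)" for \<omega>
    unfolding W_def by (simp add: exp_sum[OF F, symmetric] g_def sum_divide_distrib)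
  have "prob {\<omega> \<in> space M. x \<le> (\<Sum>i\<in>F. if \<bar>V i \<omega>\<bar> \<le> T then V i \<omega> else 0)}
      = prob {\<omega> \<in> space M. exp (x / T) \<le> W \<omega>}"
    using T by (simp add: W divide_le_cancel)
  also have "\<dots> \<le> expectation W / exp (x / T)"
    by (rule integral_Markov_inequality_measure[OF Wint, of "{}"]) (auto simp: W)
  also have "\<dots> \<le> exp ((v / T) powr p + 2 * (v / T)\<^sup>2) ^ card F / exp (x / T)"
  proof (rule divide_right_mono)
    have "expectation W = (\<Prod>i\<in>F. expectation (\<lambda>\<omega>. exp (g (V i \<omega>))))"
      unfolding W_def by (rule indep_vars_lebesgue_integral[OF F ind int])
    also have "\<dots> \<le> (\<Prod>i\<in>F. exp ((v / T) powr p + 2 * (v / T)\<^sup>2))"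
      using le by (intro prod_mono) (auto intro!: integral_nonneg)
    finally show "expectation W \<le> exp ((v / T) powr p + 2 * (v / T)\<^sup>2) ^ card F" by simp
  qed simp
  also have "\<dots> = exp (- x / T + card F * ((v / T) powr p + 2 * (v / T)\<^sup>2))"
    by (simp add: exp_diff flip: exp_of_nat_mult)
  finally show ?thesis .
qed

lemma moment_le_tail:
  assumes "moment_le M p Z c" "0 < T" "0 < c" "0 < p"
  shows "prob {\<omega> \<in> space M. T < \<bar>Z \<omega>\<bar>} \<le> (c / T) powr p"
proof -
  note [measurable] = moment_leD(1)[OF assms(1)]
  have "prob {\<omega> \<in> space M. T < \<bar>Z \<omega>\<bar>} \<le> prob {\<omega> \<in> space M. T powr p \<le> \<bar>Z \<omega>\<bar> powr p}"
    using assms by (intro finite_measure_mono) (auto intro!: powr_mono2)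
  also have "\<dots> \<le> expectation (\<lambda>\<omega>. \<bar>Z \<omega>\<bar> powr p) / T powr p"
    by (rule integral_Markov_inequality_measure[OF moment_leD(2)[OF assms(1)], of "{}"]) (use assms in auto)
  also have "\<dots> \<le> c powr p / T powr p"
    using moment_leD(3)[OF assms(1)] by (intro divide_right_mono) auto
  also have "\<dots> = (c / T) powr p" using assms by (simp add: powr_divide)
  finally show ?thesis .
qed

text \<open>Either some summand exceeds T, which costs one Markov bound per summand, or truncation
  changes nothing and the exponential bound applies to the sum or to its negative.\<close>

lemma indep_sum_tail:
  fixes V :: "'i \<Rightarrow> 'a \<Rightarrow> real"
  assumes p: "2 < p" and v: "0 < v" and T: "0 < T" and F: "finite F"
    and indep: "indep_vars (\<lambda>_. borel) V F"
    and V: "\<And>i. i \<in> F \<Longrightarrow> moment_le M p (V i) v"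
    and mean: "\<And>i. i \<in> F \<Longrightarrow> expectation (V i) = 0"
  shows "prob {\<omega> \<in> space M. x < \<bar>\<Sum>i\<in>F. V i \<omega>\<bar>}
     \<le> card F * (v / T) powr p + 2 * exp (- x / T + card F * ((v / T) powr p + 2 * (v / T)\<^sup>2))"
proof -
  have Vm[measurable]: "V i \<in> borel_measurable M" if "i \<in> F" for i using V[OF that] by (rule moment_leD)
  define A where "A = (\<lambda>i. {\<omega> \<in> space M. T < \<bar>V i \<omega>\<bar>})"
  \<comment> \<open>The sign \<sigma> lets the one-sided bound serve both tails.\<close>
  define U where "U = (\<lambda>\<sigma>. {\<omega> \<in> space M. x \<le> (\<Sum>i\<in>F. if \<bar>\<sigma> * V i \<omega>\<bar> \<le> T then \<sigma> * V i \<omega> else 0)})"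
  have Am: "A i \<in> events" if "i \<in> F" for i using Vm[OF that] unfolding A_def by measurable
  have Um: "U \<sigma> \<in> events" for \<sigma> unfolding U_def by measurable
  have Ub: "prob (U \<sigma>) \<le> exp (- x / T + card F * ((v / T) powr p + 2 * (v / T)\<^sup>2))" if "\<bar>\<sigma>\<bar> = 1" for \<sigma>
    unfolding U_def
  proof (rule indep_truncated_sum_upper_tail[OF p v T F])
    show "indep_vars (\<lambda>_. borel) (\<lambda>i \<omega>. \<sigma> * V i \<omega>) F"
      by (rule indep_vars_compose2[OF indep, of "\<lambda>_ y. \<sigma> * y"]) auto
    show "moment_le M p (\<lambda>\<omega>. \<sigma> * V i \<omega>) v" if "i \<in> F" for i
      using moment_le_cmult_le[OF V[OF that], of \<sigma>] v p \<open>\<bar>\<sigma>\<bar> = 1\<close> by simp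
    show "expectation (\<lambda>\<omega>. \<sigma> * V i \<omega>) = 0" if "i \<in> F" for i using mean[OF that] by simp
  qed
  have "{\<omega> \<in> space M. x < \<bar>\<Sum>i\<in>F. V i \<omega>\<bar>} \<subseteq> (\<Union>i\<in>F. A i) \<union> (U 1 \<union> U (- 1))"
  proof
    fix \<omega> assume \<omega>: "\<omega> \<in> {\<omega> \<in> space M. x < \<bar>\<Sum>i\<in>F. V i \<omega>\<bar>}"
    show "\<omega> \<in> (\<Union>i\<in>F. A i) \<union> (U 1 \<union> U (- 1))"
    proof (cases "\<exists>i\<in>F. T < \<bar>V i \<omega>\<bar>")
      case True
      then show ?thesis using \<omega> by (auto simp: A_def)
    next
      case False
      then have "(\<Sum>i\<in>F. if \<bar>\<sigma> * V i \<omega>\<bar> \<le> T then \<sigma> * V i \<omega> else 0) = \<sigma> * (\<Sum>i\<in>F. V i \<omega>)" if "\<bar>\<sigma>\<bar> = 1" for \<sigma>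
        unfolding sum_distrib_left using that by (intro sum.cong) (auto simp: abs_mult not_less)
      then have "\<omega> \<in> U \<sigma> \<longleftrightarrow> x \<le> \<sigma> * (\<Sum>i\<in>F. V i \<omega>)" if "\<bar>\<sigma>\<bar> = 1" for \<sigma>
        using \<omega> that by (simp add: U_def)
      from this[of 1] this[of "-1"] show ?thesis using \<omega> by auto
    qed
  qed
  then have "prob {\<omega> \<in> space M. x < \<bar>\<Sum>i\<in>F. V i \<omega>\<bar>} \<le> prob ((\<Union>i\<in>F. A i) \<union> (U 1 \<union> U (- 1)))"
    by (rule finite_measure_mono) (intro sets.Un sets.finite_UN F Am Um)
  also have "\<dots> \<le> prob (\<Union>i\<in>F. A i) + prob (U 1 \<union> U (- 1))"
    by (intro measure_Un_le sets.Un sets.finite_UN F Am Um)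
  also have "\<dots> \<le> (\<Sum>i\<in>F. prob (A i)) + (prob (U 1) + prob (U (- 1)))"
    by (intro add_mono measure_Un_le measure_UNION_le F Am Um)
  also have "\<dots> \<le> (\<Sum>i\<in>F. (v / T) powr p) + (exp (- x / T + card F * ((v / T) powr p + 2 * (v / T)\<^sup>2))
      + exp (- x / T + card F * ((v / T) powr p + 2 * (v / T)\<^sup>2)))"
    using Ub V T v p unfolding A_def by (intro add_mono sum_mono moment_le_tail) auto
  finally show ?thesis by simp
qed

end

section \<open>Functionals of finite windows of innovations\<close>

locale innovations = prob_space M for M :: "'a measure" +
  fixes S :: "'s measure" and \<epsilon> :: "int \<Rightarrow> 'a \<Rightarrow> 's"
  assumes indep_innovations: "indep_vars (\<lambda>_. S) \<epsilon> UNIV"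
begin

lemma measurable_innovation: "\<epsilon> i \<in> measurable M S"
  using indep_innovations by (auto simp: indep_vars_def)

text \<open>The sigma-algebra on the sample space generated by the innovations with index in K.
  Measurability with respect to it expresses dependence on that window only.\<close>

definition win :: "int set \<Rightarrow> 'a measure" where
  "win K = vimage_algebra (space M) (\<lambda>\<omega>. \<lambda>i\<in>K. \<epsilon> i \<omega>) (PiM K (\<lambda>_. S))"

lemma space_win: "space (win K) = space M"
  by (simp add: win_def)

lemma measurable_win_restrict: "(\<lambda>\<omega>. \<lambda>i\<in>K. \<epsilon> i \<omega>) \<in> measurable (win K) (PiM K (\<lambda>_. S))"
  unfolding win_def
  using measurable_space[OF measurable_innovation]
  by (intro measurable_vimage_algebra1) (auto simp: space_PiM)

lemma measurable_win_innovation: "i \<in> K \<Longrightarrow> \<epsilon> i \<in> measurable (win K) S"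
  using measurable_compose[OF measurable_win_restrict measurable_component_singleton, of i K]
  by simp

lemma measurable_win_mono:
  assumes "Z \<in> measurable (win K) N" "K \<subseteq> K'"
  shows "Z \<in> measurable (win K') N"
proof -
  have "(\<lambda>\<omega>. \<omega>) \<in> measurable (win K') (win K)"
    unfolding win_def[of K]
    by (rule measurable_vimage_algebra2)
       (use assms in \<open>auto simp: space_win intro!: measurable_restrict measurable_win_innovation\<close>)
  then show ?thesis using measurable_compose assms(1) by blast
qed

lemma measurable_win_events:
  assumes "Z \<in> measurable (win K) N"
  shows "Z \<in> measurable M N"
proof -
  have "(\<lambda>\<omega>. \<omega>) \<in> measurable M (win K)"
    unfolding win_def[of K]
    by (rule measurable_vimage_algebra2)
       (auto intro!: measurable_restrict measurable_innovation)
  then show ?thesis using measurable_compose assms(1) by blast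
qed

text \<open>Disjoint groups of independent innovations are independent, and the preimages under
  their restrictions are exactly the sets of \<open>win (K j)\<close>, which contain all events
  determined by \<open>Z j\<close>.\<close>

lemma indep_vars_win:
  assumes disj: "disjoint_family_on K L"
    and Z: "\<And>j. j \<in> L \<Longrightarrow> Z j \<in> measurable (win (K j)) (N j)"
  shows "indep_vars N Z L"
proof -
  have "indep_vars (\<lambda>j. PiM (K j) (\<lambda>_. S)) (\<lambda>j \<omega>. restrict (\<lambda>i. \<epsilon> i \<omega>) (K j)) L"
    using indep_innovations disj by (intro indep_vars_restrict) auto
  then have ind: "indep_sets (\<lambda>j. {(\<lambda>\<omega>. restrict (\<lambda>i. \<epsilon> i \<omega>) (K j)) -` A \<inter> space M | A. A \<in> sets (PiM (K j) (\<lambda>_. S))}) L"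
    by (simp add: indep_vars_def2)
  have "indep_sets (\<lambda>j. {Z j -` A \<inter> space M | A. A \<in> sets (N j)}) L"
  proof (rule indep_sets_mono_sets[OF ind])
    fix j assume j: "j \<in> L"
    have "sets (win (K j)) = {(\<lambda>\<omega>. restrict (\<lambda>i. \<epsilon> i \<omega>) (K j)) -` A \<inter> space M | A. A \<in> sets (PiM (K j) (\<lambda>_. S))}"
      unfolding win_def using measurable_space[OF measurable_innovation]
      by (intro sets_vimage_algebra2) (auto simp: space_PiM)
    then show "{Z j -` A \<inter> space M | A. A \<in> sets (N j)}
      \<subseteq> {(\<lambda>\<omega>. restrict (\<lambda>i. \<epsilon> i \<omega>) (K j)) -` A \<inter> space M | A. A \<in> sets (PiM (K j) (\<lambda>_. S))}"
      using measurable_sets[OF Z[OF j]] by (auto simp: space_win)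
  qed
  then show ?thesis using measurable_win_events[OF Z] by (simp add: indep_vars_def2)
qed

text \<open>A \<open>d\<close>-dependent sum splits into \<open>d\<close> sums of independent terms, one for each residue class.\<close>

lemma moment_le_dependent_sum:
  fixes Z :: "int \<Rightarrow> 'a \<Rightarrow> real" and d :: nat
  assumes p: "2 < p" and c: "0 < c" and d: "0 < d" and F: "finite F"
    and meas: "\<And>i. i \<in> F \<Longrightarrow> Z i \<in> borel_measurable (win (W i))"
    and Z: "\<And>i. i \<in> F \<Longrightarrow> moment_le M p (Z i) c"
    and mean: "\<And>i. i \<in> F \<Longrightarrow> expectation (Z i) = 0"
    and disj: "\<And>i j. i \<in> F \<Longrightarrow> j \<in> F \<Longrightarrow> i + int d \<le> j \<Longrightarrow> W i \<inter> W j = {}"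
  shows "moment_le M p (\<lambda>\<omega>. \<Sum>i\<in>F. Z i \<omega>) (d * (rosenthal_const p * sqrt (card F) * c))"
proof (cases "F = {}")
  case True
  then show ?thesis using p by (simp add: moment_le_zero)
next
  case False
  define K where "K = rosenthal_const p"
  have K: "1 \<le> K" using p rosenthal_const_ge_1[of p] by (simp add: K_def)
  define G where "G = (\<lambda>r. {i \<in> F. i mod int d = r})"
  have pos: "0 < K * sqrt (card F) * c"
    using K c F False by (simp add: card_gt_0_iff)
  have res: "moment_le M p (\<lambda>\<omega>. \<Sum>i\<in>G r. Z i \<omega>) (K * sqrt (card F) * c)" for r
  proof -
    have sep: "i + int d \<le> j" if "i \<in> G r" "j \<in> G r" "i < j" for i j
    proof -
      have "int d dvd j - i" using that mod_eq_dvd_iff[of j "int d" i] by (simp add: G_def)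
      then show ?thesis using that zdvd_imp_le[of "int d" "j - i"] by simp
    qed
    have "disjoint_family_on W (G r)"
      unfolding disjoint_family_on_def
    proof (intro ballI impI)
      fix i j assume ij: "i \<in> G r" "j \<in> G r" "i \<noteq> j"
      have mem: "i \<in> F" "j \<in> F" using ij by (auto simp: G_def)
      show "W i \<inter> W j = {}"
        using sep[of i j] sep[of j i] ij disj[OF mem] disj[OF mem(2,1)] by (cases "i < j") auto
    qed
    then have ind: "indep_vars (\<lambda>_. borel) Z (G r)"
      by (rule indep_vars_win) (use meas in \<open>auto simp: G_def\<close>)
    have "moment_le M p (\<lambda>\<omega>. \<Sum>i\<in>G r. Z i \<omega>) (K * sqrt (card (G r)) * c)"
      unfolding K_def by (rule moment_le_indep_sum[OF p c _ ind]) (use F Z mean in \<open>auto simp: G_def\<close>)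
    \<comment> \<open>Each residue class is bounded by the size of all of F. The total factor is
      therefore d rather than sqrt d, which the geometric decay over the scales absorbs.\<close>
    then show ?thesis
      by (rule moment_le_mono) (use K c p F in \<open>auto simp: G_def intro!: mult_right_mono mult_left_mono card_mono\<close>)
  qed
  have "(\<Sum>i\<in>F. Z i \<omega>) = (\<Sum>r\<in>{0..<int d}. \<Sum>i\<in>G r. Z i \<omega>)" for \<omega>
    unfolding G_def using d F by (intro sum.group[symmetric]) auto
  then show ?thesis
    using moment_le_sum[of "{0..<int d}" p M "\<lambda>r \<omega>. \<Sum>i\<in>G r. Z i \<omega>" "\<lambda>_. K * sqrt (card F) * c"] p pos res
    by (simp add: K_def)
qed

text \<open>Interchange the sums and apply Minkowski's inequality over the scales. Scale k
  contributes its dependence range times its size, so polynomial ranges are harmless when sizes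
  decay geometrically.\<close>

lemma moment_le_multiscale_sum:
  fixes Z :: "nat \<Rightarrow> int \<Rightarrow> 'a \<Rightarrow> real" and d :: "nat \<Rightarrow> nat" and c :: "nat \<Rightarrow> real"
  assumes p: "2 < p" and c: "\<And>k. k \<in> {1..m} \<Longrightarrow> 0 < c k" and d: "\<And>k. k \<in> {1..m} \<Longrightarrow> 0 < d k"
    and F: "finite F"
    and meas: "\<And>k i. k \<in> {1..m} \<Longrightarrow> i \<in> F \<Longrightarrow> Z k i \<in> borel_measurable (win (W k i))"
    and Z: "\<And>k i. k \<in> {1..m} \<Longrightarrow> i \<in> F \<Longrightarrow> moment_le M p (Z k i) (c k)"
    and mean: "\<And>k i. k \<in> {1..m} \<Longrightarrow> i \<in> F \<Longrightarrow> expectation (Z k i) = 0"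
    and disj: "\<And>k i j. k \<in> {1..m} \<Longrightarrow> i \<in> F \<Longrightarrow> j \<in> F \<Longrightarrow> i + int (d k) \<le> j \<Longrightarrow> W k i \<inter> W k j = {}"
  shows "moment_le M p (\<lambda>\<omega>. \<Sum>i\<in>F. \<Sum>k=1..m. Z k i \<omega>)
           (rosenthal_const p * sqrt (card F) * (\<Sum>k=1..m. d k * c k))"
proof (cases "F = {}")
  case True
  then show ?thesis using p by (simp add: moment_le_zero)
next
  case False
  have "moment_le M p (\<lambda>\<omega>. \<Sum>k=1..m. \<Sum>i\<in>F. Z k i \<omega>)
      (\<Sum>k=1..m. d k * (rosenthal_const p * sqrt (card F) * c k))"
  proof (rule moment_le_sum)
    fix k assume k: "k \<in> {1..m}"
    show "moment_le M p (\<lambda>\<omega>. \<Sum>i\<in>F. Z k i \<omega>) (d k * (rosenthal_const p * sqrt (card F) * c k))"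
      by (rule moment_le_dependent_sum[OF p c[OF k] d[OF k] F meas[OF k] Z[OF k] mean[OF k] disj[OF k]])
    show "0 < d k * (rosenthal_const p * sqrt (card F) * c k)"
      using rosenthal_const_ge_1[of p] p c[OF k] d[OF k] F False by (simp add: card_gt_0_iff)
  qed (use p in auto)
  then show ?thesis
    by (subst sum.swap) (simp add: sum_distrib_left mult_ac)
qed

end

section \<open>Fourier expansion of the lag window\<close>

text \<open>Jordan's inequality: the concave sine lies above its chord over [0, pi / 2].\<close>

lemma sin_ge_linear:
  assumes "0 \<le> x" "x \<le> pi / 2"
  shows "2 * x / pi \<le> sin x"
proof -
  have "convex_on {0..pi} (\<lambda>x. - sin x)"
    by (rule f''_ge0_imp_convex[where f' = "\<lambda>x. - cos x" and f'' = sin])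
       (auto intro!: derivative_eq_intros sin_ge_zero)
  from convex_onD[OF this, of "2 * x / pi" 0 "pi / 2"] show ?thesis
    using assms by (simp add: field_simps)
qed

lemma cmod_cis_minus_one: "cmod (cis x - 1) = 2 * \<bar>sin (x / 2)\<bar>"
proof -
  have "(cmod (cis x - 1))\<^sup>2 = (cos x - 1)\<^sup>2 + (sin x)\<^sup>2"
    by (simp add: cmod_power2)
  also have "\<dots> = 2 - 2 * cos x"
    by (simp add: power2_diff sin_squared_eq)
  also have "\<dots> = (2 * \<bar>sin (x / 2)\<bar>)\<^sup>2"
    using cos_double_sin[of "x / 2"] by (simp add: power_mult_distrib)
  finally show ?thesis by (rule power2_eq_imp_eq) auto
qed

lemma cmod_cis_diff_le: "cmod (cis x - cis y) \<le> \<bar>x - y\<bar>"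
proof -
  have "cis x - cis y = cis y * (cis (x - y) - 1)"
    by (simp add: algebra_simps cis_mult)
  then have "cmod (cis x - cis y) = 2 * \<bar>sin ((x - y) / 2)\<bar>"
    by (simp only: norm_mult norm_cis cmod_cis_minus_one mult_1)
  then show ?thesis using abs_sin_x_le_abs_x[of "(x - y) / 2"] by simp
qed

lemma cmod_scaled_diff_le:
  fixes x y :: real
  assumes "cmod c = 1"
  shows "cmod (of_real x * c - of_real y * d) \<le> \<bar>x - y\<bar> + \<bar>y\<bar> * cmod (c - d)"
proof -
  have "of_real x * c - of_real y * d = of_real (x - y) * c + of_real y * (c - d)"
    by (simp add: algebra_simps)
  then show ?thesis
    using norm_triangle_ineq[of "of_real (x - y) * c" "of_real y * (c - d)"] assms
    by (simp add: norm_mult del: of_real_diff)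
qed

section \<open>Characters of the cyclic group of order N and the discrete Fourier transform\<close>

definition character :: "nat \<Rightarrow> int \<Rightarrow> int \<Rightarrow> complex" where
  "character N l t = cis (2 * pi * of_int (l * t) / real N)"

lemma character_add_left: "character N (k + l) t = character N k t * character N l t"
  by (simp add: character_def cis_mult add_divide_distrib algebra_simps)

lemma character_add_right: "character N l (s + t) = character N l s * character N l t"
  by (simp add: character_def cis_mult add_divide_distrib algebra_simps)

lemma cmod_character [simp]: "cmod (character N l t) = 1"
  by (simp add: character_def)

lemma character_zero [simp]: "character N 0 t = 1" "character N l 0 = 1"
  by (simp_all add: character_def)

lemma character_commute: "character N l t = character N t l"
  by (simp add: character_def mult.commute)

lemma character_minus: "character N l (- t) = cnj (character N l t)"
  by (simp add: character_def cis_cnj)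

lemma character_period: "0 < N \<Longrightarrow> character N l (int N) = 1"
  using cis_multiple_2pi[of "of_int l"] by (simp add: character_def mult.assoc)

text \<open>A geometric sum whose base z is an N-th root of unity; z = 1 would force sin (pi k / N)
  = 0, hence N to divide k.\<close>

lemma sum_character:
  assumes N: "0 < N" and k: "\<bar>k\<bar> < int N"
  shows "(\<Sum>l<N. character N (int l) k) = (if k = 0 then of_nat N else 0)"
proof (cases "k = 0")
  case False
  define z where "z = character N 1 k"
  have pow: "character N (int l) k = z ^ l" for l
    by (induction l) (simp_all add: z_def character_add_left)
  have "z \<noteq> 1"
  proof
    assume "z = 1"
    then have "sin (pi * of_int k / N) = 0"
      using cmod_cis_minus_one[of "2 * pi * of_int k / N"] by (simp add: z_def character_def)
    then obtain j :: int where "pi * of_int k / N = of_int j * pi"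
      using sin_zero_iff_int2 by blast
    then have "of_int k = (of_int (j * int N) :: real)" using N by (simp add: field_simps)
    then have "k = j * int N" by (simp only: of_int_eq_iff)
    then have "int N dvd k" by simp
    then show False using k False by (auto dest: dvd_imp_le_int)
  qed
  moreover have "z ^ N = 1"
    using character_period[OF N, of k] pow[of N] by (simp add: character_commute)
  ultimately show ?thesis
    using False by (simp add: pow sum_gp_strict)
qed simp

definition fourier_coeff :: "nat \<Rightarrow> (int \<Rightarrow> complex) \<Rightarrow> nat \<Rightarrow> complex" where
  "fourier_coeff N w l = (\<Sum>t<N. w (int t) * cnj (character N (int l) (int t))) / of_nat N"

lemma sum_character_orthogonal:
  assumes "s < N" "t < N"
  shows "(\<Sum>l<N. character N (int l) (int s) * cnj (character N (int l) (int t))) = (if s = t then of_nat N else 0)"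
proof -
  have "(\<Sum>l<N. character N (int l) (int s) * cnj (character N (int l) (int t)))
      = (\<Sum>l<N. character N (int l) (int s - int t))"
    using character_add_right[of N _ "int s" "- int t"] by (simp add: character_minus)
  then show ?thesis using sum_character[of N "int s - int t"] assms by auto
qed

lemma fourier_inversion:
  assumes N: "0 < N" and per: "\<And>t. w (t mod int N) = w t"
  shows "w t = (\<Sum>l<N. fourier_coeff N w l * character N (int l) t)"
proof -
  define s where "s = nat (t mod int N)"
  have s: "int s = t mod int N" "s < N" using N by (auto simp: s_def nat_less_iff)
  have per_char: "character N (int l) t = character N (int l) (int s)" for l
  proof -
    have "t = int s + int N * (t div int N)" by (simp add: s)
    moreover have "character N (int l) (int N * j) = 1" for j
      using cis_multiple_2pi[of "of_int (int l * j)"] N by (simp add: character_def mult_ac)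
    ultimately show ?thesis by (metis character_add_right mult.right_neutral)
  qed
  have "(\<Sum>l<N. fourier_coeff N w l * character N (int l) t)
      = (\<Sum>l<N. \<Sum>r<N. w (int r) / of_nat N * (character N (int l) (int s) * cnj (character N (int l) (int r))))"
    by (simp add: per_char fourier_coeff_def sum_distrib_left sum_divide_distrib mult_ac)
  also have "\<dots> = (\<Sum>r<N. w (int r) / of_nat N * (\<Sum>l<N. character N (int l) (int s) * cnj (character N (int l) (int r))))"
    by (subst sum.swap) (simp add: sum_distrib_left)
  also have "\<dots> = (\<Sum>r<N. if r = s then w (int r) else 0)"
    using s(2) N by (intro sum.cong) (auto simp: sum_character_orthogonal)
  also have "\<dots> = w t" using s per[of t] by simp
  finally show ?thesis ..
qed

lemma fourier_parseval:
  assumes N: "0 < N"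
  shows "(\<Sum>l<N. (cmod (fourier_coeff N w l))\<^sup>2) = (\<Sum>t<N. (cmod (w (int t)))\<^sup>2) / N"
proof -
  have "of_real (\<Sum>l<N. (cmod (fourier_coeff N w l))\<^sup>2)
      = (\<Sum>l<N. fourier_coeff N w l * cnj (fourier_coeff N w l))"
    by (simp add: complex_norm_square flip: of_real_power)
  also have "\<dots> = (\<Sum>l<N. \<Sum>t<N. \<Sum>s<N. w (int t) * cnj (w (int s)) / (of_nat N)\<^sup>2 *
      (character N (int l) (int s) * cnj (character N (int l) (int t))))"
    by (simp add: fourier_coeff_def sum_product sum_divide_distrib power2_eq_square mult_ac)
  also have "\<dots> = (\<Sum>t<N. \<Sum>l<N. \<Sum>s<N. w (int t) * cnj (w (int s)) / (of_nat N)\<^sup>2 *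
      (character N (int l) (int s) * cnj (character N (int l) (int t))))"
    by (rule sum.swap)
  also have "\<dots> = (\<Sum>t<N. \<Sum>s<N. w (int t) * cnj (w (int s)) / (of_nat N)\<^sup>2 *
      (\<Sum>l<N. character N (int l) (int s) * cnj (character N (int l) (int t))))"
    by (subst sum.swap) (simp add: sum_distrib_left)
  also have "\<dots> = (\<Sum>t<N. \<Sum>s<N. if s = t then w (int t) * cnj (w (int t)) / of_nat N else 0)"
    using N by (intro sum.cong) (auto simp: sum_character_orthogonal power2_eq_square)
  also have "\<dots> = of_real ((\<Sum>t<N. (cmod (w (int t)))\<^sup>2) / N)"
    by (simp add: complex_norm_square sum_divide_distrib flip: of_real_power)
  finally show ?thesis by (simp only: of_real_eq_iff)
qed

text \<open>Summation over a full period is invariant under the shift by one, which multiplies the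
  character by a constant phase.\<close>

lemma fourier_coeff_difference:
  assumes N: "0 < N" and per: "\<And>t. w (t mod int N) = w t"
  shows "fourier_coeff N (\<lambda>t. w (t + 1) - w t) l = (character N (int l) 1 - 1) * fourier_coeff N w l"
proof -
  define g where "g = (\<lambda>t. w (int t) * cnj (character N (int l) (int t)))"
  have "w (int N) = w 0" using per[of "int N"] by simp
  then have gN: "g N = g 0" by (simp add: g_def character_period[OF N])
  have shift: "(\<Sum>t<N. g (Suc t)) = (\<Sum>t<N. g t)"
    using sum.lessThan_Suc_shift[of g N] sum.lessThan_Suc[of g N] gN by simp
  have one: "character N (int l) 1 * cnj (character N (int l) 1) = 1"
    using complex_norm_square[of "character N (int l) 1"] by simp
  have "character N (int l) 1 * g (Suc t) = w (int t + 1) * cnj (character N (int l) (int t))" for t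
    using one by (simp add: g_def character_add_right add.commute[of 1] mult_ac)
  then have "(\<Sum>t<N. w (int t + 1) * cnj (character N (int l) (int t))) = character N (int l) 1 * (\<Sum>t<N. g t)"
    using shift by (simp add: sum_distrib_left flip: shift)
  then show ?thesis
    by (simp add: fourier_coeff_def g_def left_diff_distrib sum_subtractf diff_divide_distrib)
qed

lemma sum_inverse_squares_le: "(\<Sum>l=1..n. 1 / (real l)\<^sup>2) \<le> 2"
proof -
  have "(\<Sum>l=1..n. 1 / (real l)\<^sup>2) \<le> 2 - 1 / real n" if "1 \<le> n"
    using that
  proof (induction n rule: dec_induct)
    case (step n)
    have "1 / (real (Suc n))\<^sup>2 \<le> 1 / (real n * real (Suc n))"
      using step by (intro divide_left_mono) (auto simp: power2_eq_square)
    also have "\<dots> = 1 / real n - 1 / real (Suc n)" using step by (simp add: field_simps)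
    finally show ?case using step by simp
  qed simp
  then show ?thesis
    by (cases "1 \<le> n") (auto intro: order.trans)
qed

text \<open>The sine is symmetric under l -> N - l, so Jordan's inequality at m = min l (N - l)
  gives |\<open>character N l 1\<close> - 1| >= 4 m / N. Adding both inverse squares removes the
  minimum and makes the bound summable over l.\<close>

lemma cmod_character_minus_one_ge:
  assumes "1 \<le> l" "l < N"
  shows "1 / (cmod (character N (int l) 1 - 1))\<^sup>2 \<le> (real N)\<^sup>2 / 16 * (1 / (real l)\<^sup>2 + 1 / (real (N - l))\<^sup>2)"
proof -
  define m where "m = min l (N - l)"
  have m: "1 \<le> m" "2 * m \<le> N" using assms by (auto simp: m_def)
  have N: "0 < N" using assms by simp
  have "sin (pi * l / N) = sin (pi * m / N)"
  proof (cases "l \<le> N - l")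
    case False
    have "pi * l / N = pi - pi * m / N"
      using False assms N by (simp add: m_def min_def of_nat_diff field_simps)
    then show ?thesis by simp
  qed (simp add: m_def)
  moreover have "2 * (pi * m / N) / pi \<le> sin (pi * m / N)"
    using m N by (intro sin_ge_linear) (auto simp: field_simps simp flip: of_nat_mult)
  ultimately have "4 * real m / N \<le> cmod (character N (int l) 1 - 1)"
    using cmod_cis_minus_one[of "2 * pi * l / N"] by (simp add: character_def)
  moreover have pos: "0 < 4 * real m / N" using m N by simp
  ultimately have "1 / (cmod (character N (int l) 1 - 1))\<^sup>2 \<le> 1 / (4 * real m / N)\<^sup>2"
    by (intro frac_le power_mono zero_less_power) auto
  also have "\<dots> = (real N)\<^sup>2 / 16 * (1 / (real m)\<^sup>2)" by (simp add: power_divide power_mult_distrib)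
  also have "1 / (real m)\<^sup>2 \<le> 1 / (real l)\<^sup>2 + 1 / (real (N - l))\<^sup>2"
    by (simp add: m_def min_def)
  finally show ?thesis by (simp add: mult_left_mono)
qed

text \<open>The coefficients of the difference sequence are controlled by Parseval; dividing by
  \<open>character N l 1 - 1\<close> costs a square summable factor.\<close>

lemma sum_fourier_coeff_le:
  fixes w :: "int \<Rightarrow> complex"
  assumes N: "0 < N" and per: "\<And>t. w (t mod int N) = w t"
    and bound: "\<And>t. cmod (w t) \<le> L" and lip: "\<And>t. cmod (w (t + 1) - w t) \<le> L / N"
  shows "(\<Sum>l<N. cmod (fourier_coeff N w l)) \<le> 2 * L"
proof -
  define v where "v = (\<lambda>t. w (t + 1) - w t)"
  define e where "e = (\<lambda>l. cmod (character N (int l) 1 - 1))"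
  have L: "0 \<le> L" using bound[of 0] norm_ge_zero[of "w 0"] by linarith
  have e0: "0 < e l" if "l \<in> {1..<N}" for l
  proof -
    have "sin (pi * l / N) > 0" using that by (intro sin_gt_zero) (auto simp: field_simps)
    then show ?thesis using cmod_cis_minus_one[of "2 * pi * l / N"] by (simp add: e_def character_def)
  qed
  have "(\<Sum>l<N. (cmod (fourier_coeff N v l))\<^sup>2) \<le> (\<Sum>t<N. (L / N)\<^sup>2) / N"
    unfolding fourier_parseval[OF N] v_def using lip by (intro divide_right_mono sum_mono power_mono) auto
  also have "\<dots> = (L / N)\<^sup>2" using N by simp
  finally have pars: "(\<Sum>l\<in>{1..<N}. (cmod (fourier_coeff N v l))\<^sup>2) \<le> (L / N)\<^sup>2"
    using sum_mono2[of "{..<N}" "{1..<N}" "\<lambda>l. (cmod (fourier_coeff N v l))\<^sup>2"] by force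
  have refl: "(\<Sum>l\<in>{1..<N}. 1 / (real (N - l))\<^sup>2) = (\<Sum>l\<in>{1..<N}. 1 / (real l)\<^sup>2)"
    by (rule sum.reindex_bij_witness[of _ "\<lambda>l. N - l" "\<lambda>l. N - l"]) auto
  have two: "(\<Sum>l\<in>{1..<N}. 1 / (real l)\<^sup>2) \<le> 2"
    using sum_inverse_squares_le[of "N - 1"] N by (simp add: atLeastLessThanSuc_atLeastAtMost[symmetric])
  have "(\<Sum>l\<in>{1..<N}. (1 / e l)\<^sup>2) \<le> (\<Sum>l\<in>{1..<N}. (real N)\<^sup>2 / 16 * (1 / (real l)\<^sup>2 + 1 / (real (N - l))\<^sup>2))"
    unfolding e_def by (intro sum_mono) (use cmod_character_minus_one_ge in \<open>auto simp: power_divide\<close>)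
  also have "\<dots> \<le> (real N)\<^sup>2 / 16 * 4"
    unfolding sum_distrib_left[symmetric] sum.distrib refl using two by (intro mult_left_mono) auto
  also have "\<dots> \<le> (real N)\<^sup>2" by simp
  finally have inv: "(\<Sum>l\<in>{1..<N}. (1 / e l)\<^sup>2) \<le> (real N)\<^sup>2" .
  have "cmod (fourier_coeff N w l) = cmod (fourier_coeff N v l) * (1 / e l)" if "l \<in> {1..<N}" for l
    using e0[OF that] fourier_coeff_difference[where w=w and l=l, OF N per] by (simp add: v_def e_def norm_mult)
  then have "(\<Sum>l\<in>{1..<N}. cmod (fourier_coeff N w l))\<^sup>2 = (\<Sum>l\<in>{1..<N}. cmod (fourier_coeff N v l) * (1 / e l))\<^sup>2"
    by simp
  also have "\<dots> \<le> (\<Sum>l\<in>{1..<N}. (cmod (fourier_coeff N v l))\<^sup>2) * (\<Sum>l\<in>{1..<N}. (1 / e l)\<^sup>2)"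
    by (rule Cauchy_Schwarz_ineq_sum)
  also have "\<dots> \<le> (L / N)\<^sup>2 * (real N)\<^sup>2"
    using pars inv by (intro mult_mono) (auto intro!: sum_nonneg)
  also have "\<dots> = L\<^sup>2" using N by (simp add: power_divide)
  finally have rest: "(\<Sum>l\<in>{1..<N}. cmod (fourier_coeff N w l)) \<le> L"
    using L by (rule power2_le_imp_le)
  \<comment> \<open>Frequency 0 is estimated directly, since the factor relating w to its difference
    sequence vanishes there.\<close>
  have "cmod (fourier_coeff N w 0) \<le> (\<Sum>t<N. cmod (w (int t))) / N"
    by (simp add: fourier_coeff_def norm_divide divide_right_mono norm_sum)
  also have "\<dots> \<le> (\<Sum>t<N. L) / N" using bound by (intro divide_right_mono sum_mono) auto
  finally have "cmod (fourier_coeff N w 0) \<le> L" using N by simp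
  moreover have "{..<N} = insert 0 {1..<N}" using N by auto
  ultimately show ?thesis using rest by simp
qed

text \<open>The shift \<open>s\<close> accounts for the nearest grid frequency below \<open>\<theta>\<close>; the remaining phase varies
  so slowly that the window, periodized with period \<open>4B\<close>, stays Lipschitz at scale \<open>1 / B\<close>.\<close>

lemma lag_window_expansion:
  fixes a :: "real \<Rightarrow> real" and L A :: real
  assumes lip: "L-lipschitz_on UNIV a" and supp: "\<And>x. 1 \<le> \<bar>x\<bar> \<Longrightarrow> a x = 0"
    and A: "\<And>x. \<bar>a x\<bar> \<le> A" and B: "0 < B" and \<theta>: "\<theta> \<in> {0..pi}"
  obtains u :: "nat \<Rightarrow> complex" and s :: int where "0 \<le> s" "s \<le> 4 * int B"
    "\<forall>t. \<bar>t\<bar> < 2 * int B \<longrightarrow> of_real (a (of_int t * (1 / real B))) * exp (- (\<i> * of_int t * of_real \<theta>))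
        = (\<Sum>l<4 * B. u l * character (4 * B) (int l - s) t)"
    "(\<Sum>l<4 * B. cmod (u l)) \<le> 2 * (4 * L + 7 * A)"
proof -
  \<comment> \<open>The period is 4 B because lags of any size below 2 B occur between a block and
    its neighbourhood; they must be represented without wrap-around.\<close>
  define N where "N = 4 * B"
  have N: "0 < N" using B by (simp add: N_def)
  define s where "s = \<lfloor>\<theta> * N / (2 * pi)\<rfloor>"
  define \<beta> where "\<beta> = \<theta> - 2 * pi * s / N"
  have L: "0 \<le> L" using lip by (rule lipschitz_on_nonneg)
  have A0: "0 \<le> A" using A[of 0] by linarith
  have s_bounds: "of_int s \<le> \<theta> * N / (2 * pi)" "\<theta> * N / (2 * pi) < of_int s + 1"
    by (auto simp: s_def)
  have "\<theta> * N < 2 * pi * (s + 1)" "2 * pi * s \<le> \<theta> * N"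
    using s_bounds by (auto simp: field_simps)
  then have "\<theta> < 2 * pi * (s + 1) / N" "2 * pi * s / N \<le> \<theta>"
    using N by (auto simp: pos_less_divide_eq pos_divide_le_eq)
  then have \<beta>: "0 \<le> \<beta>" "\<beta> \<le> 2 * pi / N"
    by (auto simp: \<beta>_def distrib_left add_divide_distrib)
  have s0: "0 \<le> s" using \<theta> by (simp add: s_def)
  have "\<theta> * N / (2 * pi) \<le> real N"
    using \<theta> N by (simp add: field_simps)
  then have "real_of_int s \<le> real_of_int (int N)" using s_bounds by simp
  then have sN: "s \<le> int N" by (simp only: of_int_le_iff)
  \<comment> \<open>The representative of t modulo N in [-2 B, 2 B).\<close>
  define r where "r = (\<lambda>t. (t + 2 * int B) mod int N - 2 * int B)"
  define h where "h = (\<lambda>t::int. of_real (a (of_int t / real B)) * cis (- \<beta> * of_int t))"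
  define w where "w = (\<lambda>t. h (r t))"
  have r_id: "r t = t" if "\<bar>t\<bar> < 2 * int B" for t
    using that by (simp add: r_def N_def)
  have h0: "h t = 0" if "int B \<le> \<bar>t\<bar>" for t
  proof -
    have "real_of_int (int B) \<le> real_of_int \<bar>t\<bar>" using that by (simp only: of_int_le_iff)
    then have "1 \<le> \<bar>of_int t / real B\<bar>" using B by (simp add: field_simps)
    then show ?thesis using supp by (simp add: h_def)
  qed
  have hA: "cmod (h t) \<le> A" for t using A by (simp add: h_def norm_mult)
  \<comment> \<open>L / B = 4 L / N is the variation of the window over one lag, and 7 bounds 2 pi
    in the variation 2 pi / N of the remaining phase.\<close>
  have hdiff: "cmod (h (t + 1) - h t) \<le> (4 * L + 7 * A) / N" for t
  proof -
    have "\<bar>a (of_int (t + 1) / real B) - a (of_int t / real B)\<bar> \<le> L * \<bar>of_int (t + 1) / real B - of_int t / real B\<bar>"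
      using lipschitz_onD[OF lip, of "of_int (t + 1) / real B" "of_int t / real B"] by (simp add: dist_real_def)
    also have "\<dots> = 4 * L / N" using B by (simp add: N_def flip: diff_divide_distrib)
    finally have 1: "\<bar>a (of_int (t + 1) / real B) - a (of_int t / real B)\<bar> \<le> 4 * L / N" .
    have "cmod (cis (- \<beta> * of_int (t + 1)) - cis (- \<beta> * of_int t)) \<le> \<bar>- \<beta> * of_int (t + 1) - - \<beta> * of_int t\<bar>"
      by (rule cmod_cis_diff_le)
    also have "\<dots> = \<beta>" using \<beta> by (simp add: algebra_simps)
    finally have 2: "cmod (cis (- \<beta> * of_int (t + 1)) - cis (- \<beta> * of_int t)) \<le> 2 * pi / N" using \<beta> by linarith
    have "cmod (h (t + 1) - h t) \<le> \<bar>a (of_int (t + 1) / real B) - a (of_int t / real B)\<bar>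
        + \<bar>a (of_int t / real B)\<bar> * cmod (cis (- \<beta> * of_int (t + 1)) - cis (- \<beta> * of_int t))"
      unfolding h_def by (rule cmod_scaled_diff_le) simp
    also have "\<dots> \<le> 4 * L / N + A * (2 * pi / N)"
      using 1 2 A[of "of_int t / real B"] A0 by (intro add_mono mult_mono) auto
    also have "\<dots> \<le> (4 * L + 7 * A) / N"
      using A0 pi_approx mult_left_mono[of "2 * pi" 7 A]
      by (simp add: add_divide_distrib[symmetric] divide_right_mono mult_ac)
    finally show ?thesis .
  qed
  have per: "w (t mod int N) = w t" for t
    by (simp add: w_def r_def mod_simps)
  have bound: "cmod (w t) \<le> 4 * L + 7 * A" for t
    using hA[of "r t"] L A0 by (simp add: w_def)
  have wlip: "cmod (w (t + 1) - w t) \<le> (4 * L + 7 * A) / N" for t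
  \<comment> \<open>At the seam the representative jumps from 2 B - 1 to -2 B. Both lie outside the
    support of the window, so periodizing creates no jump in the values.\<close>
  proof (cases "(t + 2 * int B) mod int N = int N - 1")
    case True
    have "(t + 2 * int B + 1) mod int N = ((t + 2 * int B) mod int N + 1) mod int N" by (simp add: mod_simps)
    also have "\<dots> = 0" by (simp add: True)
    finally have "r (t + 1) = - 2 * int B" by (simp add: r_def add_ac)
    moreover have "r t = 2 * int B - 1" using True by (simp add: r_def N_def)
    ultimately have "w (t + 1) = 0" "w t = 0" using B by (auto simp: w_def intro!: h0)
    then show ?thesis using L A0 by simp
  next
    case False
    have "(t + 2 * int B) mod int N < int N" "0 \<le> (t + 2 * int B) mod int N" using N by auto
    then have "((t + 2 * int B) mod int N + 1) mod int N = (t + 2 * int B) mod int N + 1"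
      using False by (intro mod_pos_pos_trivial) auto
    then have "(t + 2 * int B + 1) mod int N = (t + 2 * int B) mod int N + 1" by (simp add: mod_simps)
    then have "r (t + 1) = r t + 1" by (simp add: r_def add_ac)
    then show ?thesis using hdiff[of "r t"] by (simp add: w_def)
  qed
  show ?thesis
  proof (rule that[of s "fourier_coeff N w"]; (intro allI impI)?)
    show "0 \<le> s" "s \<le> 4 * int B" using s0 sN by (auto simp: N_def)
    show "(\<Sum>l<4 * B. cmod (fourier_coeff N w l)) \<le> 2 * (4 * L + 7 * A)"
      using sum_fourier_coeff_le[OF N per bound wlip] by (simp add: N_def)
    fix t :: int assume t: "\<bar>t\<bar> < 2 * int B"
    have "exp (- (\<i> * of_int t * of_real \<theta>)) = cis (- \<theta> * of_int t)"
      by (simp add: cis_conv_exp mult_ac)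
    also have "- \<theta> * of_int t = - \<beta> * of_int t + 2 * pi * of_int (- s * t) / N"
      by (simp add: \<beta>_def algebra_simps)
    also have "cis \<dots> = cis (- \<beta> * of_int t) * character N (- s) t"
      by (simp only: cis_mult character_def)
    finally have "of_real (a (of_int t * (1 / real B))) * exp (- (\<i> * of_int t * of_real \<theta>)) = w t * character N (- s) t"
      using r_id[OF t] by (simp add: w_def h_def)
    also have "\<dots> = (\<Sum>l<N. fourier_coeff N w l * character N (int l) t) * character N (- s) t"
      using fourier_inversion[where w=w and t=t, OF N per] by simp
    also have "\<dots> = (\<Sum>l<N. fourier_coeff N w l * character N (int l - s) t)"
      using character_add_left[of N _ "- s" t] by (simp add: sum_distrib_right mult.assoc)
    finally show "of_real (a (of_int t * (1 / real B))) * exp (- (\<i> * of_int t * of_real \<theta>))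
        = (\<Sum>l<4 * B. fourier_coeff N w l * character (4 * B) (int l - s) t)" by (simp add: N_def)
  qed
qed

section \<open>Approximation of causal processes by finitely dependent ones\<close>

text \<open>Split at the level t: below it compare with the power \<alpha>, above it with the power
  Q. Leaving t free allows it to be balanced against the decay rate.\<close>

lemma powr_interpolation_le:
  fixes D t :: real
  assumes "0 \<le> D" "0 < t" "\<alpha> \<le> q" "q \<le> Q"
  shows "D powr q \<le> t powr (q - \<alpha>) * D powr \<alpha> + t powr (q - Q) * D powr Q"
proof (cases "D = 0")
  case False
  then have D: "0 < D" using assms by simp
  show ?thesis
  proof (cases "D \<le> t")
    case True
    have "D powr q = D powr (q - \<alpha>) * D powr \<alpha>" by (simp flip: powr_add)
    also have "\<dots> \<le> t powr (q - \<alpha>) * D powr \<alpha>"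
      using True D assms by (intro mult_right_mono powr_mono2) auto
    finally show ?thesis by (simp add: add_increasing2)
  next
    case False
    have "D powr q = D powr (q - Q) * D powr Q" by (simp flip: powr_add)
    also have "\<dots> \<le> t powr (q - Q) * D powr Q"
      using False D assms by (intro mult_right_mono powr_mono2') auto
    finally show ?thesis by (simp add: add_increasing)
  qed
qed (use assms in auto)

lemma powr_split_le:
  fixes D s :: real
  assumes "0 \<le> D" "0 < s" "0 < q" "q \<le> \<alpha>"
  shows "D powr q \<le> s powr q + s powr (q - \<alpha>) * D powr \<alpha>"
  using powr_interpolation_le[of D s 0 q \<alpha>] assms by (cases "D = 0") auto

text \<open>Geometric decay passes from order \<alpha> to order q. When \<alpha> <= q the moment of
  order Q controls large values, and q < Q keeps the new exponent \<open>\<kappa>\<close> positive;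
  when \<alpha> > q, splitting off small values is enough.\<close>

lemma (in prob_space) nn_integral_powr_geometric:
  fixes \<alpha> q Q c \<rho> :: real and D :: "nat \<Rightarrow> 'a \<Rightarrow> real"
  assumes \<alpha>: "0 < \<alpha>" and q: "0 < q" "q < Q" and c: "0 < c" and \<rho>: "0 < \<rho>" "\<rho> < 1"
    and Dm[measurable]: "\<And>n. D n \<in> borel_measurable M" and D: "\<And>n x. 0 \<le> D n x"
    and D\<alpha>: "\<And>n. 1 \<le> n \<Longrightarrow> (\<integral>\<^sup>+ x. ennreal (D n x powr \<alpha>) \<partial>M) \<le> ennreal (c * \<rho> ^ n)"
    and DQ: "\<And>n. (\<integral>\<^sup>+ x. ennreal (D n x powr Q) \<partial>M) \<le> ennreal c"
  obtains c' \<rho>' where "0 < c'" "0 < \<rho>'" "\<rho>' < 1"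
    "\<And>n. 1 \<le> n \<Longrightarrow> (\<integral>\<^sup>+ x. ennreal (D n x powr q) \<partial>M) \<le> ennreal (c' * \<rho>' ^ n)"
proof (cases "\<alpha> \<le> q")
  case True
  define \<kappa> where "\<kappa> = (Q - q) / (Q - \<alpha>)"
  have \<kappa>: "0 < \<kappa>" using True q by (simp add: \<kappa>_def)
  show ?thesis
  proof (rule that[of "2 * c" "\<rho> powr \<kappa>"])
    show "\<rho> powr \<kappa> < 1" using powr_less_mono2[OF \<kappa>, of \<rho> 1] \<rho> by simp
    fix n :: nat assume n: "1 \<le> n"
    note 1 = D\<alpha>[OF n] and 2 = DQ[of n]
    \<comment> \<open>The level grows with n so that both terms of the interpolation decay at the
      common rate \<open>\<rho> powr (\<kappa> * n)\<close>.\<close>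
    define t where "t = \<rho> powr (- real n / (Q - \<alpha>))"
    have t: "0 < t" using \<rho> by (simp add: t_def)
    have eq: "(q - \<alpha>) / (Q - \<alpha>) = 1 - \<kappa>" using True q by (simp add: \<kappa>_def field_simps)
    have t1: "t powr (q - \<alpha>) * \<rho> ^ n = (\<rho> powr \<kappa>) ^ n"
    proof -
      have "t powr (q - \<alpha>) = \<rho> powr (- (real n * ((q - \<alpha>) / (Q - \<alpha>))))"
        by (simp add: t_def powr_powr)
      then have "t powr (q - \<alpha>) * \<rho> ^ n = \<rho> powr (- (real n * (1 - \<kappa>))) * \<rho> powr (real n)"
        using \<rho> by (simp add: eq powr_realpow)
      also have "\<dots> = \<rho> powr (- (real n * (1 - \<kappa>)) + real n)"
        by (rule powr_add[symmetric])
      also have "\<dots> = \<rho> powr (\<kappa> * real n)" by (simp add: algebra_simps)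
      also have "\<dots> = (\<rho> powr \<kappa>) ^ n" using \<rho> by (simp add: powr_powr flip: powr_realpow)
      finally show ?thesis .
    qed
    have t2: "t powr (q - Q) = (\<rho> powr \<kappa>) ^ n"
    proof -
      have "t powr (q - Q) = \<rho> powr (\<kappa> * real n)"
        by (simp add: t_def powr_powr \<kappa>_def algebra_simps diff_divide_distrib)
      also have "\<dots> = (\<rho> powr \<kappa>) ^ n" using \<rho> by (simp add: powr_powr flip: powr_realpow)
      finally show ?thesis .
    qed
    have "(\<integral>\<^sup>+ x. ennreal (D n x powr q) \<partial>M)
        \<le> (\<integral>\<^sup>+ x. ennreal (t powr (q - \<alpha>)) * ennreal (D n x powr \<alpha>) + ennreal (t powr (q - Q)) * ennreal (D n x powr Q) \<partial>M)"
      using powr_interpolation_le[OF D t True, of Q] q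
      by (intro nn_integral_mono) (simp add: ennreal_leI flip: ennreal_mult ennreal_plus)
    also have "\<dots> = ennreal (t powr (q - \<alpha>)) * (\<integral>\<^sup>+ x. ennreal (D n x powr \<alpha>) \<partial>M)
        + ennreal (t powr (q - Q)) * (\<integral>\<^sup>+ x. ennreal (D n x powr Q) \<partial>M)"
      by (simp add: nn_integral_add nn_integral_cmult)
    also have "\<dots> \<le> ennreal (t powr (q - \<alpha>)) * ennreal (c * \<rho> ^ n) + ennreal (t powr (q - Q)) * ennreal c"
      using 1 2 by (intro add_mono mult_left_mono) auto
    also have "\<dots> = ennreal (t powr (q - \<alpha>) * \<rho> ^ n * c + t powr (q - Q) * c)"
      using c \<rho> by (simp add: mult_ac flip: ennreal_mult ennreal_plus)
    also have "t powr (q - \<alpha>) * \<rho> ^ n * c + t powr (q - Q) * c = 2 * c * (\<rho> powr \<kappa>) ^ n"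
      by (simp only: t1 t2) simp
    finally show "(\<integral>\<^sup>+ x. ennreal (D n x powr q) \<partial>M) \<le> ennreal (2 * c * (\<rho> powr \<kappa>) ^ n)" .
  qed (use c \<rho> in auto)
next
  case False
  show ?thesis
  proof (rule that[of "1 + c" "\<rho> powr (q / \<alpha>)"])
    show "\<rho> powr (q / \<alpha>) < 1" using powr_less_mono2[of "q / \<alpha>" \<rho> 1] \<rho> q \<alpha> by simp
    fix n :: nat assume n: "1 \<le> n"
    note 1 = D\<alpha>[OF n]
    \<comment> \<open>This level makes s^q and s^(q - \<alpha>) \<rho>^n equal.\<close>
    define s where "s = \<rho> powr (real n / \<alpha>)"
    have s: "0 < s" using \<rho> by (simp add: s_def)
    have s1: "s powr q = (\<rho> powr (q / \<alpha>)) ^ n"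
      using \<rho> by (simp add: s_def powr_powr mult_ac flip: powr_realpow)
    have "s powr (q - \<alpha>) * \<rho> ^ n = \<rho> powr (real n / \<alpha> * (q - \<alpha>) + real n)"
      using \<rho> by (simp add: s_def powr_powr powr_add powr_realpow)
    also have "\<dots> = \<rho> powr (q / \<alpha> * real n)" using \<alpha> by (simp add: field_simps)
    also have "\<dots> = (\<rho> powr (q / \<alpha>)) ^ n" using \<rho> by (simp add: powr_powr flip: powr_realpow)
    finally have s2: "s powr (q - \<alpha>) * \<rho> ^ n = (\<rho> powr (q / \<alpha>)) ^ n" .
    have "(\<integral>\<^sup>+ x. ennreal (D n x powr q) \<partial>M)
        \<le> (\<integral>\<^sup>+ x. ennreal (s powr q) + ennreal (s powr (q - \<alpha>)) * ennreal (D n x powr \<alpha>) \<partial>M)"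
      using powr_split_le[OF D s, of q \<alpha>] False q
      by (intro nn_integral_mono) (simp add: ennreal_leI flip: ennreal_mult ennreal_plus)
    also have "\<dots> = ennreal (s powr q) + ennreal (s powr (q - \<alpha>)) * (\<integral>\<^sup>+ x. ennreal (D n x powr \<alpha>) \<partial>M)"
      using emeasure_space_1 by (simp add: nn_integral_add nn_integral_cmult)
    also have "\<dots> \<le> ennreal (s powr q) + ennreal (s powr (q - \<alpha>)) * ennreal (c * \<rho> ^ n)"
      using 1 by (intro add_mono mult_left_mono) auto
    also have "\<dots> = ennreal (s powr q + s powr (q - \<alpha>) * \<rho> ^ n * c)"
      using c \<rho> by (simp add: mult_ac flip: ennreal_mult ennreal_plus)
    also have "s powr q + s powr (q - \<alpha>) * \<rho> ^ n * c = (1 + c) * (\<rho> powr (q / \<alpha>)) ^ n"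
      by (simp only: s1 s2) (simp add: algebra_simps)
    finally show "(\<integral>\<^sup>+ x. ennreal (D n x powr q) \<partial>M) \<le> ennreal ((1 + c) * (\<rho> powr (q / \<alpha>)) ^ n)" .
  qed (use c \<rho> in auto)
qed

lemma moment_leI_nn_integral:
  assumes "Z \<in> borel_measurable M" "(\<integral>\<^sup>+ \<omega>. ennreal (\<bar>Z \<omega>\<bar> powr p) \<partial>M) \<le> ennreal (c powr p)"
  shows "moment_le M p Z c"
proof -
  note [measurable] = assms(1)
  have "integrable M (\<lambda>\<omega>. \<bar>Z \<omega>\<bar> powr p)"
    by (rule integrableI_nonneg) (use assms(2) in \<open>auto intro: le_less_trans\<close>)
  moreover from this have "ennreal (\<integral>\<omega>. \<bar>Z \<omega>\<bar> powr p \<partial>M) \<le> ennreal (c powr p)"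
    using assms(2) by (simp add: nn_integral_eq_integral)
  ultimately show ?thesis using assms(1) by (simp add: moment_le_def)
qed

lemma abs_diff_powr_le:
  fixes x y p :: real
  assumes "0 < p"
  shows "\<bar>x - y\<bar> powr p \<le> 2 powr p * (\<bar>x\<bar> powr p + \<bar>y\<bar> powr p)"
proof -
  have "\<bar>x - y\<bar> powr p \<le> (2 * max \<bar>x\<bar> \<bar>y\<bar>) powr p"
    using assms by (intro powr_mono2) auto
  also have "\<dots> = 2 powr p * max \<bar>x\<bar> \<bar>y\<bar> powr p" by (simp add: powr_mult)
  also have "\<dots> \<le> 2 powr p * (\<bar>x\<bar> powr p + \<bar>y\<bar> powr p)"
    by (intro mult_left_mono) (auto simp: max_def)
  finally show ?thesis .
qed

section \<open>Stationarity: the law of the past of an i.i.d. sequence\<close>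

locale iid_innovations = innovations M S \<epsilon>
  for M :: "'a measure" and S :: "'s measure" and \<epsilon> :: "int \<Rightarrow> 'a \<Rightarrow> 's" +
  fixes \<mu> :: "'s measure"
  assumes law_innovation: "\<And>i. distr M S (\<epsilon> i) = \<mu>"
begin

abbreviation path_law :: "(nat \<Rightarrow> 's) measure" where
  "path_law \<equiv> PiM UNIV (\<lambda>_. \<mu>)"

definition past :: "int \<Rightarrow> 'a \<Rightarrow> nat \<Rightarrow> 's" where
  "past i \<omega> j = \<epsilon> (i - int j) \<omega>"

lemma causal_process_eq: "causal_process G \<epsilon> i \<omega> = G (past i \<omega>)"
  by (simp add: causal_process_def past_def[abs_def])

lemma prob_space_\<mu>: "prob_space \<mu>"
  using prob_space_distr[OF measurable_innovation[of 0]] by (simp add: law_innovation)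

lemma sets_path_law: "sets path_law = sets (PiM UNIV (\<lambda>_. S))"
  by (intro sets_PiM_cong) (simp_all flip: law_innovation[of 0])

lemma sequence_space_\<mu>: "sequence_space \<mu>"
proof -
  interpret Q: prob_space \<mu> by (rule prob_space_\<mu>)
  show ?thesis by unfold_locales
qed

lemma prob_space_path_law: "prob_space path_law"
  by (intro prob_space_PiM prob_space_\<mu>)

lemma measurable_past: "past i \<in> measurable M path_law"
proof -
  have "(\<lambda>\<omega>. \<lambda>j\<in>UNIV. past i \<omega> j) \<in> measurable M (PiM UNIV (\<lambda>_. S))"
    unfolding past_def by (intro measurable_restrict measurable_innovation)
  then show ?thesis using sets_path_law by (simp add: restrict_UNIV cong: measurable_cong_sets)
qed

lemma distr_past: "distr M path_law (past i) = path_law"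
proof -
  have "indep_vars (\<lambda>_. S) (\<lambda>j::nat. \<epsilon> (i - int j)) UNIV"
    by (rule indep_vars_win[of "\<lambda>j. {i - int j}"])
       (auto simp: disjoint_family_on_def measurable_win_innovation)
  then have "distr M (PiM UNIV (\<lambda>_. S)) (\<lambda>\<omega>. \<lambda>j\<in>UNIV. \<epsilon> (i - int j) \<omega>)
      = PiM UNIV (\<lambda>j::nat. distr M S (\<epsilon> (i - int j)))"
    by (subst (asm) indep_vars_iff_distr_eq_PiM) (auto simp: measurable_innovation)
  also have "(\<lambda>\<omega>. \<lambda>j\<in>UNIV. \<epsilon> (i - int j) \<omega>) = past i"
    by (simp add: past_def fun_eq_iff)
  finally show ?thesis
    by (simp add: law_innovation cong: distr_cong) (metis distr_cong sets_path_law)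
qed

lemma nn_integral_past:
  "f \<in> borel_measurable path_law \<Longrightarrow> (\<integral>\<^sup>+ \<omega>. f (past i \<omega>) \<partial>M) = (\<integral>\<^sup>+ x. f x \<partial>path_law)"
  using nn_integral_distr[OF measurable_past[of i], of f] by (simp add: distr_past)

text \<open>Allows two different times i and j because the coupling joins the past at time n with an
  independent past at time 0; the joint law does not depend on the times.\<close>

lemma nn_integral_past_past:
  assumes "f \<in> borel_measurable (path_law \<Otimes>\<^sub>M path_law)"
  shows "(\<integral>\<^sup>+ z. f (past i (fst z), past j (snd z)) \<partial>(M \<Otimes>\<^sub>M M)) = (\<integral>\<^sup>+ z. f z \<partial>(path_law \<Otimes>\<^sub>M path_law))"
proof -
  have "path_law \<Otimes>\<^sub>M path_law
      = distr (M \<Otimes>\<^sub>M M) (path_law \<Otimes>\<^sub>M path_law) (\<lambda>(x, y). (past i x, past j y))"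
    using pair_measure_distr[OF measurable_past[of i] measurable_past[of j]] prob_space_path_law
    by (simp add: distr_past prob_space_imp_sigma_finite)
  then have "(\<integral>\<^sup>+ z. f z \<partial>(path_law \<Otimes>\<^sub>M path_law))
      = (\<integral>\<^sup>+ z. f z \<partial>distr (M \<Otimes>\<^sub>M M) (path_law \<Otimes>\<^sub>M path_law) (\<lambda>(x, y). (past i x, past j y)))"
    by simp
  also have "\<dots> = (\<integral>\<^sup>+ z. f (past i (fst z), past j (snd z)) \<partial>(M \<Otimes>\<^sub>M M))"
    using measurable_past[of i] measurable_past[of j] assms
    by (subst nn_integral_distr) (auto simp: case_prod_beta)
  finally show ?thesis ..
qed

text \<open>\<open>comb_seq k\<close> takes the entries j < k from the past and all later ones from
  the fixed sequence y.\<close>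

lemma measurable_comb_past:
  assumes "y \<in> space path_law"
  shows "(\<lambda>\<omega>. comb_seq k (past i \<omega>) y) \<in> measurable (win {i - int k..i}) path_law"
proof -
  have y: "y j \<in> space S" for j
    using assms by (auto simp: space_PiM PiE_iff simp flip: law_innovation[of 0])
  have "(\<lambda>\<omega>. \<lambda>j\<in>UNIV. comb_seq k (past i \<omega>) y j) \<in> measurable (win {i - int k..i}) (PiM UNIV (\<lambda>_. S))"
  proof (rule measurable_restrict)
    fix j :: nat
    show "(\<lambda>\<omega>. comb_seq k (past i \<omega>) y j) \<in> measurable (win {i - int k..i}) S"
      using y by (cases "j < k") (auto simp: comb_seq_def past_def intro!: measurable_win_innovation)
  qed
  then show ?thesis using sets_path_law by (simp add: restrict_UNIV cong: measurable_cong_sets)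
qed

text \<open>Instead of conditional expectations, the approximation freezes the remote past at a
  suitable point \<open>y k\<close>; such a point exists because the average over \<open>y\<close> is small.\<close>

lemma causal_approximation:
  fixes G :: "(nat \<Rightarrow> 's) \<Rightarrow> real"
  assumes G: "G \<in> borel_measurable (PiM UNIV (\<lambda>_. S))"
    and X: "X = causal_process G \<epsilon>"
    and mean: "\<And>k. expectation (X k) = 0"
    and \<alpha>: "0 < \<alpha>" and gmc: "GMC M G \<epsilon> \<alpha>"
    and q: "1 \<le> q" "q < Q" and int: "\<And>k. integrable M (\<lambda>\<omega>. \<bar>X k \<omega>\<bar> powr Q)"
  obtains Xa :: "nat \<Rightarrow> int \<Rightarrow> 'a \<Rightarrow> real" and C \<rho> where
    "0 < C" "0 < \<rho>" "\<rho> < 1" "\<forall>i \<omega>. Xa 0 i \<omega> = 0"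
    "\<forall>k i. Xa k i \<in> borel_measurable (win {i - int k..i})"
    "\<forall>k i. expectation (Xa k i) = 0"
    "\<forall>k i. moment_le M q (\<lambda>\<omega>. Xa k i \<omega> - X i \<omega>) (C * \<rho> ^ k)"
proof -
  interpret P: prob_space path_law by (rule prob_space_path_law)
  interpret PP: pair_prob_space path_law path_law ..
  have Gm[measurable]: "G \<in> borel_measurable path_law"
    using G sets_path_law by (simp cong: measurable_cong_sets)
  have Xeq: "X i \<omega> = G (past i \<omega>)" for i \<omega> by (simp add: X causal_process_eq)
  note [measurable] = measurable_past
  have Xm[measurable]: "X i \<in> borel_measurable M" for i
    unfolding X causal_process_eq[abs_def] by measurable
  define c0 where "c0 = expectation (\<lambda>\<omega>. \<bar>X 0 \<omega>\<bar> powr Q)"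
  have c0: "0 \<le> c0" by (simp add: c0_def)
  have GQ: "(\<integral>\<^sup>+ x. ennreal (\<bar>G x\<bar> powr Q) \<partial>path_law) = ennreal c0"
    using nn_integral_past[of "\<lambda>x. ennreal (\<bar>G x\<bar> powr Q)" 0] int[of 0]
    by (simp add: c0_def nn_integral_eq_integral flip: Xeq)
  obtain c1 \<rho>1 where c1: "0 < c1" "0 < \<rho>1" "\<rho>1 < 1"
    and gmc1: "\<And>n::nat. 1 \<le> n \<Longrightarrow>
       (\<integral>\<^sup>+ z. ennreal (\<bar>causal_process G (coupled_innovations \<epsilon>) (int n) z
                      - causal_process G \<epsilon> (int n) (fst z)\<bar> powr \<alpha>) \<partial>(M \<Otimes>\<^sub>M M)) \<le> ennreal (c1 * \<rho>1 ^ n)"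
    using gmc unfolding GMC_def by blast
  define D where "D = (\<lambda>n (z :: (nat \<Rightarrow> 's) \<times> (nat \<Rightarrow> 's)). \<bar>G (comb_seq n (fst z) (snd z)) - G (fst z)\<bar>)"
  have Dm[measurable]: "D n \<in> borel_measurable (path_law \<Otimes>\<^sub>M path_law)" for n
    unfolding D_def by measurable
  have D\<alpha>: "(\<integral>\<^sup>+ z. ennreal (D n z powr \<alpha>) \<partial>(path_law \<Otimes>\<^sub>M path_law)) \<le> ennreal (c1 * \<rho>1 ^ n)" if n: "1 \<le> n" for n
  proof -
    \<comment> \<open>Entry j has time n - j, and n - j >= 1 means j < n. Hence the first n entries
      are original, and entry j >= n is entry j - n of the copied past at time 0.\<close>
    have "(\<lambda>j. coupled_innovations \<epsilon> (int n - int j) z) = comb_seq n (past (int n) (fst z)) (past 0 (snd z))" for z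
      by (auto simp: fun_eq_iff coupled_innovations_def comb_seq_def past_def case_prod_beta of_nat_diff)
    then have "causal_process G (coupled_innovations \<epsilon>) (int n) z = G (comb_seq n (past (int n) (fst z)) (past 0 (snd z)))" for z
      by (simp add: causal_process_def)
    then have "(\<integral>\<^sup>+ z. ennreal (D n (past (int n) (fst z), past 0 (snd z)) powr \<alpha>) \<partial>(M \<Otimes>\<^sub>M M)) \<le> ennreal (c1 * \<rho>1 ^ n)"
      using gmc1[OF n] by (simp add: D_def causal_process_eq)
    then show ?thesis by (subst (asm) nn_integral_past_past) auto
  qed
  \<comment> \<open>Splicing two independent paths gives a path with the same law, so the coupled
    value has the same Q-th moment as the original one.\<close>
  have DQ: "(\<integral>\<^sup>+ z. ennreal (D n z powr Q) \<partial>(path_law \<Otimes>\<^sub>M path_law)) \<le> ennreal (2 powr Q * (c0 + c0))" for n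
  proof -
    have "(\<integral>\<^sup>+ z. ennreal (\<bar>G (comb_seq n (fst z) (snd z))\<bar> powr Q) \<partial>(path_law \<Otimes>\<^sub>M path_law))
        = (\<integral>\<^sup>+ x. ennreal (\<bar>G x\<bar> powr Q) \<partial>distr (path_law \<Otimes>\<^sub>M path_law) path_law (\<lambda>(x, y). comb_seq n x y))"
      by (subst nn_integral_distr) (auto simp: case_prod_beta)
    also have "\<dots> = ennreal c0"
      by (simp add: sequence_space.PiM_comb_seq[OF sequence_space_\<mu>] GQ)
    finally have comb: "(\<integral>\<^sup>+ z. ennreal (\<bar>G (comb_seq n (fst z) (snd z))\<bar> powr Q) \<partial>(path_law \<Otimes>\<^sub>M path_law)) = ennreal c0" .
    have "(\<integral>\<^sup>+ z. ennreal (\<bar>G (fst z)\<bar> powr Q) \<partial>(path_law \<Otimes>\<^sub>M path_law)) = (\<integral>\<^sup>+ x. \<integral>\<^sup>+ y. ennreal (\<bar>G x\<bar> powr Q) \<partial>path_law \<partial>path_law)"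
      by (subst P.nn_integral_fst[symmetric]) auto
    also have "\<dots> = ennreal c0" by (simp add: GQ P.emeasure_space_1)
    finally have fst: "(\<integral>\<^sup>+ z. ennreal (\<bar>G (fst z)\<bar> powr Q) \<partial>(path_law \<Otimes>\<^sub>M path_law)) = ennreal c0" .
    have "(\<integral>\<^sup>+ z. ennreal (D n z powr Q) \<partial>(path_law \<Otimes>\<^sub>M path_law))
      \<le> (\<integral>\<^sup>+ z. ennreal (2 powr Q) * (ennreal (\<bar>G (comb_seq n (fst z) (snd z))\<bar> powr Q) + ennreal (\<bar>G (fst z)\<bar> powr Q)) \<partial>(path_law \<Otimes>\<^sub>M path_law))"
      using abs_diff_powr_le[of Q] q unfolding D_def
      by (intro nn_integral_mono) (simp add: ennreal_leI flip: ennreal_mult ennreal_plus)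
    also have "\<dots> = ennreal (2 powr Q) * (ennreal c0 + ennreal c0)"
      by (simp add: nn_integral_cmult nn_integral_add comb fst)
    also have "\<dots> = ennreal (2 powr Q * (c0 + c0))"
      using c0 by (simp flip: ennreal_mult ennreal_plus)
    finally show ?thesis .
  qed
  define c2 where "c2 = c1 + 2 powr Q * (c0 + c0)"
  have c2: "c1 \<le> c2" "2 powr Q * (c0 + c0) \<le> c2" "0 < c2" using c1 c0 by (auto simp: c2_def add_pos_nonneg)
  obtain c3 \<rho>3 where c3: "0 < c3" "0 < \<rho>3" "\<rho>3 < 1"
    and Dq: "\<And>n. 1 \<le> n \<Longrightarrow> (\<integral>\<^sup>+ z. ennreal (D n z powr q) \<partial>(path_law \<Otimes>\<^sub>M path_law)) \<le> ennreal (c3 * \<rho>3 ^ n)"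
  proof (rule PP.nn_integral_powr_geometric[OF \<alpha> _ q(2) c2(3) c1(2,3) Dm])
    show "(\<integral>\<^sup>+ z. ennreal (D n z powr \<alpha>) \<partial>(path_law \<Otimes>\<^sub>M path_law)) \<le> ennreal (c2 * \<rho>1 ^ n)" if "1 \<le> n" for n
      using D\<alpha>[OF that] by (rule order.trans) (use c1 c2 in \<open>auto intro!: ennreal_leI mult_right_mono\<close>)
    show "(\<integral>\<^sup>+ z. ennreal (D n z powr Q) \<partial>(path_law \<Otimes>\<^sub>M path_law)) \<le> ennreal c2" for n
      using DQ[of n] by (rule order.trans) (use c2 in \<open>auto intro!: ennreal_leI\<close>)
  qed (use q that in \<open>auto simp: D_def\<close>)
  \<comment> \<open>The factor 2 leaves room for the averaging argument: if every y failed, the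
    average would be at least twice its upper bound. The same y serves every time i, since all pasts
    have the same law.\<close>
  have "\<exists>y\<in>space path_law. (\<integral>\<^sup>+ x. ennreal (D n (x, y) powr q) \<partial>path_law) \<le> ennreal (2 * c3 * \<rho>3 ^ n)" if n: "1 \<le> n" for n
  proof (rule ccontr)
    assume "\<not> ?thesis"
    then have "(\<integral>\<^sup>+ y. ennreal (2 * c3 * \<rho>3 ^ n) \<partial>path_law) \<le> (\<integral>\<^sup>+ y. \<integral>\<^sup>+ x. ennreal (D n (x, y) powr q) \<partial>path_law \<partial>path_law)"
      by (intro nn_integral_mono) auto
    also have "\<dots> = (\<integral>\<^sup>+ z. ennreal (D n z powr q) \<partial>(path_law \<Otimes>\<^sub>M path_law))"
      by (rule PP.nn_integral_snd) measurable
    also have "\<dots> \<le> ennreal (c3 * \<rho>3 ^ n)" by (rule Dq[OF n])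
    finally have "2 * c3 * \<rho>3 ^ n \<le> c3 * \<rho>3 ^ n" using c3 by (simp add: P.emeasure_space_1)
    then show False using c3 by simp
  qed
  then obtain y where y: "\<And>n. 1 \<le> n \<Longrightarrow> y n \<in> space path_law"
    and Dy: "\<And>n. 1 \<le> n \<Longrightarrow> (\<integral>\<^sup>+ x. ennreal (D n (x, y n) powr q) \<partial>path_law) \<le> ennreal (2 * c3 * \<rho>3 ^ n)"
    by metis
  define H where "H = (\<lambda>k i \<omega>. G (comb_seq k (past i \<omega>) (y k)))"
  \<comment> \<open>Centring preserves mean zero. Scale 0 is set to 0 so that sums of increments
    telescope from nothing.\<close>
  define Xa where "Xa = (\<lambda>k i \<omega>. if k = 0 then 0 else H k i \<omega> - expectation (H k i))"
  define \<rho> where "\<rho> = \<rho>3 powr (1 / q)"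
  define c4 where "c4 = (2 * c3) powr (1 / q)"
  \<comment> \<open>The first term pays for centring the error at scales k >= 1; the second bounds X
    itself, which is the error at scale 0.\<close>
  define C where "C = 3 * c4 + 2 powr (1 / q) * (c0 + 1) powr (1 / Q)"
  have \<rho>: "0 < \<rho>" "\<rho> < 1" using c3 q powr_less_mono2[of "1 / q" \<rho>3 1] by (auto simp: \<rho>_def)
  have c4: "0 < c4" using c3 by (simp add: c4_def)
  have C: "0 < C" using c4 c0 by (simp add: C_def add_pos_nonneg)
  have Hm: "H k i \<in> borel_measurable (win {i - int k..i})" if "1 \<le> k" for k i
    unfolding H_def by (rule measurable_compose[OF measurable_comb_past[OF y[OF that]] Gm])
  have HX: "moment_le M q (\<lambda>\<omega>. H k i \<omega> - X i \<omega>) (c4 * \<rho> ^ k)" if k: "1 \<le> k" for k i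
  proof (rule moment_leI_nn_integral)
    show "(\<lambda>\<omega>. H k i \<omega> - X i \<omega>) \<in> borel_measurable M"
      using measurable_win_events[OF Hm[OF k]] by measurable
    have "(\<lambda>x. (x, y k)) \<in> measurable path_law (path_law \<Otimes>\<^sub>M path_law)" using y[OF k] by measurable
    then have [measurable]: "(\<lambda>x. D k (x, y k)) \<in> borel_measurable path_law"
      using measurable_compose[OF _ Dm] by blast
    have "(\<integral>\<^sup>+ \<omega>. ennreal (\<bar>H k i \<omega> - X i \<omega>\<bar> powr q) \<partial>M) = (\<integral>\<^sup>+ \<omega>. ennreal (D k (past i \<omega>, y k) powr q) \<partial>M)"
      by (simp add: H_def D_def Xeq)
    also have "\<dots> = (\<integral>\<^sup>+ x. ennreal (D k (x, y k) powr q) \<partial>path_law)"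
      by (rule nn_integral_past) measurable
    also have "\<dots> \<le> ennreal (2 * c3 * \<rho>3 ^ k)" by (rule Dy[OF k])
    also have "2 * c3 * \<rho>3 ^ k = (c4 * \<rho> ^ k) powr q"
      using c3 q \<rho> by (simp add: c4_def \<rho>_def powr_mult powr_powr powr_realpow[symmetric])
    finally show "(\<integral>\<^sup>+ \<omega>. ennreal (\<bar>H k i \<omega> - X i \<omega>\<bar> powr q) \<partial>M) \<le> ennreal ((c4 * \<rho> ^ k) powr q)" .
  qed
  have XQ: "moment_le M Q (X i) ((c0 + 1) powr (1 / Q))" for i
  proof (rule moment_leI_nn_integral)
    have "(\<integral>\<^sup>+ \<omega>. ennreal (\<bar>X i \<omega>\<bar> powr Q) \<partial>M) = ennreal c0"
      unfolding Xeq using nn_integral_past[of "\<lambda>x. ennreal (\<bar>G x\<bar> powr Q)" i] GQ by simp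
    also have "\<dots> \<le> ennreal (((c0 + 1) powr (1 / Q)) powr Q)"
      using c0 q by (intro ennreal_leI) (simp add: powr_powr)
    finally show "(\<integral>\<^sup>+ \<omega>. ennreal (\<bar>X i \<omega>\<bar> powr Q) \<partial>M) \<le> ennreal (((c0 + 1) powr (1 / Q)) powr Q)" .
  qed simp
  have Xq: "moment_le M q (X i) (2 powr (1 / q) * (c0 + 1) powr (1 / Q))" for i
    using moment_le_lower[OF XQ, of q i] c0 q by (simp add: moment_le_def powr_mult powr_powr)
  have Xint: "integrable M (X i)" for i
    using moment_le_integrable(1)[OF XQ, of i] c0 q by simp
  show ?thesis
  proof (rule that[of C \<rho> Xa]; (intro allI)?)
    show "0 < C" "0 < \<rho>" "\<rho> < 1" by fact+
    show "Xa 0 i \<omega> = 0" for i \<omega> by (simp add: Xa_def)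
    fix k i
    show "Xa k i \<in> borel_measurable (win {i - int k..i})"
      using Hm[of k i] by (cases "k = 0") (auto simp: Xa_def)
    have Hint: "integrable M (H k i)" "expectation (\<lambda>\<omega>. H k i \<omega> - X i \<omega>) = expectation (H k i)" if k: "1 \<le> k"
    proof -
      have *: "integrable M (\<lambda>\<omega>. H k i \<omega> - X i \<omega>)"
        using moment_le_integrable(1)[OF HX[OF k]] c4 \<rho> q by simp
      from Bochner_Integration.integrable_add[OF * Xint[of i]] show **: "integrable M (H k i)" by simp
      show "expectation (\<lambda>\<omega>. H k i \<omega> - X i \<omega>) = expectation (H k i)"
        using ** Xint by (simp add: mean)
    qed
    show "expectation (Xa k i) = 0"
      using Hint(1) by (cases "k = 0") (auto simp: Xa_def prob_space)
    show "moment_le M q (\<lambda>\<omega>. Xa k i \<omega> - X i \<omega>) (C * \<rho> ^ k)"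
    proof (cases "k = 0")
      case True
      have "moment_le M q (X i) C"
        by (rule moment_le_mono[OF Xq]) (use c4 q in \<open>auto simp: C_def\<close>)
      then show ?thesis using True by (simp add: Xa_def moment_le_minus)
    next
      case False
      then have k: "1 \<le> k" by simp
      have "moment_le M q (\<lambda>\<omega>. (H k i \<omega> - X i \<omega>) - expectation (\<lambda>\<omega>. H k i \<omega> - X i \<omega>)) (3 * (c4 * \<rho> ^ k))"
        by (rule moment_le_center[OF HX[OF k]]) (use c4 \<rho> q in auto)
      then have "moment_le M q (\<lambda>\<omega>. Xa k i \<omega> - X i \<omega>) (3 * (c4 * \<rho> ^ k))"
        unfolding Hint(2)[OF k] using False by (simp add: Xa_def algebra_simps)
      then show ?thesis
        by (rule moment_le_mono) (use c4 \<rho> q in \<open>auto simp: C_def distrib_right\<close>)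
    qed
  qed
qed

end

section \<open>Bilinear forms\<close>

text \<open>The weight (k + 4)^2 dominates the range k + 4 of the products times the factor k + 1 of
  their increments. Half of the decay, sqrt \<rho>, absorbs it.\<close>

lemma sum_poly_geometric_bounded:
  fixes \<rho> :: real
  assumes "0 < \<rho>" "\<rho> < 1"
  obtains s where "0 < s" "\<And>m. (\<Sum>k=1..m. (real k + 4)\<^sup>2 * \<rho> ^ k) \<le> s"
proof -
  have lim: "(\<lambda>k::nat. (real k + 4)\<^sup>2 * sqrt \<rho> ^ k) \<longlonglongrightarrow> 0"
    using assms by real_asymp
  have "summable (\<lambda>k::nat. (real k + 4)\<^sup>2 * \<rho> ^ k)"
  proof (rule summable_comparison_test_ev)
    have "\<forall>\<^sub>F k in sequentially. (real k + 4)\<^sup>2 * sqrt \<rho> ^ k < 1"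
      using order_tendstoD(2)[OF lim, of 1] by simp
    then show "\<forall>\<^sub>F k in sequentially. norm ((real k + 4)\<^sup>2 * \<rho> ^ k) \<le> sqrt \<rho> ^ k"
    proof eventually_elim
      case (elim k)
      have "(real k + 4)\<^sup>2 * \<rho> ^ k = ((real k + 4)\<^sup>2 * sqrt \<rho> ^ k) * sqrt \<rho> ^ k"
        using assms by (simp add: mult.assoc flip: power_mult_distrib)
      also have "\<dots> \<le> 1 * sqrt \<rho> ^ k" using elim assms by (intro mult_right_mono) auto
      finally show ?case using assms by simp
    qed
    show "summable (\<lambda>k. sqrt \<rho> ^ k)" using assms by (intro summable_geometric) simp
  qed
  then have "(\<Sum>k=1..m. (real k + 4)\<^sup>2 * \<rho> ^ k) \<le> (\<Sum>k. (real k + 4)\<^sup>2 * \<rho> ^ k)" for m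
    using assms by (intro sum_le_suminf) auto
  then have "(\<Sum>k=1..m. (real k + 4)\<^sup>2 * \<rho> ^ k) \<le> \<bar>\<Sum>k. (real k + 4)\<^sup>2 * \<rho> ^ k\<bar> + 1" for m
    by (rule order.trans) linarith
  then show ?thesis by (intro that[of "\<bar>\<Sum>k. (real k + 4)\<^sup>2 * \<rho> ^ k\<bar> + 1"]) auto
qed

section \<open>Blocks of time points\<close>

definition block :: "nat \<Rightarrow> nat \<Rightarrow> int \<Rightarrow> int set" where
  "block B n r = {r * int B + 1..(r + 1) * int B} \<inter> {1..int n}"

text \<open>A block with its two adjacent blocks, cut to {1..n}. It contains every admissible j at
  distance less than B from a point of the block, and all distances to the block stay below 2
  B.\<close>

definition neighbourhood :: "nat \<Rightarrow> nat \<Rightarrow> int \<Rightarrow> int set" where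
  "neighbourhood B n r = {(r - 1) * int B + 1..(r + 2) * int B} \<inter> {1..int n}"

lemma finite_block [simp]: "finite (block B n r)"
  and finite_neighbourhood [simp]: "finite (neighbourhood B n r)"
  by (simp_all add: block_def neighbourhood_def)

lemma block_subset_neighbourhood: "block B n r \<subseteq> neighbourhood B n r"
  by (auto simp: block_def neighbourhood_def algebra_simps)

lemma card_neighbourhood: "card (neighbourhood B n r) \<le> 3 * B"
proof -
  have "card (neighbourhood B n r) \<le> card {(r - 1) * int B + 1..(r + 2) * int B}"
    unfolding neighbourhood_def by (intro card_mono) auto
  also have "\<dots> = nat ((r + 2) * int B - (r - 1) * int B)" by simp
  also have "(r + 2) * int B - (r - 1) * int B = int (3 * B)" by (simp add: algebra_simps)
  finally show ?thesis by simp
qed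

lemma card_block: "card (block B n r) \<le> 3 * B"
  using card_mono[OF finite_neighbourhood block_subset_neighbourhood] card_neighbourhood
  by (rule order.trans)

text \<open>What the estimates need from the causal representation. The requirement q > 4 puts
  products of two linear forms into L^(q/2) with q/2 > 2, the range of the Rosenthal type
  bound.\<close>

locale weak_dependence = innovations M S \<epsilon>
  for M :: "'a measure" and S :: "'s measure" and \<epsilon> :: "int \<Rightarrow> 'a \<Rightarrow> 's" +
  fixes X :: "int \<Rightarrow> 'a \<Rightarrow> real" and Xa :: "nat \<Rightarrow> int \<Rightarrow> 'a \<Rightarrow> real" and q C \<rho> :: real
  assumes q: "4 < q" and C: "0 < C" and \<rho>: "0 < \<rho>" "\<rho> < 1"
    and Xa_0: "Xa 0 i \<omega> = 0"
    and Xa_meas: "Xa k i \<in> borel_measurable (win {i - int k..i})"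
    and Xa_mean: "expectation (Xa k i) = 0"
    and Xa_approx: "moment_le M q (\<lambda>\<omega>. Xa k i \<omega> - X i \<omega>) (C * \<rho> ^ k)"
begin

lemma X_moment: "moment_le M q (X i) C"
  using Xa_approx[of 0 i] by (simp add: Xa_0 moment_le_minus)

lemma Xa_moment: "moment_le M q (Xa k i) (2 * C)"
proof -
  have "moment_le M q (\<lambda>\<omega>. (Xa k i \<omega> - X i \<omega>) + X i \<omega>) (C * \<rho> ^ k + C)"
    using q C \<rho> by (intro moment_le_add Xa_approx X_moment) auto
  then have "moment_le M q (Xa k i) (C * \<rho> ^ k + C)" by simp
  then show ?thesis
    by (rule moment_le_mono) (use q C \<rho> in \<open>auto simp: power_le_one_iff mult_left_le intro!: power_le_one\<close>)
qed

lemma Xa_integrable: "integrable M (Xa k i)"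
  using moment_le_integrable(1)[OF Xa_moment] q C by simp

lemma Xa_increment:
  assumes "1 \<le> k"
  shows "moment_le M q (\<lambda>\<omega>. Xa k i \<omega> - Xa (k - 1) i \<omega>) (2 * C / \<rho> * \<rho> ^ k)"
proof -
  have "moment_le M q (\<lambda>\<omega>. (Xa k i \<omega> - X i \<omega>) - (Xa (k - 1) i \<omega> - X i \<omega>)) (C * \<rho> ^ k + C * \<rho> ^ (k - 1))"
    using q C \<rho> by (intro moment_le_diff Xa_approx) auto
  then have "moment_le M q (\<lambda>\<omega>. Xa k i \<omega> - Xa (k - 1) i \<omega>) (C * \<rho> ^ k + C * \<rho> ^ (k - 1))"
    by simp
  then show ?thesis
  proof (rule moment_le_mono)
    have "\<rho> ^ k = \<rho> * \<rho> ^ (k - 1)" using assms by (simp flip: power_Suc)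
    moreover have "\<rho> * \<rho> ^ (k - 1) \<le> \<rho> ^ (k - 1)" using \<rho> by (intro mult_left_le_one_le) auto
    ultimately show "C * \<rho> ^ k + C * \<rho> ^ (k - 1) \<le> 2 * C / \<rho> * \<rho> ^ k"
      using C \<rho> by simp
  qed (use q C \<rho> in auto)
qed

section \<open>Linear forms in the approximations\<close>

definition lin :: "nat \<Rightarrow> int set \<Rightarrow> (int \<Rightarrow> real) \<Rightarrow> 'a \<Rightarrow> real" where
  "lin k F c \<omega> = (\<Sum>i\<in>F. c i * Xa k i \<omega>)"

lemma lin_0: "lin 0 F c \<omega> = 0"
  by (simp add: lin_def Xa_0)

lemma lin_meas:
  assumes "\<And>i. i \<in> F \<Longrightarrow> {i - int k..i} \<subseteq> W"
  shows "lin k F c \<in> borel_measurable (win W)"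
  unfolding lin_def[abs_def]
  using measurable_win_mono[OF Xa_meas assms] by (intro borel_measurable_sum borel_measurable_times) auto

text \<open>The increment at time i uses only innovations in {i - k..i}, so this is a (k +
  1)-dependent sum. The cardinality is replaced by an upper bound b because blocks at the end of the
  sample may be short or empty.\<close>

lemma lin_increment:
  assumes F: "finite F" "card F \<le> b" and c: "\<And>i. \<bar>c i\<bar> \<le> 1" and k: "1 \<le> k"
  shows "moment_le M q (\<lambda>\<omega>. lin k F c \<omega> - lin (k - 1) F c \<omega>)
     (rosenthal_const q * sqrt b * (2 * C / \<rho> * ((real k + 1) * \<rho> ^ k)))"
proof -
  have pos: "0 < 2 * C / \<rho> * \<rho> ^ k" using C \<rho> by simp
  have "moment_le M q (\<lambda>\<omega>. \<Sum>i\<in>F. c i * (Xa k i \<omega> - Xa (k - 1) i \<omega>))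
      (real (k + 1) * (rosenthal_const q * sqrt (card F) * (2 * C / \<rho> * \<rho> ^ k)))"
  proof (rule moment_le_dependent_sum[where W = "\<lambda>i. {i - int k..i}"])
    fix i assume "i \<in> F"
    show "(\<lambda>\<omega>. c i * (Xa k i \<omega> - Xa (k - 1) i \<omega>)) \<in> borel_measurable (win {i - int k..i})"
      using Xa_meas[of k i] measurable_win_mono[OF Xa_meas[of "k - 1" i], of "{i - int k..i}"] by auto
    show "moment_le M q (\<lambda>\<omega>. c i * (Xa k i \<omega> - Xa (k - 1) i \<omega>)) (2 * C / \<rho> * \<rho> ^ k)"
      using q C \<rho> by (intro moment_le_cmult_le Xa_increment k c) auto
    show "expectation (\<lambda>\<omega>. c i * (Xa k i \<omega> - Xa (k - 1) i \<omega>)) = 0"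
      using Xa_mean Xa_integrable by simp
  qed (use q pos F in auto)
  moreover have "(\<lambda>\<omega>. \<Sum>i\<in>F. c i * (Xa k i \<omega> - Xa (k - 1) i \<omega>)) = (\<lambda>\<omega>. lin k F c \<omega> - lin (k - 1) F c \<omega>)"
    by (simp add: lin_def right_diff_distrib sum_subtractf)
  ultimately have "moment_le M q (\<lambda>\<omega>. lin k F c \<omega> - lin (k - 1) F c \<omega>)
      (real (k + 1) * (rosenthal_const q * sqrt (card F) * (2 * C / \<rho> * \<rho> ^ k)))" by simp
  then show ?thesis
  proof (rule moment_le_mono)
    have "real (k + 1) * (rosenthal_const q * sqrt (card F) * (2 * C / \<rho> * \<rho> ^ k))
      \<le> real (k + 1) * (rosenthal_const q * sqrt b * (2 * C / \<rho> * \<rho> ^ k))"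
      using rosenthal_const_ge_1[of q] q pos F by (intro mult_left_mono mult_right_mono) auto
    then show "real (k + 1) * (rosenthal_const q * sqrt (card F) * (2 * C / \<rho> * \<rho> ^ k))
        \<le> rosenthal_const q * sqrt b * (2 * C / \<rho> * ((real k + 1) * \<rho> ^ k))"
      by (simp only: of_nat_add of_nat_1 mult_ac)
  qed (use q C \<rho> rosenthal_const_ge_1[of q] in auto)
qed

text \<open>Telescoping from scale 0 and summing the increments gives the order sqrt b uniformly in
  the scale k, as the factors (k + 1) \<rho>^k are summable.\<close>

lemma lin_moment:
  obtains K where "0 < K"
    "\<forall>k F c b. finite F \<longrightarrow> card F \<le> b \<longrightarrow> 0 < b \<longrightarrow> (\<forall>i. \<bar>c i\<bar> \<le> 1) \<longrightarrow> moment_le M q (lin k F c) (K * sqrt b)"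
    "\<forall>k F c b. finite F \<longrightarrow> card F \<le> b \<longrightarrow> 0 < b \<longrightarrow> (\<forall>i. \<bar>c i\<bar> \<le> 1) \<longrightarrow> 1 \<le> k \<longrightarrow>
       moment_le M q (\<lambda>\<omega>. lin k F c \<omega> - lin (k - 1) F c \<omega>) (K * sqrt b * ((real k + 1) * \<rho> ^ k))"
proof -
  obtain s where s: "0 < s" "\<And>m. (\<Sum>k=1..m. (real k + 4)\<^sup>2 * \<rho> ^ k) \<le> s"
    using sum_poly_geometric_bounded \<rho> by blast
  define K0 where "K0 = rosenthal_const q * (2 * C / \<rho>)"
  have K0: "0 < K0" using rosenthal_const_ge_1[of q] q C \<rho> by (simp add: K0_def)
  define K where "K = K0 + K0 * s"
  have K: "0 < K" "K0 \<le> K" "K0 * s \<le> K" using K0 s by (auto simp: K_def add_pos_pos)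
  show ?thesis
  proof (rule that[OF K(1)]; intro allI impI)
    fix k :: nat and F :: "int set" and c :: "int \<Rightarrow> real" and b :: nat
    assume F: "finite F" "card F \<le> b" and b: "0 < b" and c: "\<forall>i. \<bar>c i\<bar> \<le> 1"
    note c = c[rule_format]
    have inc: "moment_le M q (\<lambda>\<omega>. lin k F c \<omega> - lin (k - 1) F c \<omega>) (K0 * sqrt b * ((real k + 1) * \<rho> ^ k))" if "1 \<le> k" for k
      using lin_increment[OF F, where c=c and k=k] c that by (simp add: K0_def mult_ac)
    show "moment_le M q (\<lambda>\<omega>. lin k F c \<omega> - lin (k - 1) F c \<omega>) (K * sqrt b * ((real k + 1) * \<rho> ^ k))" if "1 \<le> k"
      using inc[OF that] by (rule moment_le_mono) (use K K0 \<rho> q in \<open>auto intro!: mult_right_mono\<close>)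
    have "moment_le M q (\<lambda>\<omega>. \<Sum>l=1..k. lin l F c \<omega> - lin (l - 1) F c \<omega>) (\<Sum>l=1..k. K0 * sqrt b * ((real l + 1) * \<rho> ^ l))"
      using inc q K0 b \<rho> by (intro moment_le_sum) auto
    moreover have "(\<Sum>l=1..k. lin l F c \<omega> - lin (l - 1) F c \<omega>) = lin k F c \<omega>" for \<omega>
      by (induction k) (simp_all add: lin_0)
    ultimately have "moment_le M q (lin k F c) (\<Sum>l=1..k. K0 * sqrt b * ((real l + 1) * \<rho> ^ l))" by simp
    then show "moment_le M q (lin k F c) (K * sqrt b)"
    proof (rule moment_le_mono)
      have "(\<Sum>l=1..k. K0 * sqrt b * ((real l + 1) * \<rho> ^ l)) = K0 * sqrt b * (\<Sum>l=1..k. (real l + 1) * \<rho> ^ l)"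
        by (simp add: sum_distrib_left)
      also have "(\<Sum>l=1..k. (real l + 1) * \<rho> ^ l) \<le> (\<Sum>l=1..k. (real l + 4)\<^sup>2 * \<rho> ^ l)"
        using \<rho> by (intro sum_mono mult_right_mono) (auto simp: power2_eq_square algebra_simps)
      also have "\<dots> \<le> s" by (rule s)
      finally have "(\<Sum>l=1..k. K0 * sqrt b * ((real l + 1) * \<rho> ^ l)) \<le> K0 * sqrt b * s"
        using K0 by (simp add: mult_left_mono)
      also have "\<dots> = K0 * s * sqrt b" by simp
      also have "\<dots> \<le> K * sqrt b" using K by (intro mult_right_mono) auto
      finally show "(\<Sum>l=1..k. K0 * sqrt b * ((real l + 1) * \<rho> ^ l)) \<le> K * sqrt b" .
    qed (use q K0 \<rho> in \<open>auto intro!: sum_nonneg\<close>)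
  qed
qed

section \<open>Products of linear forms over a block and its neighbourhood\<close>

definition bil :: "nat \<Rightarrow> nat \<Rightarrow> nat \<Rightarrow> (int \<Rightarrow> real) \<Rightarrow> (int \<Rightarrow> real) \<Rightarrow> int \<Rightarrow> 'a \<Rightarrow> real" where
  "bil k B n c d r \<omega> = lin k (block B n r) c \<omega> * lin k (neighbourhood B n r) d \<omega>"

lemma bil_0: "bil 0 B n c d r = (\<lambda>_. 0)"
  by (simp add: bil_def lin_0 fun_eq_iff)

lemma bil_meas:
  assumes "{(r - 1) * int B + 1 - int k..(r + 2) * int B} \<subseteq> W"
  shows "bil k B n c d r \<in> borel_measurable (win W)"
proof -
  have "{i - int k..i} \<subseteq> W" if "i \<in> neighbourhood B n r" for i
    using that by (intro order.trans[OF _ assms]) (auto simp: neighbourhood_def)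
  then have "lin k (neighbourhood B n r) d \<in> borel_measurable (win W)"
    "lin k (block B n r) c \<in> borel_measurable (win W)"
    using block_subset_neighbourhood by (blast intro: lin_meas)+
  then show ?thesis unfolding bil_def[abs_def] by simp
qed

lemma bil_integrable: "integrable M (bil k B n c d r)"
proof -
  \<comment> \<open>The added ones keep the bounds positive for zero coefficients and for empty
    F.\<close>
  have lin: "moment_le M q (lin k F c) ((\<Sum>i\<in>F. (\<bar>c i\<bar> + 1) * (2 * C)) + 1)" if "finite F" for F c
  proof (rule moment_le_mono)
    show "moment_le M q (lin k F c) (\<Sum>i\<in>F. (\<bar>c i\<bar> + 1) * (2 * C))"
      unfolding lin_def[abs_def]
    proof (rule moment_le_sum[OF that])
      fix i
      show "moment_le M q (\<lambda>\<omega>. c i * Xa k i \<omega>) ((\<bar>c i\<bar> + 1) * (2 * C))"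
        by (rule moment_le_mono[OF moment_le_cmult[OF Xa_moment]]) (use q C in auto)
    qed (use q C in \<open>auto intro: mult_pos_pos add_nonneg_pos\<close>)
  qed (use q C in \<open>auto intro!: sum_nonneg\<close>)
  have pos: "0 < (\<Sum>i\<in>F. (\<bar>c i\<bar> + 1) * (2 * C)) + 1" for F and c :: "int \<Rightarrow> real"
    using C by (intro add_nonneg_pos sum_nonneg) auto
  have "moment_le M (q / 2) (bil k B n c d r)
      (((\<Sum>i\<in>block B n r. (\<bar>c i\<bar> + 1) * (2 * C)) + 1) * ((\<Sum>i\<in>neighbourhood B n r. (\<bar>d i\<bar> + 1) * (2 * C)) + 1))"
    unfolding bil_def[abs_def] using lin[of "block B n r"] lin[of "neighbourhood B n r"] q pos
    by (intro moment_le_mult) auto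
  then show ?thesis
    by (rule moment_le_integrable(1)) (use q pos in auto)
qed

text \<open>The discrete product rule writes the increment as two products, each with one decaying
  factor. The constant 6 is 2 terms times the 3 of the cardinality bound 3 B.\<close>

lemma bil_moment:
  obtains K where "0 < K"
    "\<forall>k B n c d r. 0 < B \<longrightarrow> (\<forall>i. \<bar>c i\<bar> \<le> 1) \<longrightarrow> (\<forall>i. \<bar>d i\<bar> \<le> 1) \<longrightarrow> 1 \<le> k \<longrightarrow>
       moment_le M (q / 2) (\<lambda>\<omega>. bil k B n c d r \<omega> - bil (k - 1) B n c d r \<omega>) (K * B * ((real k + 1) * \<rho> ^ k))"
proof -
  obtain K where K: "0 < K" and
    lin1: "\<forall>k F c b. finite F \<longrightarrow> card F \<le> b \<longrightarrow> 0 < b \<longrightarrow> (\<forall>i. \<bar>c i\<bar> \<le> 1) \<longrightarrow> moment_le M q (lin k F c) (K * sqrt b)" and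
    lin2: "\<forall>k F c b. finite F \<longrightarrow> card F \<le> b \<longrightarrow> 0 < b \<longrightarrow> (\<forall>i. \<bar>c i\<bar> \<le> 1) \<longrightarrow> 1 \<le> k \<longrightarrow>
       moment_le M q (\<lambda>\<omega>. lin k F c \<omega> - lin (k - 1) F c \<omega>) (K * sqrt b * ((real k + 1) * \<rho> ^ k))"
    using lin_moment by blast
  note lin1 = lin1[rule_format] and lin2 = lin2[rule_format]
  show ?thesis
  proof (rule that[of "6 * K\<^sup>2"]; (intro allI impI)?)
    fix k B n :: nat and c d :: "int \<Rightarrow> real" and r :: int
    assume B: "0 < B" and c: "\<forall>i. \<bar>c i\<bar> \<le> 1" and d: "\<forall>i. \<bar>d i\<bar> \<le> 1"
    note c = c[rule_format] and d = d[rule_format]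
    define I where "I = block B n r"
    define J where "J = neighbourhood B n r"
    have I: "finite I" "card I \<le> 3 * B" and J: "finite J" "card J \<le> 3 * B"
      by (simp_all add: I_def J_def card_block card_neighbourhood)
    have B3: "0 < 3 * B" using B by simp
    have q2: "2 * (q / 2) = q" by simp
    show "moment_le M (q / 2) (\<lambda>\<omega>. bil k B n c d r \<omega> - bil (k - 1) B n c d r \<omega>) (6 * K\<^sup>2 * B * ((real k + 1) * \<rho> ^ k))"
      if k: "1 \<le> k"
    proof -
      define e where "e = (real k + 1) * \<rho> ^ k"
      have e: "0 < e" using \<rho> by (simp add: e_def)
      have 1: "moment_le M (q / 2) (\<lambda>\<omega>. (lin k I c \<omega> - lin (k - 1) I c \<omega>) * lin k J d \<omega>) (K * sqrt (3 * B) * e * (K * sqrt (3 * B)))"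
        using lin2[OF I B3 c k] lin1[OF J B3 d, of k] K B q e by (intro moment_le_mult) (auto simp: e_def)
      have 2: "moment_le M (q / 2) (\<lambda>\<omega>. lin (k - 1) I c \<omega> * (lin k J d \<omega> - lin (k - 1) J d \<omega>)) (K * sqrt (3 * B) * (K * sqrt (3 * B) * e))"
        using lin2[OF J B3 d k] lin1[OF I B3 c, of "k - 1"] K B q e by (intro moment_le_mult) (auto simp: e_def)
      have "moment_le M (q / 2) (\<lambda>\<omega>. (lin k I c \<omega> - lin (k - 1) I c \<omega>) * lin k J d \<omega> + lin (k - 1) I c \<omega> * (lin k J d \<omega> - lin (k - 1) J d \<omega>))
          (K * sqrt (3 * B) * e * (K * sqrt (3 * B)) + K * sqrt (3 * B) * (K * sqrt (3 * B) * e))"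
        using K B q e by (intro moment_le_add 1 2) auto
      also have "K * sqrt (3 * B) * e * (K * sqrt (3 * B)) + K * sqrt (3 * B) * (K * sqrt (3 * B) * e) = 2 * K\<^sup>2 * (sqrt (3 * B))\<^sup>2 * e"
        by (simp add: power2_eq_square)
      also have "\<dots> = 6 * K\<^sup>2 * B * e" by simp
      also have "(\<lambda>\<omega>. (lin k I c \<omega> - lin (k - 1) I c \<omega>) * lin k J d \<omega> + lin (k - 1) I c \<omega> * (lin k J d \<omega> - lin (k - 1) J d \<omega>))
          = (\<lambda>\<omega>. bil k B n c d r \<omega> - bil (k - 1) B n c d r \<omega>)"
        by (simp add: bil_def I_def J_def algebra_simps)
      finally show ?thesis by (simp add: e_def)
    qed
  qed (use K in auto)
qed

definition cbil :: "nat \<Rightarrow> nat \<Rightarrow> nat \<Rightarrow> (int \<Rightarrow> real) \<Rightarrow> (int \<Rightarrow> real) \<Rightarrow> int \<Rightarrow> 'a \<Rightarrow> real" where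
  "cbil k B n c d r \<omega> = bil k B n c d r \<omega> - expectation (bil k B n c d r)"

lemma cbil_meas:
  assumes "{(r - 1) * int B + 1 - int k..(r + 2) * int B} \<subseteq> W"
  shows "cbil k B n c d r \<in> borel_measurable (win W)"
  unfolding cbil_def[abs_def] using bil_meas[OF assms] by simp

text \<open>The multiscale bound is applied once more, now along the block index and in L^(q/2).
  Increments at scale k are (k + 4)-dependent in that index, uniformly in B; this yields the sharp
  order sqrt b * B for b blocks.\<close>

lemma cbil_sum_moment:
  obtains K where "0 < K"
    "\<forall>m B n c d R b. 0 < B \<longrightarrow> (\<forall>i. \<bar>c i\<bar> \<le> 1) \<longrightarrow> (\<forall>i. \<bar>d i\<bar> \<le> 1) \<longrightarrow> finite R \<longrightarrow> card R \<le> b \<longrightarrow>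
       moment_le M (q / 2) (\<lambda>\<omega>. \<Sum>r\<in>R. cbil m B n c d r \<omega>) (K * sqrt b * B)"
proof -
  obtain K where K: "0 < K" and
    inc: "\<forall>k B n c d r. 0 < B \<longrightarrow> (\<forall>i. \<bar>c i\<bar> \<le> 1) \<longrightarrow> (\<forall>i. \<bar>d i\<bar> \<le> 1) \<longrightarrow> 1 \<le> k \<longrightarrow>
       moment_le M (q / 2) (\<lambda>\<omega>. bil k B n c d r \<omega> - bil (k - 1) B n c d r \<omega>) (K * B * ((real k + 1) * \<rho> ^ k))"
    using bil_moment by blast
  note inc = inc[rule_format]
  obtain s where s: "0 < s" "\<And>m. (\<Sum>k=1..m. (real k + 4)\<^sup>2 * \<rho> ^ k) \<le> s"
    using sum_poly_geometric_bounded \<rho> by blast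
  define K' where "K' = rosenthal_const (q / 2) * (3 * K * s)"
  have ros: "1 \<le> rosenthal_const (q / 2)" using rosenthal_const_ge_1[of "q / 2"] q by simp
  show ?thesis
  proof (rule that[of K']; (intro allI impI)?)
    show "0 < K'" using ros K s by (simp add: K'_def)
    fix m B n :: nat and c d :: "int \<Rightarrow> real" and R :: "int set" and b :: nat
    assume B: "0 < B" and c: "\<forall>i. \<bar>c i\<bar> \<le> 1" and d: "\<forall>i. \<bar>d i\<bar> \<le> 1" and R: "finite R" "card R \<le> b"
    note c = c[rule_format] and d = d[rule_format]
    define Z where "Z = (\<lambda>k r \<omega>. cbil k B n c d r \<omega> - cbil (k - 1) B n c d r \<omega>)"
    \<comment> \<open>The bound for the increment of \<open>bil\<close> times 3 for
      centring.\<close>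
    define e where "e = (\<lambda>k. 3 * (K * B * ((real k + 1) * \<rho> ^ k)))"
    have e: "0 < e k" for k using K B \<rho> by (simp add: e_def)
    have tele: "(\<Sum>k=1..m. Z k r \<omega>) = cbil m B n c d r \<omega>" for r \<omega>
      unfolding Z_def by (induction m) (simp_all add: cbil_def bil_0)
    define W where "W = (\<lambda>(k::nat) (r::int). {(r - 1) * int B + 1 - int k..(r + 2) * int B})"
    have "moment_le M (q / 2) (\<lambda>\<omega>. \<Sum>r\<in>R. \<Sum>k=1..m. Z k r \<omega>)
        (rosenthal_const (q / 2) * sqrt (card R) * (\<Sum>k=1..m. real (k + 4) * e k))"
    proof (rule moment_le_multiscale_sum[where W = W and Z = Z and d = "\<lambda>k. k + 4" and c = e])
      fix k :: nat and r :: int assume k: "k \<in> {1..m}"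
      show "Z k r \<in> borel_measurable (win (W k r))"
        unfolding Z_def by (intro borel_measurable_diff cbil_meas) (auto simp: W_def)
      have Zeq: "Z k r = (\<lambda>\<omega>. (bil k B n c d r \<omega> - bil (k - 1) B n c d r \<omega>)
          - expectation (\<lambda>\<omega>. bil k B n c d r \<omega> - bil (k - 1) B n c d r \<omega>))"
        using bil_integrable by (simp add: Z_def cbil_def fun_eq_iff)
      show "moment_le M (q / 2) (Z k r) (e k)"
        unfolding Zeq e_def using k q K B \<rho> by (intro moment_le_center inc c d) auto
      show "expectation (Z k r) = 0"
        using bil_integrable by (simp add: Z_def cbil_def prob_space)
      \<comment> \<open>Neighbourhoods span three blocks, and the windows reach k further
        innovations back, which is at most k blocks because B >= 1.\<close>
      fix r' assume "r + int (k + 4) \<le> r'"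
      then have "(r + int (k + 4) - 1) * int B \<le> (r' - 1) * int B" by (intro mult_right_mono) auto
      moreover have "int k \<le> int k * int B" using B mult_left_mono[of 1 "int B" "int k"] by simp
      ultimately show "W k r \<inter> W k r' = {}"
        using B by (auto simp: W_def algebra_simps)
    qed (use q e R in auto)
    then have "moment_le M (q / 2) (\<lambda>\<omega>. \<Sum>r\<in>R. cbil m B n c d r \<omega>)
        (rosenthal_const (q / 2) * sqrt (card R) * (\<Sum>k=1..m. real (k + 4) * e k))"
      by (simp only: tele)
    then show "moment_le M (q / 2) (\<lambda>\<omega>. \<Sum>r\<in>R. cbil m B n c d r \<omega>) (K' * sqrt b * B)"
    proof (rule moment_le_mono)
      have "(\<Sum>k=1..m. real (k + 4) * e k) = 3 * K * B * (\<Sum>k=1..m. (real k + 4) * (real k + 1) * \<rho> ^ k)"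
        unfolding e_def sum_distrib_left by (intro sum.cong) (simp_all only: of_nat_add of_nat_numeral mult_ac)
      also have "(\<Sum>k=1..m. (real k + 4) * (real k + 1) * \<rho> ^ k) \<le> (\<Sum>k=1..m. (real k + 4)\<^sup>2 * \<rho> ^ k)"
        using \<rho> by (intro sum_mono mult_right_mono) (auto simp: power2_eq_square)
      also have "\<dots> \<le> s" by (rule s)
      finally have *: "(\<Sum>k=1..m. real (k + 4) * e k) \<le> 3 * K * B * s" using K by (simp add: mult_left_mono)
      have "rosenthal_const (q / 2) * sqrt (card R) * (\<Sum>k=1..m. real (k + 4) * e k)
          \<le> rosenthal_const (q / 2) * sqrt b * (3 * K * B * s)"
        using * ros R e by (intro mult_mono mult_left_mono) (auto intro!: sum_nonneg simp: less_imp_le)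
      then show "rosenthal_const (q / 2) * sqrt (card R) * (\<Sum>k=1..m. real (k + 4) * e k) \<le> K' * sqrt b * B"
        by (simp add: K'_def mult_ac)
    qed (use q ros e in \<open>auto intro!: sum_nonneg mult_nonneg_nonneg simp: less_imp_le\<close>)
  qed
qed

text \<open>Consecutive blocks are grouped into superblocks of \<open>m + 4\<close> blocks; superblocks of equal
  parity are independent. The variance proxy of a superblock is of the order of its number of blocks.\<close>

lemma cbil_tail:
  obtains K where "0 < K"
    "\<forall>m B n c d nb T x. 0 < B \<longrightarrow> (\<forall>i. \<bar>c i\<bar> \<le> 1) \<longrightarrow> (\<forall>i. \<bar>d i\<bar> \<le> 1) \<longrightarrow> 0 < T \<longrightarrow>
       prob {\<omega> \<in> space M. 2 * x < \<bar>\<Sum>r\<in>{0..<int nb}. cbil m B n c d r \<omega>\<bar>}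
       \<le> 2 * ((real nb / real (m + 4) + 1) * (K * sqrt (real (m + 4)) * B / T) powr (q / 2)
           + 2 * exp (- x / T + (real nb / real (m + 4) + 1) * ((K * sqrt (real (m + 4)) * B / T) powr (q / 2) + 2 * (K * sqrt (real (m + 4)) * B / T)\<^sup>2)))"
proof -
  obtain K where K: "0 < K" and
    mom: "\<forall>m B n c d R b. 0 < B \<longrightarrow> (\<forall>i. \<bar>c i\<bar> \<le> 1) \<longrightarrow> (\<forall>i. \<bar>d i\<bar> \<le> 1) \<longrightarrow> finite R \<longrightarrow> card R \<le> b \<longrightarrow>
       moment_le M (q / 2) (\<lambda>\<omega>. \<Sum>r\<in>R. cbil m B n c d r \<omega>) (K * sqrt b * B)"
    using cbil_sum_moment by blast
  note mom = mom[rule_format]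
  show ?thesis
  proof (rule that[OF K]; intro allI impI)
    fix m B n nb :: nat and c d :: "int \<Rightarrow> real" and T x :: real
    assume B: "0 < B" and c: "\<forall>i. \<bar>c i\<bar> \<le> 1" and d: "\<forall>i. \<bar>d i\<bar> \<le> 1" and T: "0 < T"
    note c = c[rule_format] and d = d[rule_format]
    define s where "s = m + 4"
    have s: "0 < s" by (simp add: s_def)
    define R where "R = {0..<int nb}"
    define G where "G = (\<lambda>h. {r \<in> R. r div int s = h})"
    define V where "V = (\<lambda>h \<omega>. \<Sum>r\<in>G h. cbil m B n c d r \<omega>)"
    define H where "H = {0..int (nb div s)}"
    have Hfin: "finite H" by (simp add: H_def)
    define v where "v = K * sqrt s * B"
    \<comment> \<open>An upper bound for the number of superblocks of either parity.\<close>
    define h where "h = real nb / s + 1"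
    define E where "E = h * (v / T) powr (q / 2) + 2 * exp (- x / T + h * ((v / T) powr (q / 2) + 2 * (v / T)\<^sup>2))"
    have v: "0 < v" using K s B by (simp add: v_def)
    have Gsub: "G j \<subseteq> {j * int s..<(j + 1) * int s}" for j
    proof
      fix r assume "r \<in> G j"
      then have "r = j * int s + r mod int s" using div_mult_mod_eq[of r "int s"] by (simp add: G_def)
      moreover have "0 \<le> r mod int s" "r mod int s < int s" using s by auto
      ultimately show "r \<in> {j * int s..<(j + 1) * int s}" by (auto simp: algebra_simps)
    qed
    have "finite R" by (simp add: R_def)
    then have Gfin: "finite (G j)" for j by (simp add: G_def)
    have Gcard: "card (G j) \<le> s" for j
    proof -
      have "card (G j) \<le> card {j * int s..<(j + 1) * int s}" by (intro card_mono Gsub) auto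
      then show ?thesis by (simp add: algebra_simps)
    qed
    define W where "W = (\<lambda>j::int. {(j * int s - 1) * int B + 1 - int m..((j + 1) * int s + 1) * int B})"
    have Vmeas: "V j \<in> borel_measurable (win (W j))" for j
      unfolding V_def
    proof (intro borel_measurable_sum cbil_meas)
      fix r assume "r \<in> G j"
      then have r: "j * int s \<le> r" "r + 1 \<le> (j + 1) * int s" using Gsub[of j] by auto
      have "(j * int s - 1) * int B \<le> (r - 1) * int B" using r by (intro mult_right_mono) auto
      moreover have "(r + 2) * int B \<le> ((j + 1) * int s + 1) * int B" using r by (intro mult_right_mono) auto
      ultimately show "{(r - 1) * int B + 1 - int m..(r + 2) * int B} \<subseteq> W j" by (auto simp: W_def)
    qed
    \<comment> \<open>Each window extends its superblock by one block on both sides and by m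
      innovations into the past. The skipped superblock of m + 4 blocks leaves a gap of m + 2 blocks
      after the two extensions.\<close>
    have Wdisj: "W i \<inter> W j = {}" if "i + 2 \<le> j" for i j
    proof -
      have "(i + 2) * int s \<le> j * int s" using that by (intro mult_right_mono) auto
      then have "(i + 1) * int s + 1 + (int m + 2) \<le> j * int s - 1" by (simp add: s_def algebra_simps)
      then have "((i + 1) * int s + 1 + (int m + 2)) * int B \<le> (j * int s - 1) * int B" by (intro mult_right_mono) auto
      moreover have "int m \<le> int m * int B" using B mult_left_mono[of 1 "int B" "int m"] by simp
      ultimately show ?thesis using B by (auto simp: W_def distrib_right)
    qed
    have tail: "prob {\<omega> \<in> space M. x < \<bar>\<Sum>j\<in>{j \<in> H. even j = b}. V j \<omega>\<bar>} \<le> E" for b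
    proof -
      define F where "F = {j \<in> H. even j = b}"
      have F: "finite F" using Hfin by (simp add: F_def)
      have "card F \<le> card H" unfolding F_def by (intro card_mono) (auto simp: H_def)
      also have "\<dots> = nb div s + 1" by (simp add: H_def)
      finally have "real (card F) \<le> real (nb div s) + 1" by simp
      moreover have "real (nb div s) \<le> real nb / s" by (rule of_nat_div_le_of_nat)
      ultimately have cF: "real (card F) \<le> h" by (simp add: h_def)
      have "disjoint_family_on W F"
        unfolding disjoint_family_on_def
      proof (intro ballI impI)
        fix i j assume ij: "i \<in> F" "j \<in> F" "i \<noteq> j"
        then have "even i = even j" by (auto simp: F_def)
        then have "i + 1 \<noteq> j" "j + 1 \<noteq> i" by auto
        then have "i + 2 \<le> j \<or> j + 2 \<le> i" using ij by linarith
        then show "W i \<inter> W j = {}" using Wdisj by blast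
      qed
      then have ind: "indep_vars (\<lambda>_. borel) V F" by (rule indep_vars_win) (rule Vmeas)
      have "prob {\<omega> \<in> space M. x < \<bar>\<Sum>j\<in>F. V j \<omega>\<bar>}
        \<le> card F * (v / T) powr (q / 2) + 2 * exp (- x / T + card F * ((v / T) powr (q / 2) + 2 * (v / T)\<^sup>2))"
      proof (rule indep_sum_tail[OF _ v T F ind])
        show "moment_le M (q / 2) (V j) v" for j
          unfolding V_def v_def using mom[OF B c d Gfin Gcard] .
        show "expectation (V j) = 0" for j
          using bil_integrable by (simp add: V_def cbil_def prob_space)
      qed (use q in simp)
      also have "\<dots> \<le> E"
        unfolding E_def using cF by (intro add_mono mult_left_mono mult_right_mono iffD2[OF exp_le_cancel_iff]) auto
      finally show ?thesis by (simp add: F_def)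
    qed
    have Vm: "V j \<in> borel_measurable M" for j using measurable_win_events[OF Vmeas] .
    define A where "A = (\<lambda>b. {\<omega> \<in> space M. x < \<bar>\<Sum>j\<in>{j \<in> H. even j = b}. V j \<omega>\<bar>})"
    have Am: "A b \<in> events" for b using Vm unfolding A_def by measurable
    have eq: "(\<Sum>r\<in>R. cbil m B n c d r \<omega>) = (\<Sum>j\<in>{j \<in> H. even j = True}. V j \<omega>) + (\<Sum>j\<in>{j \<in> H. even j = False}. V j \<omega>)" for \<omega>
    proof -
      have "(\<lambda>r. r div int s) ` R \<subseteq> H"
        using s by (auto simp: R_def H_def zdiv_int zdiv_mono1 pos_imp_zdiv_nonneg_iff)
      then have "(\<Sum>r\<in>R. cbil m B n c d r \<omega>) = (\<Sum>j\<in>H. V j \<omega>)"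
        unfolding V_def G_def by (intro sum.group[symmetric]) (auto simp: R_def H_def)
      also have "H = {j \<in> H. even j = True} \<union> {j \<in> H. even j = False}" by auto
      also have "(\<Sum>j\<in>\<dots>. V j \<omega>) = (\<Sum>j\<in>{j \<in> H. even j = True}. V j \<omega>) + (\<Sum>j\<in>{j \<in> H. even j = False}. V j \<omega>)"
        using Hfin by (intro sum.union_disjoint) auto
      finally show ?thesis .
    qed
    \<comment> \<open>One of the two parity sums must exceed half of the threshold.\<close>
    have "{\<omega> \<in> space M. 2 * x < \<bar>\<Sum>r\<in>R. cbil m B n c d r \<omega>\<bar>} \<subseteq> A True \<union> A False"
      unfolding eq A_def by auto
    then have "prob {\<omega> \<in> space M. 2 * x < \<bar>\<Sum>r\<in>R. cbil m B n c d r \<omega>\<bar>} \<le> prob (A True \<union> A False)"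
      by (rule finite_measure_mono) (intro sets.Un Am)
    also have "\<dots> \<le> prob (A True) + prob (A False)" by (intro measure_Un_le Am)
    also have "\<dots> \<le> E + E" unfolding A_def by (intro add_mono tail)
    finally show "prob {\<omega> \<in> space M. 2 * x < \<bar>\<Sum>r\<in>{0..<int nb}. cbil m B n c d r \<omega>\<bar>}
       \<le> 2 * ((real nb / real (m + 4) + 1) * (K * sqrt (real (m + 4)) * B / T) powr (q / 2)
           + 2 * exp (- x / T + (real nb / real (m + 4) + 1) * ((K * sqrt (real (m + 4)) * B / T) powr (q / 2) + 2 * (K * sqrt (real (m + 4)) * B / T)\<^sup>2)))"
      by (simp add: R_def E_def h_def v_def s_def add.commute)
  qed
qed

end

text \<open>The exponent condition enters here. Moving n inside the power q / 4 produces n^(4/q +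
  \<eta> - 1) times logarithms, and this exponent is negative.\<close>

lemma tendsto_truncation_term:
  fixes K \<kappa> c \<eta> q :: real
  assumes "0 < K" "0 < \<kappa>" "0 < c" "4 < q" "\<eta> < 1 - 4 / q"
  shows "(\<lambda>n. real n * (K * ((\<kappa> * ln (real n) + 5) * (c * real n powr (\<eta> - 1))) * ln (real n)) powr (q / 4)) \<longlonglongrightarrow> 0"
proof -
  define \<tau> where "\<tau> = 1 - 4 / q - \<eta>"
  have \<tau>: "0 < \<tau>" using assms by (simp add: \<tau>_def)
  have "((\<lambda>n::nat. (K * c * ((\<kappa> * ln (real n) + 5) * ln (real n)) * real n powr (- \<tau>)) powr (q / 4)) \<longlongrightarrow> 0 powr (q / 4)) sequentially"
  proof (rule tendsto_powr')
    show "((\<lambda>n::nat. K * c * ((\<kappa> * ln (real n) + 5) * ln (real n)) * real n powr (- \<tau>)) \<longlongrightarrow> 0) sequentially"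
      using assms \<tau> by real_asymp
    have "\<forall>\<^sub>F n in sequentially. 1 \<le> n" by (rule eventually_ge_at_top)
    then show "0 \<noteq> (0::real) \<or> 0 < q / 4 \<and> (\<forall>\<^sub>F n::nat in sequentially. 0 \<le> K * c * ((\<kappa> * ln (real n) + 5) * ln (real n)) * real n powr (- \<tau>))"
      using assms by (intro disjI2 conjI, simp, elim eventually_mono)
        (auto intro!: mult_nonneg_nonneg add_nonneg_nonneg)
  qed simp_all
  moreover have "\<forall>\<^sub>F n::nat in sequentially. (K * c * ((\<kappa> * ln (real n) + 5) * ln (real n)) * real n powr (- \<tau>)) powr (q / 4)
      = real n * (K * ((\<kappa> * ln (real n) + 5) * (c * real n powr (\<eta> - 1))) * ln (real n)) powr (q / 4)"
    using eventually_ge_at_top[of "1::nat"]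
  proof eventually_elim
    case (elim n)
    have "- \<tau> = 4 / q + (\<eta> - 1)" by (simp add: \<tau>_def)
    then have "real n powr (- \<tau>) = real n powr (4 / q) * real n powr (\<eta> - 1)"
      by (simp only: powr_add)
    then have "(K * c * ((\<kappa> * ln (real n) + 5) * ln (real n)) * real n powr (- \<tau>)) powr (q / 4)
        = (real n powr (4 / q) * (K * ((\<kappa> * ln (real n) + 5) * (c * real n powr (\<eta> - 1))) * ln (real n))) powr (q / 4)"
      by (simp add: mult_ac)
    also have "\<dots> = (real n powr (4 / q)) powr (q / 4) * (K * ((\<kappa> * ln (real n) + 5) * (c * real n powr (\<eta> - 1))) * ln (real n)) powr (q / 4)"
      using elim assms by (intro powr_mult)
    also have "(real n powr (4 / q)) powr (q / 4) = real n" using assms elim by (simp add: powr_powr)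
    finally show ?case .
  qed
  ultimately show ?thesis using assms by (auto intro: Lim_transform_eventually)
qed

section \<open>Choice of the range and of the truncation level\<close>

context weak_dependence
begin

text \<open>The probability carries the factor \<open>B n\<close> in view of a union over
  O(\<open>B n\<close>) frequencies, and the bound is uniform in the coefficients, which depend on
  the frequency. The condition on \<open>m n\<close> keeps the expected approximation error over all
  n^2 pairs bounded.\<close>

lemma cbil_uniform_tail:
  fixes B :: "nat \<Rightarrow> nat" and \<eta> :: real
  assumes B: "\<And>n. 0 < B n" and BO: "(\<lambda>n. real (B n)) \<in> O(\<lambda>n. real n powr \<eta>)" and \<eta>: "\<eta> < 1 - 4 / q"
  obtains K and m :: "nat \<Rightarrow> nat" where "0 < K" "\<forall>n\<ge>1. (real n)\<^sup>2 * \<rho> ^ m n \<le> 1"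
    "\<forall>\<zeta>>0. \<forall>\<^sub>F n in sequentially. \<forall>c d. (\<forall>i. \<bar>c i\<bar> \<le> 1) \<longrightarrow> (\<forall>i. \<bar>d i\<bar> \<le> 1) \<longrightarrow>
       real (B n) * prob {\<omega> \<in> space M. K * sqrt (real n * real (B n) * ln (real n))
          < \<bar>\<Sum>r\<in>{0..<int (n div B n + 1)}. cbil (m n) (B n) n c d r \<omega>\<bar>} \<le> \<zeta>"
proof -
  obtain K where K: "0 < K" and tail: "\<forall>m B n c d nb T x. 0 < B \<longrightarrow> (\<forall>i. \<bar>c i\<bar> \<le> 1) \<longrightarrow> (\<forall>i. \<bar>d i\<bar> \<le> 1) \<longrightarrow> 0 < T \<longrightarrow>
       prob {\<omega> \<in> space M. 2 * x < \<bar>\<Sum>r\<in>{0..<int nb}. cbil m B n c d r \<omega>\<bar>}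
       \<le> 2 * ((real nb / real (m + 4) + 1) * (K * sqrt (real (m + 4)) * B / T) powr (q / 2)
           + 2 * exp (- x / T + (real nb / real (m + 4) + 1) * ((K * sqrt (real (m + 4)) * B / T) powr (q / 2)
               + 2 * (K * sqrt (real (m + 4)) * B / T)\<^sup>2)))"
    using cbil_tail by blast
  note tail = tail[rule_format]
  \<comment> \<open>Chosen so that \<open>\<rho> powr (\<kappa> * ln n)\<close> equals
    n^(-2).\<close>
  define \<kappa> where "\<kappa> = 2 / ln (1 / \<rho>)"
  have \<kappa>: "0 < \<kappa>" using \<rho> by (simp add: \<kappa>_def)
  define m where "m = (\<lambda>n::nat. nat \<lceil>\<kappa> * ln (real n)\<rceil>)"
  \<comment> \<open>6 K^2 compensates the variance term of the exponent; the remaining 2 yields a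
    probability of order n^(-2), enough against a factor \<open>B n\<close> of at most n.\<close>
  define K0 where "K0 = 6 * K\<^sup>2 + 2"
  obtain c0 where c0: "0 < c0" and Bc0: "\<forall>\<^sub>F n in sequentially. norm (real (B n)) \<le> c0 * norm (real n powr \<eta>)"
    using landau_o.bigE[OF BO] by blast
  \<comment> \<open>Dominates (\<open>m n\<close> + 4) * \<open>B n\<close> / n: the 5 consists of
    the 4 in the superblock length and 1 from rounding up.\<close>
  define w where "w = (\<lambda>n::nat. (\<kappa> * ln (real n) + 5) * (c0 * real n powr (\<eta> - 1)))"
  have \<eta>1: "\<eta> < 1" using \<eta> q by (rule_tac less_trans) auto
  have wlim: "w \<longlonglongrightarrow> 0"
    unfolding w_def using \<kappa> c0 \<eta>1 by real_asymp
  define g where "g = (\<lambda>n::nat. real n * (K\<^sup>2 * w n * ln (real n)) powr (q / 4))"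
  have glim: "g \<longlonglongrightarrow> 0"
    unfolding g_def w_def using tendsto_truncation_term[of "K\<^sup>2" \<kappa> c0 q \<eta>] K \<kappa> c0 q \<eta> by simp
  have mbound: "real (m n) \<le> \<kappa> * ln (real n) + 1" if "1 \<le> n" for n
  proof -
    have "0 \<le> \<kappa> * ln (real n)" using \<kappa> that by simp
    then have "real (m n) = of_int \<lceil>\<kappa> * ln (real n)\<rceil>" by (simp add: m_def of_nat_nat)
    then show ?thesis by linarith
  qed
  have prob_le: "real (B n) * prob {\<omega> \<in> space M. 2 * K0 * sqrt (real n * real (B n) * ln (real n))
          < \<bar>\<Sum>r\<in>{0..<int (n div B n + 1)}. cbil (m n) (B n) n c d r \<omega>\<bar>} \<le> 6 * g n + 4 * exp 1 / real n"
    if n: "2 \<le> n" and Bn: "real (B n) \<le> c0 * real n powr \<eta>" and wn: "w n \<le> 1" and gn: "3 * g n \<le> 1"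
      and c: "\<And>i. \<bar>c i\<bar> \<le> 1" and d: "\<And>i. \<bar>d i\<bar> \<le> 1" for n c d
  proof -
    define b where "b = real (B n)"
    define s where "s = real (m n + 4)"
    define nb where "nb = n div B n + 1"
    \<comment> \<open>At this level a threshold \<open>K0 * ln n * T\<close> has order sqrt (n b ln
      n), and its quotient by T is a multiple of ln n.\<close>
    define T where "T = sqrt (real n * b / ln (real n))"
    define h where "h = real nb / s + 1"
    define v where "v = K * sqrt s * b / T"
    have b: "1 \<le> b" using B[of n] by (simp add: b_def Suc_le_eq)
    have s: "4 \<le> s" by (simp add: s_def)
    have ln: "0 < ln (real n)" using n by simp
    have T: "0 < T" using n b ln by (simp add: T_def)
    have T2: "T\<^sup>2 = real n * b / ln (real n)" using n b ln by (simp add: T_def)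
    have "s \<le> \<kappa> * ln (real n) + 5" using mbound[of n] n by (simp add: s_def)
    moreover have "b / real n \<le> c0 * real n powr (\<eta> - 1)"
      using Bn n by (simp add: b_def powr_diff field_simps)
    ultimately have "s * (b / real n) \<le> w n"
      unfolding w_def using s b by (intro mult_mono) auto
    then have sb: "s * b / real n \<le> w n" by simp
    have "b / real n \<le> s * b / real n" using s b n mult_right_mono[of 1 s b] by (intro divide_right_mono) auto
    then have bn: "b / real n \<le> 1" using sb wn by linarith
    then have bn': "b \<le> real n" using n by simp
    have nb: "real nb \<le> real n / b + 1"
      using of_nat_div_le_of_nat[of n "B n"] by (simp add: nb_def b_def)
    have "v\<^sup>2 = K\<^sup>2 * s * b\<^sup>2 / T\<^sup>2" using s by (simp add: v_def power_divide power_mult_distrib)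
    also have "\<dots> = K\<^sup>2 * (s * b / real n) * ln (real n)"
      unfolding T2 using b n ln by (simp add: power2_eq_square)
    finally have v2: "v\<^sup>2 = K\<^sup>2 * (s * b / real n) * ln (real n)" .
    have v0: "0 < v" using K s b T by (simp add: v_def)
    have "v powr (q / 2) = (v\<^sup>2) powr (q / 4)" using v0 by (simp add: powr_powr flip: powr_numeral)
    also have "\<dots> \<le> (K\<^sup>2 * w n * ln (real n)) powr (q / 4)"
      unfolding v2 using K sb ln q s b by (intro powr_mono2 mult_right_mono mult_left_mono) auto
    finally have vp: "v powr (q / 2) \<le> (K\<^sup>2 * w n * ln (real n)) powr (q / 4)" .
    have h0: "0 \<le> h" using s by (simp add: h_def)
    have "real nb / s \<le> real nb / 1" using s by (intro divide_left_mono) auto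
    then have "h \<le> real n / b + 2" using nb by (simp add: h_def)
    then have "b * h \<le> real n + 2 * b" using b mult_left_mono[of h "real n / b + 2" b] by (simp add: field_simps)
    then have bh: "b * h \<le> 3 * real n" using bn' by linarith
    \<comment> \<open>The factor b of the union bound cancels the 1 / b in the number of
      superblocks; what is left is the n in \<open>g n\<close>.\<close>
    have "b * (h * v powr (q / 2)) \<le> 3 * real n * v powr (q / 2)"
      using mult_right_mono[OF bh, of "v powr (q / 2)"] by (simp add: mult.assoc)
    also have "\<dots> \<le> 3 * real n * (K\<^sup>2 * w n * ln (real n)) powr (q / 4)"
      using vp by (intro mult_left_mono) auto
    finally have 1: "b * (h * v powr (q / 2)) \<le> 3 * g n" by (simp add: g_def mult.assoc)
    have "h * v powr (q / 2) \<le> b * (h * v powr (q / 2))"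
      using b h0 mult_right_mono[of 1 b "h * v powr (q / 2)"] by simp
    then have 2: "h * v powr (q / 2) \<le> 1" using 1 gn by linarith
    \<comment> \<open>Superblock count times the variance proxy of one: h * s * b is at most n + b +
      s * b, hence at most 3 n while \<open>w n\<close> <= 1.\<close>
    have "h * s = real nb + s" using s by (simp add: h_def distrib_right)
    moreover have "h * (s * b / real n) = h * s * b / real n" by simp
    ultimately have "h * (s * b / real n) = (real nb * b + s * b) / real n" by (simp only: distrib_right)
    also have "real nb * b \<le> real n + b" using mult_right_mono[OF nb, of b] b by (simp add: distrib_right)
    finally have "h * (s * b / real n) \<le> (real n + b + s * b) / real n" by (simp add: divide_right_mono)
    also have "\<dots> = 1 + b / real n + s * b / real n" using n by (simp add: add_divide_distrib)
    also have "\<dots> \<le> 3" using bn sb wn by linarith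
    finally have "h * (s * b / real n) \<le> 3" .
    then have "K\<^sup>2 * ln (real n) * (h * (s * b / real n)) \<le> K\<^sup>2 * ln (real n) * 3"
      using ln by (intro mult_left_mono) auto
    then have 3: "h * v\<^sup>2 \<le> 3 * K\<^sup>2 * ln (real n)" by (simp add: v2 mult_ac)
    define x where "x = K0 * ln (real n) * T"
    have xT: "x / T = K0 * ln (real n)" using T by (simp add: x_def)
    have "ln (real n) * T = sqrt ((ln (real n))\<^sup>2) * T" using ln by simp
    also have "\<dots> = sqrt (real n * b * ln (real n))"
      unfolding T_def real_sqrt_mult[symmetric] using ln by (simp add: power2_eq_square)
    finally have x: "2 * x = 2 * K0 * sqrt (real n * real (B n) * ln (real n))"
      by (simp add: x_def b_def)
    have "- x / T + h * (v powr (q / 2) + 2 * v\<^sup>2) = - (K0 * ln (real n)) + h * v powr (q / 2) + 2 * (h * v\<^sup>2)"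
      by (simp add: xT[symmetric] algebra_simps)
    also have "\<dots> \<le> - (K0 * ln (real n)) + 1 + 2 * (3 * K\<^sup>2 * ln (real n))" using 2 3 by linarith
    also have "\<dots> = 1 - 2 * ln (real n)" by (simp add: K0_def algebra_simps)
    finally have "exp (- x / T + h * (v powr (q / 2) + 2 * v\<^sup>2)) \<le> exp (1 - 2 * ln (real n))" by simp
    also have "\<dots> = exp 1 / (real n)\<^sup>2"
      using n exp_double[of "ln (real n)"] by (simp add: exp_diff)
    finally have 4: "exp (- x / T + h * (v powr (q / 2) + 2 * v\<^sup>2)) \<le> exp 1 / (real n)\<^sup>2" .
    have "b * prob {\<omega> \<in> space M. 2 * x < \<bar>\<Sum>r\<in>{0..<int nb}. cbil (m n) (B n) n c d r \<omega>\<bar>}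
        \<le> b * (2 * (h * v powr (q / 2) + 2 * exp (- x / T + h * (v powr (q / 2) + 2 * v\<^sup>2))))"
      unfolding h_def v_def s_def b_def using b c d T B by (intro mult_left_mono tail) auto
    also have "\<dots> = 2 * (b * (h * v powr (q / 2))) + 4 * (b * exp (- x / T + h * (v powr (q / 2) + 2 * v\<^sup>2)))"
      by (simp add: algebra_simps)
    also have "\<dots> \<le> 2 * (3 * g n) + 4 * (real n * (exp 1 / (real n)\<^sup>2))"
      by (intro add_mono mult_left_mono[OF 1] mult_left_mono[OF mult_mono[OF bn' 4]]) auto
    also have "\<dots> = 6 * g n + 4 * exp 1 / real n" using n by (simp add: power2_eq_square)
    finally show ?thesis by (simp add: x b_def nb_def)
  qed
  show ?thesis
  proof (rule that[of "2 * K0" m]; (intro allI impI)?)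
    show "0 < 2 * K0" by (simp add: K0_def add_nonneg_pos)
    show "(real n)\<^sup>2 * \<rho> ^ m n \<le> 1" if n: "n \<ge> 1" for n
    proof -
      have "\<kappa> * ln (real n) \<le> real (m n)" unfolding m_def by linarith
      then have "\<rho> powr (real (m n)) \<le> \<rho> powr (\<kappa> * ln (real n))" using \<rho> by (intro powr_mono') auto
      then have "\<rho> ^ m n \<le> \<rho> powr (\<kappa> * ln (real n))" using \<rho> by (simp add: powr_realpow)
      also have "\<dots> = exp (- (2 * ln (real n)))"
        using \<rho> by (simp add: powr_def \<kappa>_def ln_div field_simps)
      also have "\<dots> = 1 / (real n)\<^sup>2"
        using n exp_double[of "ln (real n)"] by (simp add: exp_minus field_simps)
      finally show ?thesis using n by (simp add: field_simps)
    qed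
    fix \<zeta> :: real assume \<zeta>: "0 < \<zeta>"
    have "(\<lambda>n. 6 * g n + 4 * exp 1 / real n) \<longlonglongrightarrow> 6 * 0 + 0"
      by (intro tendsto_intros glim)
    then have "\<forall>\<^sub>F n in sequentially. 6 * g n + 4 * exp 1 / real n < \<zeta>"
      using \<zeta> by (intro order_tendstoD(2)) auto
    moreover have "\<forall>\<^sub>F n in sequentially. w n < 1" using wlim by (rule order_tendstoD) simp
    moreover have "\<forall>\<^sub>F n in sequentially. g n < 1 / 3" using glim by (rule order_tendstoD) simp
    ultimately show "\<forall>\<^sub>F n in sequentially. \<forall>c d. (\<forall>i. \<bar>c i\<bar> \<le> 1) \<longrightarrow> (\<forall>i. \<bar>d i\<bar> \<le> 1) \<longrightarrow>
       real (B n) * prob {\<omega> \<in> space M. 2 * K0 * sqrt (real n * real (B n) * ln (real n))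
          < \<bar>\<Sum>r\<in>{0..<int (n div B n + 1)}. cbil (m n) (B n) n c d r \<omega>\<bar>} \<le> \<zeta>"
      using Bc0 eventually_ge_at_top[of 2]
    proof eventually_elim
      case (elim n)
      show ?case
      proof (intro allI impI)
        fix c d :: "int \<Rightarrow> real" assume "\<forall>i. \<bar>c i\<bar> \<le> 1" "\<forall>i. \<bar>d i\<bar> \<le> 1"
        then have "real (B n) * prob {\<omega> \<in> space M. 2 * K0 * sqrt (real n * real (B n) * ln (real n))
          < \<bar>\<Sum>r\<in>{0..<int (n div B n + 1)}. cbil (m n) (B n) n c d r \<omega>\<bar>} \<le> 6 * g n + 4 * exp 1 / real n"
          using elim by (intro prob_le) auto
        then show "real (B n) * prob {\<omega> \<in> space M. 2 * K0 * sqrt (real n * real (B n) * ln (real n))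
          < \<bar>\<Sum>r\<in>{0..<int (n div B n + 1)}. cbil (m n) (B n) n c d r \<omega>\<bar>} \<le> \<zeta>"
          using elim by linarith
      qed
    qed
  qed
qed

end

section \<open>The spectral estimate\<close>

text \<open>By continuity in the parameter the supremum may be taken over a countable dense
  subset.\<close>

lemma borel_measurable_SUP_interval:
  fixes h :: "real \<Rightarrow> 'a \<Rightarrow> real"
  assumes ab: "a \<le> b" and meas: "\<And>\<theta>. h \<theta> \<in> borel_measurable M"
    and cont: "\<And>\<omega>. \<omega> \<in> space M \<Longrightarrow> continuous_on {a..b} (\<lambda>\<theta>. h \<theta> \<omega>)"
  shows "(\<lambda>\<omega>. SUP \<theta>\<in>{a..b}. h \<theta> \<omega>) \<in> borel_measurable M"
proof -
  obtain T where T: "countable T" "T \<subseteq> {a..b}" "{a..b} \<subseteq> closure T"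
    using separable[of "{a..b}"] by blast
  have clT: "closure T = {a..b}"
    using T closure_minimal[of T "{a..b}"] by auto
  have T0: "T \<noteq> {}" using T ab by auto
  have bdd: "bdd_above ((\<lambda>\<theta>. h \<theta> \<omega>) ` {a..b})" if "\<omega> \<in> space M" for \<omega>
    using compact_continuous_image[OF cont[OF that]] by (intro bounded_imp_bdd_above compact_imp_bounded) auto
  have bddT: "bdd_above ((\<lambda>\<theta>. h \<theta> \<omega>) ` T)" if "\<omega> \<in> space M" for \<omega>
    using bdd[OF that] by (rule bdd_above_mono) (use T in auto)
  have "(SUP \<theta>\<in>{a..b}. h \<theta> \<omega>) = (SUP \<theta>\<in>T. h \<theta> \<omega>)" if \<omega>: "\<omega> \<in> space M" for \<omega>
  proof (rule antisym)
    show "(SUP \<theta>\<in>{a..b}. h \<theta> \<omega>) \<le> (SUP \<theta>\<in>T. h \<theta> \<omega>)"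
    proof (rule cSUP_least)
      fix \<theta> assume "\<theta> \<in> {a..b}"
      then show "h \<theta> \<omega> \<le> (SUP \<theta>\<in>T. h \<theta> \<omega>)"
        using cont[OF \<omega>] clT
        by (intro continuous_le_on_closure[of T "\<lambda>\<theta>. h \<theta> \<omega>" \<theta>] cSUP_upper bddT[OF \<omega>]) auto
    qed (use ab in auto)
    show "(SUP \<theta>\<in>T. h \<theta> \<omega>) \<le> (SUP \<theta>\<in>{a..b}. h \<theta> \<omega>)"
      using T T0 bdd[OF \<omega>] by (intro cSUP_subset_mono) auto
  qed
  moreover have "(\<lambda>\<omega>. SUP \<theta>\<in>T. h \<theta> \<omega>) \<in> borel_measurable M"
    using T meas bddT by (intro borel_measurable_cSUP) auto
  ultimately show ?thesis by (simp cong: measurable_cong)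
qed

text \<open>Blocks as fibres of a map, which lets sums be grouped by them. Time points start at 1,
  hence the i - 1.\<close>

lemma block_eq:
  assumes "0 < B"
  shows "block B n r = {i \<in> {1..int n}. (i - 1) div int B = r}"
proof -
  have iff: "i \<in> {r * int B + 1..(r + 1) * int B} \<longleftrightarrow> (i - 1) div int B = r" for i
  proof
    assume "i \<in> {r * int B + 1..(r + 1) * int B}"
    then have "r * int B + 1 \<le> i" "i \<le> r * int B + int B" by (simp_all add: distrib_right)
    then show "(i - 1) div int B = r"
      by (intro int_div_pos_eq[of _ _ _ "i - 1 - r * int B"]) (simp_all add: mult.commute)
  next
    assume r: "(i - 1) div int B = r"
    have "(i - 1) div int B * int B + (i - 1) mod int B = i - 1" by (rule div_mult_mod_eq)
    then have "r * int B + (i - 1) mod int B = i - 1" unfolding r .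
    moreover have "0 \<le> (i - 1) mod int B" "(i - 1) mod int B < int B" using assms by auto
    moreover have "(r + 1) * int B = r * int B + int B" by (simp add: distrib_right)
    ultimately show "i \<in> {r * int B + 1..(r + 1) * int B}"
      unfolding atLeastAtMost_iff by linarith
  qed
  show ?thesis
    unfolding block_def by (rule set_eqI) (simp only: Int_iff iff mem_Collect_eq conj_commute)
qed

text \<open>The last block is incomplete, and empty when B divides n.\<close>

lemma sum_blocks:
  assumes B: "0 < B"
  shows "(\<Sum>r\<in>{0..<int (n div B + 1)}. \<Sum>i\<in>block B n r. f i) = (\<Sum>i\<in>{1..int n}. f i)"
proof -
  have "(i - 1) div int B \<in> {0..<int (n div B + 1)}" if "i \<in> {1..int n}" for i
  proof -
    have "(i - 1) div int B \<le> int n div int B" using that B by (intro zdiv_mono1) auto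
    then have "(i - 1) div int B < int (n div B + 1)" by (simp add: zdiv_int)
    moreover have "0 \<le> (i - 1) div int B" using that B by (simp add: pos_imp_zdiv_nonneg_iff)
    ultimately show ?thesis by simp
  qed
  then show ?thesis
    unfolding block_eq[OF B] by (intro sum.group) auto
qed

section \<open>From sample autocovariances to forms at grid frequencies\<close>

lemma sum_products_at_lag:
  fixes x :: "int \<Rightarrow> real"
  shows "(\<Sum>j = 1..int n - \<bar>k\<bar>. x j * x (j + \<bar>k\<bar>))
     = (\<Sum>p\<in>{p \<in> {1..int n} \<times> {1..int n}. fst p - snd p = k}. x (fst p) * x (snd p))"
proof (cases "0 \<le> k")
  case True
  then show ?thesis
    by (intro sum.reindex_bij_witness[of _ snd "\<lambda>j. (j + k, j)"]) auto
next
  case False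
  then show ?thesis
    by (intro sum.reindex_bij_witness[of _ fst "\<lambda>j. (j, j - k)"]) auto
qed

text \<open>Sort the pairs (i, j) by their lag i - j. Lags beyond \<open>B n\<close> carry window
  value 0, and for lags of size n or more both sides are empty sums.\<close>

lemma spectral_estimate_eq_double_sum:
  assumes n: "0 < n" and B: "0 < B n" and supp: "\<And>x. 1 \<le> \<bar>x\<bar> \<Longrightarrow> a x = 0"
  defines "g \<equiv> \<lambda>\<theta> t. of_real (a (of_int t * (1 / real (B n)))) * exp (- (\<i> * of_int t * of_real \<theta>))"
  shows "spectral_estimate a B X n \<theta> \<omega>
    = 1 / (2 * of_real pi * of_nat n) * (\<Sum>i\<in>{1..int n}. \<Sum>j\<in>{1..int n}. of_real (X i \<omega> * X j \<omega>) * g \<theta> (i - j))"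
proof -
  define P where "P = {1..int n} \<times> {1..int n}"
  define F where "F = (\<lambda>p. of_real (X (fst p) \<omega> * X (snd p) \<omega>) * g \<theta> (fst p - snd p))"
  define K where "K = {- int (B n)..int (B n)}"
  have g0: "g \<theta> t = 0" if "t \<notin> K" for t
  proof -
    have "real_of_int (int (B n)) \<le> real_of_int \<bar>t\<bar>" using that by (simp only: of_int_le_iff) (auto simp: K_def)
    then have "1 \<le> \<bar>of_int t * (1 / real (B n))\<bar>" using B by (simp add: field_simps)
    then show ?thesis using supp by (simp add: g_def)
  qed
  have lag: "of_nat n * sample_autocov X n k \<omega> = (\<Sum>p\<in>{p \<in> P. fst p - snd p = k}. X (fst p) \<omega> * X (snd p) \<omega>)" for k
    using n sum_products_at_lag[of "\<lambda>i. X i \<omega>" k n] by (simp add: sample_autocov_def P_def)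
  have "(\<Sum>i\<in>{1..int n}. \<Sum>j\<in>{1..int n}. of_real (X i \<omega> * X j \<omega>) * g \<theta> (i - j)) = (\<Sum>p\<in>P. F p)"
    unfolding P_def F_def by (simp add: sum.cartesian_product case_prod_beta)
  also have "\<dots> = (\<Sum>p\<in>{p \<in> P. fst p - snd p \<in> K}. F p)"
    using g0 by (intro sum.mono_neutral_right) (auto simp: P_def F_def)
  also have "\<dots> = (\<Sum>k\<in>K. \<Sum>p\<in>{p \<in> {p \<in> P. fst p - snd p \<in> K}. fst p - snd p = k}. F p)"
    by (intro sum.group[symmetric]) (auto simp: P_def K_def)
  also have "\<dots> = (\<Sum>k\<in>K. (\<Sum>p\<in>{p \<in> P. fst p - snd p = k}. of_real (X (fst p) \<omega> * X (snd p) \<omega>)) * g \<theta> k)"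
    unfolding sum_distrib_right F_def by (intro sum.cong) auto
  also have "\<dots> = (\<Sum>k\<in>K. of_real (of_nat n * sample_autocov X n k \<omega>) * g \<theta> k)"
    by (simp only: lag of_real_sum)
  also have "\<dots> = of_nat n * (\<Sum>k\<in>K. of_real (sample_autocov X n k \<omega>) * g \<theta> k)"
    by (simp add: sum_distrib_left mult.assoc)
  finally show ?thesis
    using n by (simp add: spectral_estimate_def g_def K_def mult.assoc)
qed

text \<open>Not the full double sum with a character: pairs outside the neighbourhoods are dropped,
  although the character does not vanish there. They are dropped before the window is
  expanded.\<close>

definition grid_form :: "nat \<Rightarrow> nat \<Rightarrow> int \<Rightarrow> (int \<Rightarrow> real) \<Rightarrow> complex" where
  "grid_form B n k x = (\<Sum>r\<in>{0..<int (n div B + 1)}. \<Sum>i\<in>block B n r. \<Sum>j\<in>neighbourhood B n r.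
     of_real (x i * x j) * character (4 * B) k (i - j))"

text \<open>The order matters. First the support of g restricts j to the neighbourhood of the block
  of i; only then are all lags below 2 B, where the expansion of g holds.\<close>

lemma double_sum_eq_grid_forms:
  fixes x :: "int \<Rightarrow> real" and g :: "int \<Rightarrow> complex"
  assumes B: "0 < B" and g0: "\<And>t. int B \<le> \<bar>t\<bar> \<Longrightarrow> g t = 0"
    and g: "\<And>t. \<bar>t\<bar> < 2 * int B \<Longrightarrow> g t = (\<Sum>l<N. u l * character (4 * B) (int l - s) t)"
  shows "(\<Sum>i\<in>{1..int n}. \<Sum>j\<in>{1..int n}. of_real (x i * x j) * g (i - j)) = (\<Sum>l<N. u l * grid_form B n (int l - s) x)"
proof -
  have "(\<Sum>i\<in>{1..int n}. \<Sum>j\<in>{1..int n}. of_real (x i * x j) * g (i - j))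
      = (\<Sum>r\<in>{0..<int (n div B + 1)}. \<Sum>i\<in>block B n r. \<Sum>j\<in>{1..int n}. of_real (x i * x j) * g (i - j))"
    by (rule sum_blocks[OF B, symmetric])
  also have "\<dots> = (\<Sum>r\<in>{0..<int (n div B + 1)}. \<Sum>i\<in>block B n r. \<Sum>j\<in>neighbourhood B n r. of_real (x i * x j) * g (i - j))"
  proof (rule sum.cong[OF refl], rule sum.cong[OF refl], rule sum.mono_neutral_right, goal_cases)
    case (3 r i)
    show ?case
    proof
    fix j assume j: "j \<in> {1..int n} - neighbourhood B n r"
    note i = 3(2)
    have "int B \<le> \<bar>i - j\<bar>"
      using i j by (auto simp: block_def neighbourhood_def algebra_simps)
    then show "of_real (x i * x j) * g (i - j) = 0" by (simp add: g0)
    qed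
  qed (auto simp: neighbourhood_def)
  also have "\<dots> = (\<Sum>r\<in>{0..<int (n div B + 1)}. \<Sum>i\<in>block B n r. \<Sum>j\<in>neighbourhood B n r.
      \<Sum>l<N. u l * (of_real (x i * x j) * character (4 * B) (int l - s) (i - j)))"
  proof (intro sum.cong refl)
    fix r i j assume "i \<in> block B n r" "j \<in> neighbourhood B n r"
    then have "\<bar>i - j\<bar> < 2 * int B" by (auto simp: block_def neighbourhood_def algebra_simps)
    then show "of_real (x i * x j) * g (i - j) = (\<Sum>l<N. u l * (of_real (x i * x j) * character (4 * B) (int l - s) (i - j)))"
      by (simp add: g sum_distrib_left mult_ac)
  qed
  also have "\<dots> = (\<Sum>r\<in>{0..<int (n div B + 1)}. \<Sum>i\<in>block B n r. \<Sum>l<N. \<Sum>j\<in>neighbourhood B n r.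
      u l * (of_real (x i * x j) * character (4 * B) (int l - s) (i - j)))"
    by (rule sum.cong[OF refl], rule sum.cong[OF refl], rule sum.swap)
  also have "\<dots> = (\<Sum>r\<in>{0..<int (n div B + 1)}. \<Sum>l<N. \<Sum>i\<in>block B n r. \<Sum>j\<in>neighbourhood B n r.
      u l * (of_real (x i * x j) * character (4 * B) (int l - s) (i - j)))"
    by (rule sum.cong[OF refl], rule sum.swap)
  also have "\<dots> = (\<Sum>l<N. \<Sum>r\<in>{0..<int (n div B + 1)}. \<Sum>i\<in>block B n r. \<Sum>j\<in>neighbourhood B n r.
      u l * (of_real (x i * x j) * character (4 * B) (int l - s) (i - j)))"
    by (rule sum.swap)
  also have "\<dots> = (\<Sum>l<N. u l * grid_form B n (int l - s) x)"
    by (simp add: grid_form_def sum_distrib_left)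
  finally show ?thesis .
qed

definition part :: "bool \<Rightarrow> complex \<Rightarrow> real" where
  "part b z = (if b then Re z else Im z)"

lemma abs_part_character_le: "\<bar>part b (character N k i)\<bar> \<le> 1"
  using abs_Re_le_cmod[of "character N k i"] abs_Im_le_cmod[of "character N k i"]
  by (simp add: part_def)

section \<open>Deviation of the grid forms and of the spectral estimate\<close>

context weak_dependence
begin

lemma X_meas [measurable]: "X i \<in> borel_measurable M"
  using X_moment by (rule moment_leD)

lemma Xa_meas_events [measurable]: "Xa k i \<in> borel_measurable M"
  using Xa_meas by (rule measurable_win_events)

lemma product_moments:
  "moment_le M (q / 2) (\<lambda>\<omega>. X i \<omega> * X j \<omega>) (C * C)"
  "moment_le M (q / 2) (\<lambda>\<omega>. Xa k i \<omega> * Xa k j \<omega>) (2 * C * (2 * C))"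
  using moment_le_mult[of "q / 2" M "X i" C "X j" C] moment_le_mult[of "q / 2" M "Xa k i" "2 * C" "Xa k j" "2 * C"]
    X_moment Xa_moment q C by auto

lemma integrable_products: "integrable M (\<lambda>\<omega>. X i \<omega> * X j \<omega>)" "integrable M (\<lambda>\<omega>. Xa k i \<omega> * Xa k j \<omega>)"
  using moment_le_integrable(1)[OF product_moments(1)] moment_le_integrable(1)[OF product_moments(2)] q C
  by auto

text \<open>Change one factor at a time: this gives the moment bound C^2 \<rho>^k (1 + 2), and the
  first moment costs a factor 2.\<close>

lemma product_difference:
  "expectation (\<lambda>\<omega>. \<bar>X i \<omega> * X j \<omega> - Xa k i \<omega> * Xa k j \<omega>\<bar>) \<le> 6 * C\<^sup>2 * \<rho> ^ k"
proof -
  have 1: "moment_le M (q / 2) (\<lambda>\<omega>. X i \<omega> * (Xa k j \<omega> - X j \<omega>)) (C * (C * \<rho> ^ k))"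
    using X_moment Xa_approx q C \<rho> by (intro moment_le_mult) auto
  have 2: "moment_le M (q / 2) (\<lambda>\<omega>. (Xa k i \<omega> - X i \<omega>) * Xa k j \<omega>) (C * \<rho> ^ k * (2 * C))"
    using Xa_moment Xa_approx q C \<rho> by (intro moment_le_mult) auto
  have "moment_le M (q / 2) (\<lambda>\<omega>. X i \<omega> * (Xa k j \<omega> - X j \<omega>) + (Xa k i \<omega> - X i \<omega>) * Xa k j \<omega>)
      (C * (C * \<rho> ^ k) + C * \<rho> ^ k * (2 * C))"
    using q C \<rho> by (intro moment_le_add 1 2) auto
  from moment_le_integrable(2)[OF this]
  have "expectation (\<lambda>\<omega>. \<bar>X i \<omega> * (Xa k j \<omega> - X j \<omega>) + (Xa k i \<omega> - X i \<omega>) * Xa k j \<omega>\<bar>) \<le> 6 * C\<^sup>2 * \<rho> ^ k"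
    using q C \<rho> by (simp add: add_pos_pos power2_eq_square)
  moreover have "X i \<omega> * (Xa k j \<omega> - X j \<omega>) + (Xa k i \<omega> - X i \<omega>) * Xa k j \<omega> = - (X i \<omega> * X j \<omega> - Xa k i \<omega> * Xa k j \<omega>)" for \<omega>
    by (simp add: algebra_simps)
  ultimately show ?thesis by (simp only: abs_minus_cancel)
qed

text \<open>A random variable free of the frequency that dominates the approximation error of every
  grid form. One application of Markov's inequality then serves all frequencies.\<close>

definition approx_error :: "nat \<Rightarrow> nat \<Rightarrow> 'a \<Rightarrow> real" where
  "approx_error m n \<omega> = (\<Sum>i\<in>{1..int n}. \<Sum>j\<in>{1..int n}. \<bar>X i \<omega> * X j \<omega> - Xa m i \<omega> * Xa m j \<omega>\<bar>)"

lemma approx_error_integrable: "integrable M (approx_error m n)"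
  unfolding approx_error_def[abs_def] using integrable_products by auto

lemma approx_error_nonneg: "0 \<le> approx_error m n \<omega>"
  unfolding approx_error_def by (intro sum_nonneg) auto

lemma approx_error_expectation: "expectation (approx_error m n) \<le> 6 * C\<^sup>2 * ((real n)\<^sup>2 * \<rho> ^ m)"
proof -
  have "expectation (approx_error m n)
      = (\<Sum>i\<in>{1..int n}. \<Sum>j\<in>{1..int n}. expectation (\<lambda>\<omega>. \<bar>X i \<omega> * X j \<omega> - Xa m i \<omega> * Xa m j \<omega>\<bar>))"
    unfolding approx_error_def[abs_def] using integrable_products by (simp add: integral_sum)
  also have "\<dots> \<le> (\<Sum>i\<in>{1..int n}. \<Sum>j\<in>{1..int n}. 6 * C\<^sup>2 * \<rho> ^ m)"
    by (intro sum_mono product_difference)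
  finally show ?thesis by (simp add: power2_eq_square mult_ac)
qed

lemma integrable_grid_form:
  "integrable M (\<lambda>\<omega>. grid_form B n k (\<lambda>i. X i \<omega>))"
  "integrable M (\<lambda>\<omega>. grid_form B n k (\<lambda>i. Xa m i \<omega>))"
  unfolding grid_form_def using integrable_products
  by (auto intro!: Bochner_Integration.integrable_sum integrable_mult_left integrable_of_real simp del: of_real_mult)

lemma grid_form_difference:
  assumes "0 < B"
  shows "cmod (grid_form B n k (\<lambda>i. X i \<omega>) - grid_form B n k (\<lambda>i. Xa m i \<omega>)) \<le> approx_error m n \<omega>"
proof -
  let ?d = "\<lambda>i j. X i \<omega> * X j \<omega> - Xa m i \<omega> * Xa m j \<omega>"
  have "grid_form B n k (\<lambda>i. X i \<omega>) - grid_form B n k (\<lambda>i. Xa m i \<omega>)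
      = (\<Sum>r\<in>{0..<int (n div B + 1)}. \<Sum>i\<in>block B n r. \<Sum>j\<in>neighbourhood B n r. of_real (?d i j) * character (4 * B) k (i - j))"
    by (simp add: grid_form_def left_diff_distrib flip: sum_subtractf)
  also have "cmod \<dots> \<le> (\<Sum>r\<in>{0..<int (n div B + 1)}. \<Sum>i\<in>block B n r. \<Sum>j\<in>neighbourhood B n r. \<bar>?d i j\<bar>)"
    by (intro order.trans[OF norm_sum] sum_mono) (simp add: norm_mult del: of_real_diff of_real_mult)
  also have "\<dots> \<le> (\<Sum>r\<in>{0..<int (n div B + 1)}. \<Sum>i\<in>block B n r. \<Sum>j\<in>{1..int n}. \<bar>?d i j\<bar>)"
    by (intro sum_mono sum_mono2) (auto simp: neighbourhood_def)
  also have "\<dots> = approx_error m n \<omega>"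
    unfolding approx_error_def by (rule sum_blocks[OF assms])
  finally show ?thesis .
qed

text \<open>The character at i - j is the one at i times the conjugate of the one at j; separating
  real and imaginary parts leaves four real products of linear forms.\<close>

lemma grid_form_bil:
  defines "Q \<equiv> \<lambda>m B n k b b' \<omega>. \<Sum>r\<in>{0..<int (n div B + 1)}.
     bil m B n (\<lambda>i. part b (character (4 * B) k i)) (\<lambda>i. part b' (character (4 * B) k i)) r \<omega>"
  shows "Re (grid_form B n k (\<lambda>i. Xa m i \<omega>)) = Q m B n k True True \<omega> + Q m B n k False False \<omega>"
    "Im (grid_form B n k (\<lambda>i. Xa m i \<omega>)) = Q m B n k False True \<omega> - Q m B n k True False \<omega>"
proof -
  have ch: "character (4 * B) k (i - j) = character (4 * B) k i * cnj (character (4 * B) k j)" for i j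
    using character_add_right[of "4 * B" k i "- j"] by (simp add: character_minus)
  show "Re (grid_form B n k (\<lambda>i. Xa m i \<omega>)) = Q m B n k True True \<omega> + Q m B n k False False \<omega>"
    unfolding Q_def grid_form_def ch bil_def lin_def sum_product part_def
    by (simp add: algebra_simps flip: sum.distrib)
  show "Im (grid_form B n k (\<lambda>i. Xa m i \<omega>)) = Q m B n k False True \<omega> - Q m B n k True False \<omega>"
    unfolding Q_def grid_form_def ch bil_def lin_def sum_product part_def
    by (simp add: algebra_simps flip: sum_subtractf)
qed

definition grid_sum :: "nat \<Rightarrow> nat \<Rightarrow> nat \<Rightarrow> int \<Rightarrow> bool \<Rightarrow> bool \<Rightarrow> 'a \<Rightarrow> real" where
  "grid_sum m B n k b b' \<omega> = (\<Sum>r\<in>{0..<int (n div B + 1)}.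
     cbil m B n (\<lambda>i. part b (character (4 * B) k i)) (\<lambda>i. part b' (character (4 * B) k i)) r \<omega>)"

lemma grid_sum_meas: "grid_sum m B n k b b' \<in> borel_measurable M"
  unfolding grid_sum_def[abs_def] using measurable_win_events[OF cbil_meas[OF order.refl]]
  by (intro borel_measurable_sum) auto

text \<open>Real and imaginary part each contribute two grid sums, hence 4 y; the approximation
  error enters once for the sample path and once for the expectation.\<close>

lemma grid_form_deviation:
  assumes B: "0 < B" and y: "\<And>b b'. \<bar>grid_sum m B n k b b' \<omega>\<bar> \<le> y"
    and e: "approx_error m n \<omega> \<le> e" "expectation (approx_error m n) \<le> e"
  shows "cmod (grid_form B n k (\<lambda>i. X i \<omega>) - expectation (\<lambda>\<omega>. grid_form B n k (\<lambda>i. X i \<omega>))) \<le> 4 * y + 2 * e"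
proof -
  let ?X = "\<lambda>\<omega>. grid_form B n k (\<lambda>i. X i \<omega>)"
  let ?A = "\<lambda>\<omega>. grid_form B n k (\<lambda>i. Xa m i \<omega>)"
  note int = integrable_grid_form[of B n k] bil_integrable
  have "Re (?A \<omega> - expectation ?A) = Re (?A \<omega>) - expectation (\<lambda>\<omega>. Re (?A \<omega>))"
    using int by simp
  also have "\<dots> = grid_sum m B n k True True \<omega> + grid_sum m B n k False False \<omega>"
    unfolding grid_form_bil using int by (simp add: grid_sum_def cbil_def sum_subtractf)
  finally have re: "\<bar>Re (?A \<omega> - expectation ?A)\<bar> \<le> 2 * y"
    using y[of True True] y[of False False] by linarith
  have "Im (?A \<omega> - expectation ?A) = Im (?A \<omega>) - expectation (\<lambda>\<omega>. Im (?A \<omega>))"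
    using int by simp
  also have "\<dots> = grid_sum m B n k False True \<omega> - grid_sum m B n k True False \<omega>"
    unfolding grid_form_bil using int by (simp add: grid_sum_def cbil_def sum_subtractf)
  finally have im: "\<bar>Im (?A \<omega> - expectation ?A)\<bar> \<le> 2 * y"
    using y[of False True] y[of True False] by linarith
  have 1: "cmod (?A \<omega> - expectation ?A) \<le> 4 * y"
    using cmod_le[of "?A \<omega> - expectation ?A"] re im by linarith
  have 2: "cmod (?X \<omega> - ?A \<omega>) \<le> e" using grid_form_difference[OF B] e(1) by (rule order.trans)
  have "cmod (expectation ?X - expectation ?A) = cmod (expectation (\<lambda>\<omega>. ?X \<omega> - ?A \<omega>))"
    using int by simp
  also have "\<dots> \<le> expectation (\<lambda>\<omega>. cmod (?X \<omega> - ?A \<omega>))" by (rule integral_norm_bound)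
  also have "\<dots> \<le> expectation (approx_error m n)"
    using int approx_error_integrable grid_form_difference[OF B] by (intro integral_mono) auto
  finally have 3: "cmod (expectation ?X - expectation ?A) \<le> e" using e(2) by simp
  have tri: "cmod (x - x') \<le> cmod (x - z) + cmod (z - z') + cmod (x' - z')" for x x' z z' :: complex
    using norm_triangle_ineq4[of "(x - z) + (z - z')" "x' - z'"] norm_triangle_ineq[of "x - z" "z - z'"] by simp
  show ?thesis using tri[of "?X \<omega>" "expectation ?X" "?A \<omega>" "expectation ?A"] 1 2 3 by linarith
qed

text \<open>The coefficients and the shift s depend on \<theta>, but the indices l - s stay in one
  fixed range and the coefficient sum has one fixed bound. This is the passage from finitely many
  frequencies to all of [0, pi].\<close>

lemma spectral_deviation_le:
  fixes a :: "real \<Rightarrow> real" and L A y :: real and B :: "nat \<Rightarrow> nat"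
  assumes lip: "L-lipschitz_on UNIV a" and supp: "\<And>x. 1 \<le> \<bar>x\<bar> \<Longrightarrow> a x = 0"
    and A: "\<And>x. \<bar>a x\<bar> \<le> A" and B: "0 < B n" and n: "0 < n" and \<theta>: "\<theta> \<in> {0..pi}"
    and y: "\<And>k. k \<in> {- 4 * int (B n)..4 * int (B n)} \<Longrightarrow>
      cmod (grid_form (B n) n k (\<lambda>i. X i \<omega>) - expectation (\<lambda>\<omega>. grid_form (B n) n k (\<lambda>i. X i \<omega>))) \<le> y"
  shows "cmod (spectral_estimate a B X n \<theta> \<omega> - expectation (\<lambda>\<omega>. spectral_estimate a B X n \<theta> \<omega>))
    \<le> 2 * (4 * L + 7 * A) * y / (2 * pi * n)"
proof -
  obtain u s where s: "0 \<le> s" "s \<le> 4 * int (B n)"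
    and u: "\<forall>t. \<bar>t\<bar> < 2 * int (B n) \<longrightarrow> of_real (a (of_int t * (1 / real (B n)))) * exp (- (\<i> * of_int t * of_real \<theta>))
        = (\<Sum>l<4 * B n. u l * character (4 * B n) (int l - s) t)"
    and u_sum: "(\<Sum>l<4 * B n. cmod (u l)) \<le> 2 * (4 * L + 7 * A)"
    by (rule lag_window_expansion[where a = a and A = A, OF lip supp A B \<theta>], assumption, erule (3) that)
  note u = u[rule_format]
  define g where "g = (\<lambda>t. of_real (a (of_int t * (1 / real (B n)))) * exp (- (\<i> * of_int t * of_real \<theta>)))"
  define gf where "gf = (\<lambda>k \<omega>. grid_form (B n) n k (\<lambda>i. X i \<omega>))"
  have int: "integrable M (gf k)" for k unfolding gf_def by (rule integrable_grid_form)
  have vanish: "of_real (a (of_int t * (1 / real (B n)))) * exp (- (\<i> * of_int t * of_real \<theta>)) = 0"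
    if "int (B n) \<le> \<bar>t\<bar>" for t
  proof -
    have "real_of_int (int (B n)) \<le> real_of_int \<bar>t\<bar>" using that by (simp only: of_int_le_iff)
    then have "1 \<le> \<bar>of_int t * (1 / real (B n))\<bar>" using B by (simp add: field_simps)
    then show ?thesis using supp by simp
  qed
  have eq: "spectral_estimate a B X n \<theta> \<omega> = 1 / (2 * of_real pi * of_nat n) * (\<Sum>l<4 * B n. u l * gf (int l - s) \<omega>)" for \<omega>
  proof -
    have "(\<Sum>i\<in>{1..int n}. \<Sum>j\<in>{1..int n}. of_real (X i \<omega> * X j \<omega>) * g (i - j)) = (\<Sum>l<4 * B n. u l * gf (int l - s) \<omega>)"
      unfolding gf_def
    proof (rule double_sum_eq_grid_forms[OF B])
      show "g t = 0" if "int (B n) \<le> \<bar>t\<bar>" for t using vanish[OF that] by (simp only: g_def)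
      show "g t = (\<Sum>l<4 * B n. u l * character (4 * B n) (int l - s) t)" if "\<bar>t\<bar> < 2 * int (B n)" for t
        using u[OF that] by (simp only: g_def)
    qed
    then show ?thesis
      using spectral_estimate_eq_double_sum[where a = a and B = B and n = n and X = X and \<theta> = \<theta> and \<omega> = \<omega>, OF n B] supp
      by (simp only: g_def)
  qed
  have "spectral_estimate a B X n \<theta> \<omega> - expectation (\<lambda>\<omega>. spectral_estimate a B X n \<theta> \<omega>)
      = 1 / (2 * of_real pi * of_nat n) * (\<Sum>l<4 * B n. u l * (gf (int l - s) \<omega> - expectation (gf (int l - s))))"
    unfolding eq using int by (simp add: integral_sum right_diff_distrib sum_subtractf diff_divide_distrib)
  then have "cmod (spectral_estimate a B X n \<theta> \<omega> - expectation (\<lambda>\<omega>. spectral_estimate a B X n \<theta> \<omega>))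
      = cmod (\<Sum>l<4 * B n. u l * (gf (int l - s) \<omega> - expectation (gf (int l - s)))) / (2 * pi * n)"
    by (simp add: norm_divide norm_mult)
  also have "\<dots> \<le> (\<Sum>l<4 * B n. cmod (u l) * y) / (2 * pi * n)"
  proof (intro divide_right_mono order.trans[OF norm_sum] sum_mono)
    fix l assume "l \<in> {..<4 * B n}"
    then have "cmod (gf (int l - s) \<omega> - expectation (gf (int l - s))) \<le> y"
      unfolding gf_def using s by (intro y) auto
    then show "cmod (u l * (gf (int l - s) \<omega> - expectation (gf (int l - s)))) \<le> cmod (u l) * y"
      by (simp add: norm_mult mult_left_mono)
  qed auto
  also have "\<dots> = (\<Sum>l<4 * B n. cmod (u l)) * y / (2 * pi * n)" by (simp add: sum_distrib_right)
  also have "\<dots> \<le> 2 * (4 * L + 7 * A) * y / (2 * pi * n)"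
  proof (intro divide_right_mono mult_right_mono u_sum)
    show "0 \<le> y" by (rule order.trans[OF norm_ge_zero y[of 0]]) simp
  qed auto
  finally show ?thesis .
qed

section \<open>The supremum over frequencies\<close>

definition scaled_deviation :: "(real \<Rightarrow> real) \<Rightarrow> (nat \<Rightarrow> nat) \<Rightarrow> nat \<Rightarrow> real \<Rightarrow> 'a \<Rightarrow> real" where
  "scaled_deviation a B n \<theta> \<omega> = sqrt (real n * (1 / real (B n))) *
     cmod (spectral_estimate a B X n \<theta> \<omega> - (\<integral>\<omega>'. spectral_estimate a B X n \<theta> \<omega>' \<partial>M))"

lemma integrable_sample_autocov: "integrable M (sample_autocov X n k)"
  unfolding sample_autocov_def[abs_def] using integrable_products
  by (intro integrable_mult_right Bochner_Integration.integrable_sum)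

lemma scaled_deviation_meas: "scaled_deviation a B n \<theta> \<in> borel_measurable M"
proof -
  have [measurable]: "sample_autocov X n k \<in> borel_measurable M" for k
    using integrable_sample_autocov by auto
  show ?thesis unfolding scaled_deviation_def[abs_def] spectral_estimate_def by measurable
qed

text \<open>The expectation passes inside the finite sum over lags, so the centring is itself a
  trigonometric polynomial in \<theta>.\<close>

lemma scaled_deviation_continuous: "continuous_on T (\<lambda>\<theta>. scaled_deviation a B n \<theta> \<omega>)"
proof -
  have eq: "(\<integral>\<omega>'. spectral_estimate a B X n \<theta> \<omega>' \<partial>M) = 1 / (2 * of_real pi) *
     (\<Sum>k = - int (B n)..int (B n). of_real (expectation (sample_autocov X n k)) * of_real (a (of_int k * (1 / real (B n)))) * exp (- (\<i> * of_int k * of_real \<theta>)))" for \<theta>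
    unfolding spectral_estimate_def using integrable_sample_autocov by (simp add: integral_sum)
  show ?thesis
    unfolding scaled_deviation_def eq unfolding spectral_estimate_def by (intro continuous_intros)
qed

text \<open>The bound on the supremum is deterministic outside two exceptional events: a large
  \<open>approx_error\<close>, and a large \<open>grid_sum\<close> for some grid index and some
  choice of real and imaginary parts.\<close>

lemma spectral_sup_tail:
  fixes a :: "real \<Rightarrow> real" and B :: "nat \<Rightarrow> nat" and \<eta> :: real
  assumes lip: "L-lipschitz_on UNIV a" and supp: "\<And>x. 1 \<le> \<bar>x\<bar> \<Longrightarrow> a x = 0"
    and A: "\<And>x. \<bar>a x\<bar> \<le> A"
    and B: "\<And>n. 0 < B n" and BO: "(\<lambda>n. real (B n)) \<in> O(\<lambda>n. real n powr \<eta>)" and \<eta>: "\<eta> < 1 - 4 / q"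
  shows "bigO_in_prob M (\<lambda>n \<omega>. SUP \<theta>\<in>{0..pi}. scaled_deviation a B n \<theta> \<omega>) (\<lambda>n. sqrt (ln (real n)))"
proof -
  define Z where "Z = (\<lambda>n \<omega>. SUP \<theta>\<in>{0..pi}. scaled_deviation a B n \<theta> \<omega>)"
  obtain K and m :: "nat \<Rightarrow> nat" where K: "0 < K" and m: "\<forall>n\<ge>1. (real n)\<^sup>2 * \<rho> ^ m n \<le> 1" and
    tail: "\<forall>\<zeta>>0. \<forall>\<^sub>F n in sequentially. \<forall>c d. (\<forall>i. \<bar>c i\<bar> \<le> 1) \<longrightarrow> (\<forall>i. \<bar>d i\<bar> \<le> 1) \<longrightarrow>
       real (B n) * prob {\<omega> \<in> space M. K * sqrt (real n * real (B n) * ln (real n))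
          < \<bar>\<Sum>r\<in>{0..<int (n div B n + 1)}. cbil (m n) (B n) n c d r \<omega>\<bar>} \<le> \<zeta>"
    using cbil_uniform_tail[OF B BO \<eta>] by blast
  note m = m[rule_format] and tail = tail[rule_format]
  define D where "D = 2 * (4 * L + 7 * A) / (2 * pi)"
  have D: "0 \<le> D"
    using lipschitz_on_nonneg[OF lip] A[of 0] by (simp add: D_def)
  \<comment> \<open>4 K + 2 comes from the deviation of a grid form, and D from the coefficient sum
    and the prefactor of the estimate. The 1 makes the constant positive.\<close>
  define K1 where "K1 = D * (4 * K + 2) + 1"
  have K1: "0 < K1" using D K by (simp add: K1_def add_nonneg_pos)
  define y where "y = (\<lambda>n. sqrt (real n * real (B n) * ln (real n)))"
  have yn: "sqrt (real n * ln (real n)) \<le> y n" if "1 \<le> n" for n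
  proof -
    have "real n * 1 * ln (real n) \<le> real n * real (B n) * ln (real n)"
      using that B[of n] by (intro mult_right_mono mult_left_mono) auto
    then show ?thesis by (simp add: y_def)
  qed
  have Zle: "Z n \<omega> \<le> K1 * sqrt (ln (real n))"
    if n: "2 \<le> n" and \<omega>: "\<And>k b b'. k \<in> {- 4 * int (B n)..4 * int (B n)} \<Longrightarrow> \<bar>grid_sum (m n) (B n) n k b b' \<omega>\<bar> \<le> K * y n"
      and e: "approx_error (m n) n \<omega> \<le> y n" "expectation (approx_error (m n) n) \<le> y n" for n \<omega>
  proof -
    have "scaled_deviation a B n \<theta> \<omega> \<le> K1 * sqrt (ln (real n))" if \<theta>: "\<theta> \<in> {0..pi}" for \<theta>
    proof -
      have gf: "cmod (grid_form (B n) n k (\<lambda>i. X i \<omega>) - expectation (\<lambda>\<omega>. grid_form (B n) n k (\<lambda>i. X i \<omega>))) \<le> (4 * K + 2) * y n"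
        if "k \<in> {- 4 * int (B n)..4 * int (B n)}" for k
        using grid_form_deviation[OF B \<omega>[OF that] e] by (simp add: algebra_simps)
      have "scaled_deviation a B n \<theta> \<omega> \<le> sqrt (real n * (1 / real (B n))) * (2 * (4 * L + 7 * A) * ((4 * K + 2) * y n) / (2 * pi * n))"
        unfolding scaled_deviation_def
        using n by (intro mult_left_mono spectral_deviation_le[where a = a and A = A and B = B and n = n, OF lip supp A B _ \<theta> gf]) auto
      also have "\<dots> = D * (4 * K + 2) * (sqrt (real n * (1 / real (B n))) * y n / real n)"
        by (simp add: D_def)
      also have "sqrt (real n * (1 / real (B n))) * y n = sqrt ((real n)\<^sup>2 * ln (real n))"
        using B[of n] by (simp add: y_def power2_eq_square flip: real_sqrt_mult)
      also have "\<dots> = real n * sqrt (ln (real n))" by (simp add: real_sqrt_mult)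
      also have "D * (4 * K + 2) * (real n * sqrt (ln (real n)) / real n) = D * (4 * K + 2) * sqrt (ln (real n))"
        using n by simp
      also have "\<dots> \<le> K1 * sqrt (ln (real n))" using n by (simp add: K1_def mult_right_mono)
      finally show ?thesis .
    qed
    then show ?thesis unfolding Z_def by (intro cSUP_least) auto
  qed
  have Z0: "0 \<le> Z n \<omega>" for n \<omega>
  proof -
    have "bdd_above ((\<lambda>\<theta>. scaled_deviation a B n \<theta> \<omega>) ` {0..pi})"
      using compact_continuous_image[OF scaled_deviation_continuous]
      by (intro bounded_imp_bdd_above compact_imp_bounded) auto
    moreover have "0 \<le> scaled_deviation a B n 0 \<omega>" by (simp add: scaled_deviation_def)
    ultimately show ?thesis unfolding Z_def by (intro cSUP_upper2[of _ _ 0]) auto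
  qed
  have "\<exists>K>0. \<forall>\<^sub>F n in sequentially. prob {\<omega> \<in> space M. K * sqrt (ln (real n)) < \<bar>Z n \<omega>\<bar>} \<le> \<zeta>" if \<zeta>: "0 < \<zeta>" for \<zeta>
  proof (intro exI conjI)
    show "0 < K1" by fact
    \<comment> \<open>72 = 2 * 4 * 9: half of the probability is reserved for the approximation
      error, there are four choices of parts, and 8 \<open>B n\<close> + 1 <= 9 \<open>B n\<close>
      indices.\<close>
    have \<zeta>72: "0 < \<zeta> / 72" using \<zeta> by simp
    \<comment> \<open>Since \<open>y n\<close> is at least sqrt (n ln n), the bound 1 puts the
      expected approximation error below \<open>y n\<close>, and the bound \<zeta> / 2 makes the
      Markov estimate small.\<close>
    have "(\<lambda>n. 6 * C\<^sup>2 / sqrt (real n * ln (real n))) \<longlonglongrightarrow> 0" by real_asymp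
    then have "\<forall>\<^sub>F n in sequentially. 6 * C\<^sup>2 / sqrt (real n * ln (real n)) < min 1 (\<zeta> / 2)"
      using \<zeta> by (intro order_tendstoD(2)) auto
    then show "\<forall>\<^sub>F n in sequentially. prob {\<omega> \<in> space M. K1 * sqrt (ln (real n)) < \<bar>Z n \<omega>\<bar>} \<le> \<zeta>"
      using tail[OF \<zeta>72] eventually_ge_at_top[of 2]
    proof (eventually_elim)
      case (elim n)
      let ?I = "{- 4 * int (B n)..4 * int (B n)}"
      let ?P = "\<lambda>k b b'. {\<omega> \<in> space M. K * y n < \<bar>grid_sum (m n) (B n) n k b b' \<omega>\<bar>}"
      let ?D = "{\<omega> \<in> space M. y n \<le> approx_error (m n) n \<omega>}"
      have n: "2 \<le> n" using elim by simp
      have pos: "0 < sqrt (real n * ln (real n))" using n by simp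
      have ypos: "0 < y n" using yn[of n] pos n by linarith
      have "expectation (approx_error (m n) n) \<le> 6 * C\<^sup>2 * ((real n)\<^sup>2 * \<rho> ^ m n)"
        by (rule approx_error_expectation)
      also have "\<dots> \<le> 6 * C\<^sup>2" using m[of n] n by (simp add: mult_left_le)
      finally have De: "expectation (approx_error (m n) n) \<le> 6 * C\<^sup>2" .
      have "6 * C\<^sup>2 < sqrt (real n * ln (real n))" using elim(1) pos by (simp add: field_simps)
      then have Dy: "expectation (approx_error (m n) n) \<le> y n" using De yn[of n] n by linarith
      have meas: "?P k b b' \<in> events" for k b b' using grid_sum_meas by measurable
      have Dmeas: "?D \<in> events" using approx_error_integrable by measurable
      have "prob ?D \<le> expectation (approx_error (m n) n) / y n"
        by (rule integral_Markov_inequality_measure[OF approx_error_integrable, of "{}"])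
           (use approx_error_nonneg ypos in auto)
      also have "\<dots> \<le> 6 * C\<^sup>2 / sqrt (real n * ln (real n))"
        using De yn[of n] n pos by (intro frac_le) auto
      finally have PD: "prob ?D \<le> \<zeta> / 2" using elim(1) by simp
      have PP: "real (B n) * prob (?P k b b') \<le> \<zeta> / 72" for k b b'
        unfolding grid_sum_def y_def by (rule elim(2)[rule_format]) (rule abs_part_character_le)+
      have card: "real (card ?I) \<le> 9 * real (B n)" using B[of n] by simp
      have "prob (\<Union>k\<in>?I. \<Union>b\<in>UNIV. \<Union>b'\<in>UNIV. ?P k b b') \<le> (\<Sum>k\<in>?I. \<Sum>b\<in>UNIV. \<Sum>b'\<in>UNIV. prob (?P k b b'))"
        by (intro order.trans[OF measure_UNION_le] sum_mono sets.finite_UN meas) auto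
      also have "\<dots> \<le> (\<Sum>k\<in>?I. \<Sum>b\<in>(UNIV :: bool set). \<Sum>b'\<in>(UNIV :: bool set). \<zeta> / 72 / real (B n))"
        using PP B by (intro sum_mono) (simp add: field_simps)
      also have "\<dots> = real (card ?I) * (4 * (\<zeta> / 72 / real (B n)))" by (simp add: UNIV_bool)
      also have "\<dots> \<le> 9 * real (B n) * (4 * (\<zeta> / 72 / real (B n)))"
        using card \<zeta> by (intro mult_right_mono) auto
      also have "\<dots> = \<zeta> / 2" using B[of n] by simp
      finally have PU: "prob (\<Union>k\<in>?I. \<Union>b\<in>UNIV. \<Union>b'\<in>UNIV. ?P k b b') \<le> \<zeta> / 2" .
      have Um: "(\<Union>k\<in>?I. \<Union>b\<in>UNIV. \<Union>b'\<in>UNIV. ?P k b b') \<in> events"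
        by (intro sets.finite_UN meas) auto
      have "{\<omega> \<in> space M. K1 * sqrt (ln (real n)) < \<bar>Z n \<omega>\<bar>} \<subseteq> ?D \<union> (\<Union>k\<in>?I. \<Union>b\<in>UNIV. \<Union>b'\<in>UNIV. ?P k b b')"
      proof (rule subsetI, rule ccontr)
        fix \<omega> assume \<omega>: "\<omega> \<in> {\<omega> \<in> space M. K1 * sqrt (ln (real n)) < \<bar>Z n \<omega>\<bar>}"
          and not: "\<omega> \<notin> ?D \<union> (\<Union>k\<in>?I. \<Union>b\<in>UNIV. \<Union>b'\<in>UNIV. ?P k b b')"
        have "Z n \<omega> \<le> K1 * sqrt (ln (real n))"
        proof (rule Zle[OF n _ _ Dy])
          show "approx_error (m n) n \<omega> \<le> y n" using \<omega> not by auto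
          show "\<bar>grid_sum (m n) (B n) n k b b' \<omega>\<bar> \<le> K * y n" if "k \<in> ?I" for k b b'
            using \<omega> not that by (auto simp: not_less)
        qed
        then show False using \<omega> Z0[of n \<omega>] by simp
      qed
      then have "prob {\<omega> \<in> space M. K1 * sqrt (ln (real n)) < \<bar>Z n \<omega>\<bar>}
          \<le> prob (?D \<union> (\<Union>k\<in>?I. \<Union>b\<in>UNIV. \<Union>b'\<in>UNIV. ?P k b b'))"
        by (rule finite_measure_mono) (intro sets.Un Dmeas Um)
      also have "\<dots> \<le> prob ?D + prob (\<Union>k\<in>?I. \<Union>b\<in>UNIV. \<Union>b'\<in>UNIV. ?P k b b')"
        by (intro measure_Un_le Dmeas Um)
      also have "\<dots> \<le> \<zeta>" using PD PU by linarith
      finally show ?case .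
    qed
  qed
  moreover have "Z n \<in> borel_measurable M" for n
    unfolding Z_def by (intro borel_measurable_SUP_interval scaled_deviation_meas scaled_deviation_continuous) simp
  ultimately show ?thesis
    unfolding bigO_in_prob_def by (simp add: Z_def)
qed

end

text \<open>The set where a is nonzero is open, hence contained in the interior of its closure; so a
  vanishes at the endpoints 1 and -1 too.\<close>

lemma lipschitz_closed_support:
  fixes a :: "real \<Rightarrow> real"
  assumes lip: "L-lipschitz_on UNIV a" and supp: "closure {x. a x \<noteq> 0} = {-1..1}" and x: "1 \<le> \<bar>x\<bar>"
  shows "a x = 0"
proof (rule ccontr)
  assume "a x \<noteq> 0"
  have cont: "continuous_on UNIV a" using lip by (rule lipschitz_on_continuous_on)
  have "open (a -` (- {0}))"
    by (rule continuous_open_vimage) (use cont in \<open>auto simp: continuous_on_eq_continuous_at\<close>)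
  moreover have "a -` (- {0}) \<subseteq> closure {x. a x \<noteq> 0}"
    using closure_subset[of "{x. a x \<noteq> 0}"] by auto
  ultimately have "a -` (- {0}) \<subseteq> interior {-1..1}"
    unfolding supp by (rule interior_maximal[rotated])
  then have "x \<in> {-1<..<1}" using \<open>a x \<noteq> 0\<close> by (auto simp: interior_atLeastAtMost_real)
  then show False using x by auto
qed

theorem theorem3p2:
  fixes M :: "'a measure" and S :: "'s measure"
    and \<epsilon> :: "int \<Rightarrow> 'a \<Rightarrow> 's" and G :: "(nat \<Rightarrow> 's) \<Rightarrow> real"
    and X :: "int \<Rightarrow> 'a \<Rightarrow> real"
    and a :: "real \<Rightarrow> real" and B :: "nat \<Rightarrow> nat"
    and \<alpha> \<delta> \<eta> :: real
  assumes "prob_space M"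
    and "iid M S \<epsilon>"
    and "G \<in> borel_measurable (\<Pi>\<^sub>M j\<in>UNIV. S)"
    and "X = causal_process G \<epsilon>"
    and "\<And>k. (\<integral>\<omega>. X k \<omega> \<partial>M) = 0"
    and "\<alpha> > 0" and "GMC M G \<epsilon> \<alpha>"
    and "0 < \<delta>" and "\<delta> \<le> 4"
    and "\<And>k. integrable M (\<lambda>\<omega>. \<bar>X k \<omega>\<bar> powr (4 + \<delta>))"
    and "\<And>x. a (- x) = a x"
    and "\<exists>L. L-lipschitz_on UNIV a"
    and "closure {x. a x \<noteq> 0} = {-1..1}"
    and "a 0 = 1"
    and "\<And>n. B n > 0"
    and "filterlim B at_top sequentially"
    and "0 < \<eta>" and "\<eta> < \<delta> / (4 + \<delta>)"
    and "(\<lambda>n. real (B n)) \<in> O(\<lambda>n. real n powr \<eta>)"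
    and "(INF \<theta>. Re (spectral_density M X \<theta>)) > 0"
  shows "bigO_in_prob M
    (\<lambda>n \<omega>. SUP \<theta>\<in>{0..pi}. sqrt (real n * (1 / real (B n))) *
        cmod (spectral_estimate a B X n \<theta> \<omega> - (\<integral>\<omega>'. spectral_estimate a B X n \<theta> \<omega>' \<partial>M)))
    (\<lambda>n. sqrt (ln (real n)))"
proof -
  interpret prob_space M by fact
  define \<mu> where "\<mu> = distr M S (\<epsilon> 0)"
  interpret iid_innovations M S \<epsilon> \<mu>
    using assms(2) unfolding iid_def \<mu>_def by unfold_locales auto
  \<comment> \<open>The midpoint between 4 / (1 - \<eta>), above which \<eta> < 1 - 4/q, and the
    available moment order 4 + \<delta>. This interval is nonempty exactly because \<eta> < \<delta>
    / (4 + \<delta>).\<close>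
  define q where "q = (4 / (1 - \<eta>) + (4 + \<delta>)) / 2"
  have "\<delta> / (4 + \<delta>) < 1" using \<open>0 < \<delta>\<close> by simp
  then have \<eta>1: "\<eta> < 1" using \<open>\<eta> < \<delta> / (4 + \<delta>)\<close> by linarith
  have "\<eta> * (4 + \<delta>) < \<delta>" using \<open>\<eta> < \<delta> / (4 + \<delta>)\<close> \<open>0 < \<delta>\<close> by (simp add: pos_less_divide_eq)
  then have "4 < (4 + \<delta>) * (1 - \<eta>)" by (simp add: algebra_simps)
  then have gap: "4 / (1 - \<eta>) < 4 + \<delta>" using \<eta>1 by (simp add: pos_divide_less_eq)
  have "4 < 4 / (1 - \<eta>)" using \<open>0 < \<eta>\<close> \<eta>1 by (simp add: pos_less_divide_eq)
  then have q: "4 < q" "q < 4 + \<delta>" "4 / (1 - \<eta>) < q" using gap by (auto simp: q_def)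
  then have q1: "1 \<le> q" by simp
  have "4 < q * (1 - \<eta>)" using q(3) \<eta>1 by (simp add: pos_divide_less_eq)
  then have \<eta>q: "\<eta> < 1 - 4 / q" using q by (simp add: field_simps)
  obtain L where lip: "L-lipschitz_on UNIV a"
    by (rule exE[OF assms(12)])
  note supp = lipschitz_closed_support[OF lip assms(13)]
  \<comment> \<open>Lipschitz continuity from the value 1 at 0 bounds the window inside its
    support.\<close>
  have A: "\<bar>a x\<bar> \<le> 1 + L" for x
  proof (cases "\<bar>x\<bar> < 1")
    case True
    have "\<bar>a x - a 0\<bar> \<le> L * \<bar>x\<bar>" using lipschitz_onD[OF lip, of x 0] by (simp add: dist_real_def)
    also have "\<dots> \<le> L" using True lipschitz_on_nonneg[OF lip] by (intro mult_left_le) auto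
    finally show ?thesis using \<open>a 0 = 1\<close> by linarith
  qed (use supp lipschitz_on_nonneg[OF lip] in auto)
  obtain Xa :: "nat \<Rightarrow> int \<Rightarrow> 'a \<Rightarrow> real" and C \<rho> where Xa:
    "0 < C" "0 < \<rho>" "\<rho> < 1" "\<forall>i \<omega>. Xa 0 i \<omega> = 0"
    "\<forall>k i. Xa k i \<in> borel_measurable (win {i - int k..i})"
    "\<forall>k i. expectation (Xa k i) = 0"
    "\<forall>k i. moment_le M q (\<lambda>\<omega>. Xa k i \<omega> - X i \<omega>) (C * \<rho> ^ k)"
    by (rule causal_approximation[OF assms(3,4,5,6,7) q1 q(2) assms(10)]) (erule (6) that)
  interpret weak_dependence M S \<epsilon> X Xa q C \<rho>
    by unfold_locales (use q Xa in auto)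
  show ?thesis
    using spectral_sup_tail[OF lip supp A assms(15) assms(19) \<eta>q]
    unfolding scaled_deviation_def .
qed

end
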